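(* Let $\mathcal{C}=L_2(\Sigma_{\mathbf A}^+;\mathbb{R})$ be the set of real-valued 2-locally constant functions on $\Sigma_{\mathbf A}^+$. For $i\in\{1,\dots,N\}$ put $\delta(i)=\#\{j\in\{1,\dots,N\}:\mathbf A_{ij}=1\}$. If $$\#\{i\in\{1,\dots,N\}:\delta(i)=1\}\le 1,$$ then the set $\{f\in\mathcal{C}:[f]_2=[f]_3\}$ contains an open and dense subset of $\mathcal{C}$.
   Context: Let $N\ge 2$ be an integer and $\mathbf A$ an $N\times N$ aperiodic zero-one matrix (some power has all entries positive). $\Sigma_{\mathbf A}^+=\{\omega=(\omega_n)_{n\ge 0}\in\{1,\dots,N\}^{\mathbb{N}\cup\{0\}}:\mathbf A_{\omega_n\omega_{n+1}}=1 \text{ for all } n\ge 0\}$, with metric $d(\omega,\omega')=\sum_{n\ge0}|\omega_n-\omega'_n|/2^n$; $\sigma_{\mathbf A}$ is the shift $(\sigma_{\mathbf A}\omega)_n=\omega_{n+1}$. A function $\phi$ on $\Sigma_{\mathbf A}^+$ is $n$-locally constant if $\phi(\omega)=\phi(\omega')$ whenever $\omega_k=\omega'_k$ for $0\le k\le n-1$. $\mathcal{C}$ is a finite-dimensional real vector space with its usual topology. Gibbs measures: a $\sigma_{\mathbf A}$-invariant Borel probability measure $\mu$ is a Gibbs measure for continuous $f:\Sigma_{\mathbf A}^+\to\mathbb{R}$ if there are $C>0$, $P\in\mathbb{R}$ with $C^{-1}\le \mu(C_n(\omega))/\exp(-nP+\sum_{k=0}^{n-1}f(\sigma_{\mathbf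 A}^k\omega))\le C$ for all $\omega\in\Sigma_{\mathbf A}^+$ and $n\ge1$, where $C_n(\omega)=\{\omega':\omega'_k=\omega_k,\ 0\le k\le n-1\}$. Each Hölder continuous real $f$ (in particular each locally constant one) has a unique Gibbs measure $\mu_f$. Equivalent: $(\Sigma_{\mathbf A}^+,\sigma_{\mathbf A},\mu_f)$ and $(\Sigma_{\mathbf A}^+,\sigma_{\mathbf A},\mu_g)$ are equivalent if there is a homeomorphism $\tau:\Sigma_{\mathbf A}^+\to\Sigma_{\mathbf A}^+$ with $\tau\circ\sigma_{\mathbf A}=\sigma_{\mathbf A}\circ\tau$ and $\mu_f=\mu_g\circ\tau$ (i.e. $\mu_f(B)=\mu_g(\tau(B))$ for Borel $B$). Isomorphic: they are isomorphic if there exist Borel sets $X,Y\subset\Sigma_{\mathbf A}^+$ and a bijection $\Phi:X\to Y$ with $\sigma_{\mathbf A}(X)\subset X$, $\sigma_{\mathbf A}(Y)\subset Y$, $\mu_f(X)=\mu_g(Y)=1$; $\Phi,\Phi^{-1}$ Borel measurable; $\Phi\circ\sigma_{\mathbf A}=\sigma_{\mathbf A}\circ\Phi$ on $X$; $\mu_f=\mu_g\circ\Phi$ (i.e. $\mu_f(B)=\mu_g(\Phi(B))$ for Borel $B\subset X$). Classes: for $f\in\mathcal{C}$, $[f]_2=\{g\in\mathcal{C}:(\Sigma_{\mathbf A}^+,\sigma_{\mathbf A},\mu_f),(\Sigma_{\mathbf A}^+,\sigma_{\mathbf A},\mu_g)\text{ equivalent}\}$ and $[f]_3=\{g\in\mathcal{C}:(\Sigma_{\mathbf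 A}^+,\sigma_{\mathbf A},\mu_f),(\Sigma_{\mathbf A}^+,\sigma_{\mathbf A},\mu_g)\text{ isomorphic}\}$. *)

theory Defs
  imports "HOL-Probability.Probability" "Jordan_Normal_Form.Matrix"
begin

section \<open>One-sided topological Markov shifts\<close>

text \<open>Symbols run over \<open>{1..N}\<close>, whereas \<open>$$\<close> counts rows and columns from 0.\<close>

definition entry :: "nat mat \<Rightarrow> nat \<Rightarrow> nat \<Rightarrow> nat" where
  "entry A i j = A $$ (i - 1, j - 1)"

definition zero_one_matrix :: "nat \<Rightarrow> nat mat \<Rightarrow> bool" where
  "zero_one_matrix N A \<longleftrightarrow>
     A \<in> carrier_mat N N \<and> (\<forall>i\<in>{1..N}. \<forall>j\<in>{1..N}. entry A i j \<in> {0, 1})"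

definition aperiodic :: "nat \<Rightarrow> nat mat \<Rightarrow> bool" where
  "aperiodic N A \<longleftrightarrow> (\<exists>m\<ge>1. \<forall>i\<in>{1..N}. \<forall>j\<in>{1..N}. entry (A ^\<^sub>m m) i j > 0)"

definition out_degree :: "nat \<Rightarrow> nat mat \<Rightarrow> nat \<Rightarrow> nat" where
  "out_degree N A i = card {j \<in> {1..N}. entry A i j = 1}"

definition shift_space :: "nat \<Rightarrow> nat mat \<Rightarrow> (nat \<Rightarrow> nat) set" where
  "shift_space N A =
     {\<omega>. (\<forall>n. \<omega> n \<in> {1..N}) \<and> (\<forall>n. entry A (\<omega> n) (\<omega> (Suc n)) = 1)}"

definition shift :: "(nat \<Rightarrow> nat) \<Rightarrow> (nat \<Rightarrow> nat)" where
  "shift \<omega> = (\<lambda>n. \<omega> (Suc n))"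

text \<open>
  The locale \<open>Metric_space\<close> demands non-negativity and symmetry on the whole type, while the series
  need not converge outside the shift space; the value 0 there is irrelevant to the topology.
\<close>

definition shift_dist :: "nat \<Rightarrow> nat mat \<Rightarrow> (nat \<Rightarrow> nat) \<Rightarrow> (nat \<Rightarrow> nat) \<Rightarrow> real" where
  "shift_dist N A \<omega> \<omega>' =
     (if \<omega> \<in> shift_space N A \<and> \<omega>' \<in> shift_space N A
      then \<Sum>n. \<bar>real (\<omega> n) - real (\<omega>' n)\<bar> / 2 ^ n else 0)"

definition shift_topology :: "nat \<Rightarrow> nat mat \<Rightarrow> (nat \<Rightarrow> nat) topology" where
  "shift_topology N A = Metric_space.mtopology (shift_space N A) (shift_dist N A)"

text \<open>Only the Borel sets of this measure space are used; \<open>sigma\<close> equips it with the zero measure.\<close>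

definition shift_borel :: "nat \<Rightarrow> nat mat \<Rightarrow> (nat \<Rightarrow> nat) measure" where
  "shift_borel N A = sigma (shift_space N A) {U. openin (shift_topology N A) U}"

definition cylinder :: "nat \<Rightarrow> nat mat \<Rightarrow> nat \<Rightarrow> (nat \<Rightarrow> nat) \<Rightarrow> (nat \<Rightarrow> nat) set" where
  "cylinder N A n \<omega> = {\<omega>' \<in> shift_space N A. \<forall>k<n. \<omega>' k = \<omega> k}"


section \<open>Locally constant functions\<close>

text \<open>
  A function on the shift space is represented by its extension by zero to all sequences, so that
  distinct elements of the following set are distinct functions on the shift space.
\<close>

definition locally_constant ::
    "nat \<Rightarrow> nat mat \<Rightarrow> nat \<Rightarrow> ((nat \<Rightarrow> nat) \<Rightarrow> real) set" where
  "locally_constant N A n =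
     {\<phi>. (\<forall>\<omega>\<in>shift_space N A. \<forall>\<omega>'\<in>shift_space N A.
             (\<forall>k<n. \<omega> k = \<omega>' k) \<longrightarrow> \<phi> \<omega> = \<phi> \<omega>') \<and>
          (\<forall>\<omega>. \<omega> \<notin> shift_space N A \<longrightarrow> \<phi> \<omega> = 0)}"

text \<open>
  The usual topology of a finite-dimensional real vector space is the one induced by any norm;
  for a space \<open>\<C>\<close> of bounded functions on the shift space we take the supremum norm. As above, the
  value 0 outside \<open>\<C>\<close> is irrelevant.
\<close>

definition sup_dist ::
    "nat \<Rightarrow> nat mat \<Rightarrow> ((nat \<Rightarrow> nat) \<Rightarrow> real) set
       \<Rightarrow> ((nat \<Rightarrow> nat) \<Rightarrow> real) \<Rightarrow> ((nat \<Rightarrow> nat) \<Rightarrow> real) \<Rightarrow> real" where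
  "sup_dist N A \<C> f g =
     (if f \<in> \<C> \<and> g \<in> \<C> then \<Squnion>\<omega>\<in>shift_space N A. \<bar>f \<omega> - g \<omega>\<bar> else 0)"

definition function_topology ::
    "nat \<Rightarrow> nat mat \<Rightarrow> ((nat \<Rightarrow> nat) \<Rightarrow> real) set \<Rightarrow> ((nat \<Rightarrow> nat) \<Rightarrow> real) topology" where
  "function_topology N A \<C> = Metric_space.mtopology \<C> (sup_dist N A \<C>)"


section \<open>Gibbs measures\<close>

definition is_gibbs ::
    "nat \<Rightarrow> nat mat \<Rightarrow> ((nat \<Rightarrow> nat) \<Rightarrow> real) \<Rightarrow> (nat \<Rightarrow> nat) measure \<Rightarrow> bool" where
  "is_gibbs N A f \<mu> \<longleftrightarrow>
     continuous_map (shift_topology N A) euclideanreal f \<and>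
     prob_space \<mu> \<and> space \<mu> = shift_space N A \<and> sets \<mu> = sets (shift_borel N A) \<and>
     (\<forall>B\<in>sets \<mu>. emeasure \<mu> (shift -` B \<inter> space \<mu>) = emeasure \<mu> B) \<and>
     (\<exists>C P. C > 0 \<and>
        (\<forall>\<omega>\<in>shift_space N A. \<forall>n\<ge>1.
           inverse C \<le> measure \<mu> (cylinder N A n \<omega>)
                         / exp (- real n * P + (\<Sum>k<n. f ((shift ^^ k) \<omega>))) \<and>
           measure \<mu> (cylinder N A n \<omega>)
             / exp (- real n * P + (\<Sum>k<n. f ((shift ^^ k) \<omega>))) \<le> C))"

text \<open>A Hoelder continuous function on an aperiodic shift space has exactly one Gibbs measure.\<close>

definition gibbs_measure ::
    "nat \<Rightarrow> nat mat \<Rightarrow> ((nat \<Rightarrow> nat) \<Rightarrow> real) \<Rightarrow> (nat \<Rightarrow> nat) measure" where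
  "gibbs_measure N A f = (THE \<mu>. is_gibbs N A f \<mu>)"


section \<open>Equivalence and isomorphism\<close>

definition equivalent ::
    "nat \<Rightarrow> nat mat \<Rightarrow> (nat \<Rightarrow> nat) measure \<Rightarrow> (nat \<Rightarrow> nat) measure \<Rightarrow> bool" where
  "equivalent N A \<mu> \<nu> \<longleftrightarrow>
     (\<exists>\<tau>. homeomorphic_map (shift_topology N A) (shift_topology N A) \<tau> \<and>
          (\<forall>\<omega>\<in>shift_space N A. \<tau> (shift \<omega>) = shift (\<tau> \<omega>)) \<and>
          (\<forall>B\<in>sets (shift_borel N A). emeasure \<mu> B = emeasure \<nu> (\<tau> ` B)))"

definition isomorphic ::
    "nat \<Rightarrow> nat mat \<Rightarrow> (nat \<Rightarrow> nat) measure \<Rightarrow> (nat \<Rightarrow> nat) measure \<Rightarrow> bool" where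
  "isomorphic N A \<mu> \<nu> \<longleftrightarrow>
     (\<exists>X\<in>sets (shift_borel N A). \<exists>Y\<in>sets (shift_borel N A). \<exists>\<Phi>.
        bij_betw \<Phi> X Y \<and> shift ` X \<subseteq> X \<and> shift ` Y \<subseteq> Y \<and>
        emeasure \<mu> X = 1 \<and> emeasure \<nu> Y = 1 \<and>
        \<Phi> \<in> restrict_space (shift_borel N A) X \<rightarrow>\<^sub>M restrict_space (shift_borel N A) Y \<and>
        the_inv_into X \<Phi> \<in>
          restrict_space (shift_borel N A) Y \<rightarrow>\<^sub>M restrict_space (shift_borel N A) X \<and>
        (\<forall>\<omega>\<in>X. \<Phi> (shift \<omega>) = shift (\<Phi> \<omega>)) \<and>
        (\<forall>B\<in>sets (shift_borel N A). B \<subseteq> X \<longrightarrow> emeasure \<mu> B = emeasure \<nu> (\<Phi> ` B)))"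

definition equivalence_class ::
    "nat \<Rightarrow> nat mat \<Rightarrow> ((nat \<Rightarrow> nat) \<Rightarrow> real) set \<Rightarrow> ((nat \<Rightarrow> nat) \<Rightarrow> real)
       \<Rightarrow> ((nat \<Rightarrow> nat) \<Rightarrow> real) set" where
  "equivalence_class N A \<C> f =
     {g \<in> \<C>. equivalent N A (gibbs_measure N A f) (gibbs_measure N A g)}"

definition isomorphism_class ::
    "nat \<Rightarrow> nat mat \<Rightarrow> ((nat \<Rightarrow> nat) \<Rightarrow> real) set \<Rightarrow> ((nat \<Rightarrow> nat) \<Rightarrow> real)
       \<Rightarrow> ((nat \<Rightarrow> nat) \<Rightarrow> real) set" where
  "isomorphism_class N A \<C> f =
     {g \<in> \<C>. isomorphic N A (gibbs_measure N A f) (gibbs_measure N A g)}"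


section \<open>The two distances are metrics\<close>

lemma shift_dist_summable:
  assumes "x \<in> shift_space N A" "y \<in> shift_space N A"
  shows "summable (\<lambda>n. \<bar>real (x n) - real (y n)\<bar> / 2 ^ n)"
proof (rule summable_comparison_test')
  show "summable (\<lambda>n. real N * (1 / 2) ^ n)"
    by (intro summable_mult summable_geometric) simp
  fix n
  have "x n \<in> {1..N}" "y n \<in> {1..N}"
    using assms by (auto simp: shift_space_def)
  then have "\<bar>real (x n) - real (y n)\<bar> \<le> real N"
    by auto
  then show "norm (\<bar>real (x n) - real (y n)\<bar> / 2 ^ n) \<le> real N * (1 / 2) ^ n"
    by (simp add: power_divide divide_right_mono)
qed

lemma Metric_space_shift: "Metric_space (shift_space N A) (shift_dist N A)"
proof
  fix x y
  show "0 \<le> shift_dist N A x y"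
    by (auto simp: shift_dist_def intro: suminf_nonneg shift_dist_summable)
  show "shift_dist N A x y = shift_dist N A y x"
    by (auto simp: shift_dist_def abs_minus_commute)
next
  fix x y assume xy: "x \<in> shift_space N A" "y \<in> shift_space N A"
  have "shift_dist N A x y = 0 \<longleftrightarrow> (\<forall>n. \<bar>real (x n) - real (y n)\<bar> / 2 ^ n = 0)"
    using xy by (simp add: shift_dist_def suminf_eq_zero_iff [OF shift_dist_summable])
  also have "\<dots> \<longleftrightarrow> x = y"
    by (auto simp: fun_eq_iff)
  finally show "shift_dist N A x y = 0 \<longleftrightarrow> x = y" .
next
  fix x y z
  assume xyz: "x \<in> shift_space N A" "y \<in> shift_space N A" "z \<in> shift_space N A"
  have "(\<Sum>n. \<bar>real (x n) - real (z n)\<bar> / 2 ^ n)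
          \<le> (\<Sum>n. \<bar>real (x n) - real (y n)\<bar> / 2 ^ n + \<bar>real (y n) - real (z n)\<bar> / 2 ^ n)"
    using xyz
    by (intro suminf_le summable_add shift_dist_summable)
       (auto simp: add_divide_distrib [symmetric] intro!: divide_right_mono)
  also have "\<dots> = (\<Sum>n. \<bar>real (x n) - real (y n)\<bar> / 2 ^ n)
                  + (\<Sum>n. \<bar>real (y n) - real (z n)\<bar> / 2 ^ n)"
    using xyz by (intro suminf_add [symmetric] shift_dist_summable)
  finally show "shift_dist N A x z \<le> shift_dist N A x y + shift_dist N A y z"
    using xyz by (simp add: shift_dist_def)
qed

lemma finite_range_locally_constant:
  assumes "f \<in> locally_constant N A n"
  shows "finite (f ` shift_space N A)"
proof -
  let ?r = "\<lambda>\<omega>. restrict \<omega> {..<n}"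
  have "?r ` shift_space N A \<subseteq> {..<n} \<rightarrow>\<^sub>E {1..N}"
    by (auto simp: shift_space_def simp del: restrict_apply intro!: restrict_PiE_iff [THEN iffD2])
  then have fin: "finite (?r ` shift_space N A)"
    by (rule finite_subset) (auto intro: finite_PiE)
  have "f \<omega> = f (inv_into (shift_space N A) ?r (?r \<omega>))" if w: "\<omega> \<in> shift_space N A" for \<omega>
  proof -
    let ?w = "inv_into (shift_space N A) ?r (?r \<omega>)"
    have m: "?w \<in> shift_space N A"
      by (rule inv_into_into) (use w in blast)
    have "?r ?w = ?r \<omega>"
      by (rule f_inv_into_f [where f = ?r and A = "shift_space N A"]) (use w in blast)
    then have "\<forall>k<n. \<omega> k = ?w k"
      by (metis lessThan_iff restrict_apply')
    with m w assms show ?thesis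
      unfolding locally_constant_def by blast
  qed
  then have "f ` shift_space N A
      \<subseteq> (\<lambda>u. f (inv_into (shift_space N A) ?r u)) ` ?r ` shift_space N A"
    by (auto simp only: image_image intro!: image_eqI)
  then show ?thesis
    using fin by (meson finite_imageI finite_subset)
qed

lemma bdd_above_sup_dist:
  assumes "f \<in> locally_constant N A n" "g \<in> locally_constant N A n"
  shows "bdd_above ((\<lambda>\<omega>. \<bar>f \<omega> - g \<omega>\<bar>) ` shift_space N A)"
proof (rule bdd_above_finite, rule finite_subset)
  show "(\<lambda>\<omega>. \<bar>f \<omega> - g \<omega>\<bar>) ` shift_space N A
          \<subseteq> (\<lambda>(a, b). \<bar>a - b\<bar>) ` (f ` shift_space N A \<times> g ` shift_space N A)"
    by force
  show "finite \<dots>"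
    using assms by (intro finite_imageI finite_cartesian_product finite_range_locally_constant)
qed

lemma Metric_space_locally_constant:
  assumes ne: "shift_space N A \<noteq> {}"
  shows "Metric_space (locally_constant N A n) (sup_dist N A (locally_constant N A n))"
proof
  fix f g
  show "0 \<le> sup_dist N A (locally_constant N A n) f g"
  proof -
    obtain \<omega> where "\<omega> \<in> shift_space N A"
      using ne by blast
    then show ?thesis
      by (auto simp: sup_dist_def intro!: cSUP_upper2 bdd_above_sup_dist)
  qed
  show "sup_dist N A (locally_constant N A n) f g = sup_dist N A (locally_constant N A n) g f"
    by (auto simp: sup_dist_def abs_minus_commute)
next
  fix f g assume fg: "f \<in> locally_constant N A n" "g \<in> locally_constant N A n"
  show "sup_dist N A (locally_constant N A n) f g = 0 \<longleftrightarrow> f = g"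
  proof
    assume 0: "sup_dist N A (locally_constant N A n) f g = 0"
    show "f = g"
    proof
      fix \<omega>
      show "f \<omega> = g \<omega>"
      proof (cases "\<omega> \<in> shift_space N A")
        case True
        then have "\<bar>f \<omega> - g \<omega>\<bar> \<le> sup_dist N A (locally_constant N A n) f g"
          using fg by (auto simp: sup_dist_def intro!: cSUP_upper bdd_above_sup_dist)
        with 0 show ?thesis by simp
      next
        case False
        with fg show ?thesis by (simp add: locally_constant_def)
      qed
    qed
  next
    assume "f = g"
    then show "sup_dist N A (locally_constant N A n) f g = 0"
      using ne by (simp add: sup_dist_def)
  qed
next
  fix f g h
  assume fgh: "f \<in> locally_constant N A n" "g \<in> locally_constant N A n"
    "h \<in> locally_constant N A n"
  have "(\<Squnion>\<omega>\<in>shift_space N A. \<bar>f \<omega> - h \<omega>\<bar>)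
      \<le> (\<Squnion>\<omega>\<in>shift_space N A. \<bar>f \<omega> - g \<omega>\<bar>) + (\<Squnion>\<omega>\<in>shift_space N A. \<bar>g \<omega> - h \<omega>\<bar>)"
  proof (rule cSUP_least [OF ne])
    fix \<omega> assume w: "\<omega> \<in> shift_space N A"
    have "\<bar>f \<omega> - h \<omega>\<bar> \<le> \<bar>f \<omega> - g \<omega>\<bar> + \<bar>g \<omega> - h \<omega>\<bar>"
      by simp
    also have "\<dots> \<le> (\<Squnion>\<omega>\<in>shift_space N A. \<bar>f \<omega> - g \<omega>\<bar>) + (\<Squnion>\<omega>\<in>shift_space N A. \<bar>g \<omega> - h \<omega>\<bar>)"
      using w fgh by (intro add_mono cSUP_upper bdd_above_sup_dist)
    finally show "\<bar>f \<omega> - h \<omega>\<bar> \<le> \<dots>" .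
  qed
  then show "sup_dist N A (locally_constant N A n) f h
      \<le> sup_dist N A (locally_constant N A n) f g + sup_dist N A (locally_constant N A n) g h"
    using fgh by (simp add: sup_dist_def)
qed

end

(*
  Subtracting a coboundary and a constant turns a 2-locally constant f into log q, where
  q i j = Prob(omega_0 = i | omega_1 = j) is the backward transition kernel of its Gibbs measure,
  a Markov measure. The function q (omega_0) (omega_1) is the inverse of the Jacobian of the
  shift, so isomorphisms preserve it almost everywhere. Generically (an open and dense condition
  on f) q separates all edges i -> j except the forced ones, where i is the only predecessor of j
  and q = 1. If q is such, counting values shows that the kernel of any isomorphic Gibbs measure is
  as well. By aperiodicity, any m consecutive edges include an unforced one for some m, and from
  an unforced edge the path is determined backwards along forced edges. Hence the isomorphism
  and its inverse are, on sets of full measure, given by block maps and extend to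
  homeomorphisms.
*)
theory Submission
  imports Defs
begin

text \<open>The classes quantify over every \<open>g\<close>, and \<open>gibbs_measure\<close> is a
  definite description, so nothing can be said before existence and uniqueness of the Gibbs measure
  is known for every 2-locally constant function; this is why Markov measures are constructed and
  shown to be ergodic. The backward kernel is preferred to the forward one because the shift is
  one-sided: prefixing a symbol \<open>i\<close> to paths starting in \<open>j\<close> multiplies
  the measure by exactly \<open>q i j\<close>, with no ratio of stationary weights. The obstacle is
  that an isomorphism is defined almost everywhere only; to extend it continuously, a window of
  bounded length has to fix each symbol of the image. Forced edges carry the value 1 for every
  \<open>f\<close>, so no genericity removes their ambiguity; the bound on the window comes from the
  exponent in the definition of aperiodicity. Openness of the condition needs Perron data that vary
  continuously with \<open>f\<close>, which is obtained from an explicit estimate in place of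
  spectral perturbation theory.\<close>

locale markov_shift =
  fixes N :: nat and A :: "nat mat"
  assumes two_le_N: "2 \<le> N"
    and zero_one: "zero_one_matrix N A"
    and aperiodic: "aperiodic N A"
begin

abbreviation states :: "nat set" where
  "states \<equiv> {1..N}"

abbreviation \<Omega> :: "(nat \<Rightarrow> nat) set" where
  "\<Omega> \<equiv> shift_space N A"

abbreviation cyl :: "nat \<Rightarrow> (nat \<Rightarrow> nat) \<Rightarrow> (nat \<Rightarrow> nat) set" where
  "cyl \<equiv> cylinder N A"

abbreviation \<B> :: "(nat \<Rightarrow> nat) measure" where
  "\<B> \<equiv> shift_borel N A"

section \<open>Paths in the transition graph\<close>

definition edge :: "nat \<Rightarrow> nat \<Rightarrow> bool" where
  "edge i j \<longleftrightarrow> i \<in> states \<and> j \<in> states \<and> entry A i j = 1"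

lemma edge_states: "edge i j \<Longrightarrow> i \<in> states \<and> j \<in> states"
  by (simp add: edge_def)

lemma shift_space_iff: "\<omega> \<in> \<Omega> \<longleftrightarrow> (\<forall>n. edge (\<omega> n) (\<omega> (Suc n)))"
  by (auto simp: shift_space_def edge_def)

lemma shift_space_states: "\<omega> \<in> \<Omega> \<Longrightarrow> \<omega> n \<in> states"
  by (simp add: shift_space_def)

lemma shift_space_edge: "\<omega> \<in> \<Omega> \<Longrightarrow> edge (\<omega> n) (\<omega> (Suc n))"
  by (simp add: shift_space_iff)

lemma states_nonempty: "states \<noteq> {}"
  using two_le_N by auto

lemma power_entry_path:
  assumes "i \<in> states" "j \<in> states" "entry (A ^\<^sub>m m) i j > 0"
  shows "(edge ^^ m) i j"
  using assms
proof (induction m arbitrary: j)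
  case 0
  have "A \<in> carrier_mat N N" using zero_one by (simp add: zero_one_matrix_def)
  with 0 show ?case by (auto simp: entry_def split: if_splits)
next
  case (Suc m)
  have A: "A \<in> carrier_mat N N" using zero_one by (simp add: zero_one_matrix_def)
  then have Am: "A ^\<^sub>m m \<in> carrier_mat N N" by simp
  have "entry (A ^\<^sub>m Suc m) i j
      = (\<Sum>k = 0..<N. (A ^\<^sub>m m) $$ (i - 1, k) * A $$ (k, j - 1))"
    using A Am Suc.prems by (auto simp: entry_def scalar_prod_def)
  with Suc.prems(3) obtain k where k: "k < N" "(A ^\<^sub>m m) $$ (i - 1, k) * A $$ (k, j - 1) > 0"
    by (metis (no_types, lifting) atLeastLessThan_iff gr_zeroI sum.neutral)
  \<comment> \<open>The summation index counts from 0, so it stands for the symbol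
    \<open>Suc k\<close>.\<close>
  then have "entry (A ^\<^sub>m m) i (Suc k) > 0" "entry A (Suc k) j > 0"
    by (auto simp: entry_def)
  moreover have "Suc k \<in> states" using k by auto
  moreover from this have "entry A (Suc k) j \<in> {0, 1}"
    using zero_one Suc.prems(2) unfolding zero_one_matrix_def by blast
  ultimately have "edge (Suc k) j" "(edge ^^ m) i (Suc k)"
    using Suc.IH[of "Suc k"] Suc.prems(1,2) by (auto simp: edge_def[of "Suc k"])
  then show ?case by auto
qed

lemma primitive: obtains m where "1 \<le> m" "\<And>i j. i \<in> states \<Longrightarrow> j \<in> states \<Longrightarrow> (edge ^^ m) i j"
  using aperiodic power_entry_path unfolding aperiodic_def by blast

lemma ex_successor: "i \<in> states \<Longrightarrow> \<exists>j. edge i j"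
proof -
  assume i: "i \<in> states"
  obtain m where m: "1 \<le> m" "\<And>i j. i \<in> states \<Longrightarrow> j \<in> states \<Longrightarrow> (edge ^^ m) i j"
    using primitive by blast
  with i have "(edge ^^ Suc (m - 1)) i i" by simp
  then show ?thesis by (metis relpowp_Suc_D2)
qed

lemma ex_path_from: assumes "i \<in> states" shows "\<exists>\<omega>\<in>\<Omega>. \<omega> 0 = i"
proof -
  define s where "s i = (SOME j. edge i j)" for i
  have s: "edge i (s i)" if "i \<in> states" for i
    unfolding s_def using ex_successor[OF that] by (rule someI_ex)
  have st: "(s ^^ n) i \<in> states" for n
    by (induction n) (use assms s edge_states in auto)
  have "(\<lambda>n. (s ^^ n) i) \<in> \<Omega>"
    unfolding shift_space_iff using s st by simp
  then show ?thesis by (rule rev_bexI) simp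
qed

lemma shift_space_nonempty: "\<Omega> \<noteq> {}"
  using ex_path_from states_nonempty by blast

lemma cons_in_shift_space: "edge i (\<omega> 0) \<Longrightarrow> \<omega> \<in> \<Omega> \<Longrightarrow> case_nat i \<omega> \<in> \<Omega>"
  unfolding shift_space_iff by (auto split: nat.split)

lemma shift_cons [simp]: "shift (case_nat i \<omega>) = \<omega>"
  by (simp add: shift_def)

lemma cons_shift: "case_nat (\<omega> 0) (shift \<omega>) = \<omega>"
  by (auto simp: shift_def fun_eq_iff split: nat.split)

lemma ex_edge_path: assumes "edge i j" shows "\<exists>\<omega>\<in>\<Omega>. \<omega> 0 = i \<and> \<omega> 1 = j"
proof -
  obtain \<omega> where "\<omega> \<in> \<Omega>" "\<omega> 0 = j" using ex_path_from assms edge_states by blast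
  with assms show ?thesis
    by (intro bexI[of _ "case_nat i \<omega>"]) (auto intro: cons_in_shift_space)
qed

lemma shift_in: "\<omega> \<in> \<Omega> \<Longrightarrow> shift \<omega> \<in> \<Omega>"
  by (simp add: shift_space_iff shift_def)

lemma shift_pow: "(shift ^^ k) \<omega> n = \<omega> (n + k)"
  by (induction k arbitrary: n) (auto simp: shift_def)

lemma shift_pow_in: "\<omega> \<in> \<Omega> \<Longrightarrow> (shift ^^ k) \<omega> \<in> \<Omega>"
  by (induction k) (auto simp: shift_in)

lemma shift_pow_Suc: "(shift ^^ Suc k) \<omega> = (shift ^^ k) (shift \<omega>)"
  by (simp add: funpow_swap1)

lemma mem_cyl: "\<eta> \<in> cyl n \<omega> \<longleftrightarrow> \<eta> \<in> \<Omega> \<and> (\<forall>k<n. \<eta> k = \<omega> k)"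
  by (simp add: cylinder_def)

lemma cyl_subset: "cyl n \<omega> \<subseteq> \<Omega>"
  by (auto simp: mem_cyl)

lemma cyl_0 [simp]: "cyl 0 \<omega> = \<Omega>"
  by (auto simp: mem_cyl)

subsection \<open>Topology and Borel sets\<close>

text \<open>Distinct symbols differ by at least 1, so a disagreement at \<open>k\<close> alone
  already contributes \<open>1 / 2 ^ k\<close> to the distance.\<close>

lemma dist_small_agree:
  assumes "\<omega> \<in> \<Omega>" "\<eta> \<in> \<Omega>" "shift_dist N A \<omega> \<eta> < 1 / 2 ^ n" "k \<le> n"
  shows "\<eta> k = \<omega> k"
proof (rule ccontr)
  assume ne: "\<eta> k \<noteq> \<omega> k"
  have "1 / 2 ^ n \<le> (1 / 2 ^ k :: real)" using \<open>k \<le> n\<close> by (simp add: field_simps)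
  also have "\<dots> \<le> \<bar>real (\<omega> k) - real (\<eta> k)\<bar> / 2 ^ k"
    using ne by (intro divide_right_mono) auto
  also have "\<dots> = (\<Sum>n\<in>{k}. \<bar>real (\<omega> n) - real (\<eta> n)\<bar> / 2 ^ n)" by simp
  also have "\<dots> \<le> (\<Sum>n. \<bar>real (\<omega> n) - real (\<eta> n)\<bar> / 2 ^ n)"
    by (intro sum_le_suminf shift_dist_summable[OF assms(1,2)]) auto
  also have "\<dots> < 1 / 2 ^ n" using assms by (simp add: shift_dist_def)
  finally show False by simp
qed

text \<open>All terms before \<open>n\<close> vanish and the others are at most
  \<open>N / 2 ^ k\<close>; the factor 2 is the sum of the geometric series.\<close>

lemma agree_dist_small:
  assumes "\<omega> \<in> \<Omega>" "\<eta> \<in> \<Omega>" "\<And>k. k < n \<Longrightarrow> \<eta> k = \<omega> k"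
  shows "shift_dist N A \<omega> \<eta> \<le> 2 * real N / 2 ^ n"
proof -
  let ?t = "\<lambda>n. \<bar>real (\<omega> n) - real (\<eta> n)\<bar> / 2 ^ n"
  have sm: "summable ?t" by (rule shift_dist_summable[OF assms(1,2)])
  have "shift_dist N A \<omega> \<eta> = (\<Sum>k. ?t (k + n)) + (\<Sum>k<n. ?t k)"
    using assms(1,2) suminf_split_initial_segment[OF sm] by (simp add: shift_dist_def)
  also have "(\<Sum>k<n. ?t k) = 0" using assms(3) by simp
  also have "(\<Sum>k. ?t (k + n)) \<le> (\<Sum>k. (real N / 2 ^ n) * (1/2) ^ k)"
  proof (intro suminf_le)
    fix k
    have "\<omega> (k + n) \<in> states" "\<eta> (k + n) \<in> states" using assms shift_space_states by blast+
    then have "\<bar>real (\<omega> (k+n)) - real (\<eta> (k+n))\<bar> \<le> real N" by auto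
    then show "?t (k + n) \<le> (real N / 2 ^ n) * (1/2) ^ k"
      by (simp add: field_simps power_add)
  qed (use summable_ignore_initial_segment[OF sm] in \<open>auto intro!: summable_mult summable_geometric\<close>)
  also have "\<dots> = 2 * real N / 2 ^ n"
    by (subst suminf_mult) (auto simp: suminf_geometric)
  finally show ?thesis by simp
qed

text \<open>Balls and cylinders contain each other by the two preceding estimates. Openness is a
  matter of prefixes from here on.\<close>

lemma openin_shift_iff:
  "openin (shift_topology N A) U \<longleftrightarrow> U \<subseteq> \<Omega> \<and> (\<forall>\<omega>\<in>U. \<exists>n. cyl n \<omega> \<subseteq> U)"
proof -
  interpret Metric_space \<Omega> "shift_dist N A" by (rule Metric_space_shift)
  have 1: "\<exists>n. cyl n \<omega> \<subseteq> U" if "\<omega> \<in> \<Omega>" "r > 0" "mball \<omega> r \<subseteq> U" for \<omega> r U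
  proof -
    have "(\<lambda>n. 2 * real N * (1/2) ^ n) \<longlonglongrightarrow> 2 * real N * 0"
      by (intro tendsto_intros) auto
    then have "eventually (\<lambda>n. 2 * real N * (1/2) ^ n < r) sequentially"
      using \<open>r > 0\<close> by (intro order_tendstoD) auto
    then obtain n where n: "2 * real N * (1/2) ^ n < r"
      by (meson eventually_sequentially order_refl)
    have "cyl n \<omega> \<subseteq> mball \<omega> r"
    proof
      fix \<eta> assume "\<eta> \<in> cyl n \<omega>"
      then have "\<eta> \<in> \<Omega>" "\<And>k. k < n \<Longrightarrow> \<eta> k = \<omega> k" by (auto simp: mem_cyl)
      then have "shift_dist N A \<omega> \<eta> \<le> 2 * real N / 2 ^ n"
        using agree_dist_small that(1) by blast
      also have "\<dots> < r" using n by (simp add: power_divide)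
      finally show "\<eta> \<in> mball \<omega> r" using \<open>\<eta> \<in> \<Omega>\<close> that(1) by simp
    qed
    with that show ?thesis by blast
  qed
  have 2: "\<exists>r>0. mball \<omega> r \<subseteq> U" if "\<omega> \<in> \<Omega>" "cyl n \<omega> \<subseteq> U" for \<omega> n U
  proof (intro exI[of _ "1 / 2 ^ n"] conjI)
    have "mball \<omega> (1 / 2 ^ n) \<subseteq> cyl n \<omega>"
      using dist_small_agree[of \<omega> _ n] by (auto simp: mem_cyl less_imp_le)
    with that show "mball \<omega> (1 / 2 ^ n) \<subseteq> U" by blast
  qed simp
  show ?thesis
    unfolding shift_topology_def openin_mtopology using 1 2 by (meson subsetD)
qed

lemma topspace_shift [simp]: "topspace (shift_topology N A) = \<Omega>"
proof -
  interpret Metric_space \<Omega> "shift_dist N A" by (rule Metric_space_shift)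
  show ?thesis by (simp add: shift_topology_def)
qed

lemma openin_cyl: "openin (shift_topology N A) (cyl n \<omega>)"
  unfolding openin_shift_iff by (auto simp: mem_cyl intro!: exI[of _ n])

definition cylinders :: "(nat \<Rightarrow> nat) set set" where
  "cylinders = (\<Union>n. cyl n ` \<Omega>)"

lemma finite_cyl_image: "finite (cyl n ` \<Omega>)"
proof -
  have "cyl n ` \<Omega> \<subseteq> cyl n ` ({..<n} \<rightarrow>\<^sub>E states)"
  proof
    fix C assume "C \<in> cyl n ` \<Omega>"
    then obtain \<omega> where w: "\<omega> \<in> \<Omega>" "C = cyl n \<omega>" by blast
    then have "C = cyl n (restrict \<omega> {..<n})" by (auto simp: cylinder_def)
    moreover have "restrict \<omega> {..<n} \<in> {..<n} \<rightarrow>\<^sub>E states"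
      using w shift_space_states by (auto simp del: atLeastAtMost_iff)
    ultimately show "C \<in> cyl n ` ({..<n} \<rightarrow>\<^sub>E states)" by blast
  qed
  then show ?thesis
    by (rule finite_subset) (auto intro!: finite_imageI finite_PiE)
qed

lemma countable_cylinders: "countable cylinders"
  unfolding cylinders_def using finite_cyl_image by (auto intro: countable_finite)

lemma open_is_Union_cylinders:
  assumes "openin (shift_topology N A) U"
  shows "U = \<Union>{C \<in> cylinders. C \<subseteq> U}"
proof
  show "U \<subseteq> \<Union>{C \<in> cylinders. C \<subseteq> U}"
  proof
    fix \<omega> assume w: "\<omega> \<in> U"
    then obtain n where "cyl n \<omega> \<subseteq> U" "\<omega> \<in> \<Omega>" using assms unfolding openin_shift_iff by blast
    moreover have "\<omega> \<in> cyl n \<omega>" using \<open>\<omega> \<in> \<Omega>\<close> by (simp add: mem_cyl)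
    ultimately show "\<omega> \<in> \<Union>{C \<in> cylinders. C \<subseteq> U}" unfolding cylinders_def by blast
  qed
qed blast

lemma space_shift_borel [simp]: "space \<B> = \<Omega>"
  unfolding shift_borel_def by (rule space_measure_of) (auto simp: openin_shift_iff)

lemma sets_shift_borel_open: "sets \<B> = sigma_sets \<Omega> {U. openin (shift_topology N A) U}"
  unfolding shift_borel_def by (rule sets_measure_of) (auto simp: openin_shift_iff)

text \<open>There are only countably many cylinders, so every open set is a countable union of
  them.\<close>

lemma sets_shift_borel: "sets \<B> = sigma_sets \<Omega> cylinders"
  unfolding sets_shift_borel_open
proof
  have "U \<in> sigma_sets \<Omega> cylinders" if "openin (shift_topology N A) U" for U
  proof (subst open_is_Union_cylinders[OF that], rule sigma_sets_UNION)
    show "countable {C \<in> cylinders. C \<subseteq> U}" using countable_cylinders by simp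
  qed auto
  then show "sigma_sets \<Omega> {U. openin (shift_topology N A) U} \<subseteq> sigma_sets \<Omega> cylinders"
    by (intro sigma_sets_mono) auto
  show "sigma_sets \<Omega> cylinders \<subseteq> sigma_sets \<Omega> {U. openin (shift_topology N A) U}"
    by (intro sigma_sets_mono') (auto simp: cylinders_def openin_cyl)
qed

lemma cyl_measurable [measurable]: "cyl n \<omega> \<in> sets \<B>"
  unfolding sets_shift_borel_open using openin_cyl by auto

lemma measurable_shift_borelI:
  assumes "\<And>x. x \<in> space M \<Longrightarrow> g x \<in> \<Omega>"
    and "\<And>n \<omega>. \<omega> \<in> \<Omega> \<Longrightarrow> g -` cyl n \<omega> \<inter> space M \<in> sets M"
  shows "g \<in> M \<rightarrow>\<^sub>M \<B>"
proof (rule measurable_sigma_sets[OF sets_shift_borel])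
  show "cylinders \<subseteq> Pow \<Omega>" using cyl_subset by (auto simp: cylinders_def)
qed (use assms in \<open>auto simp: cylinders_def\<close>)

definition start :: "nat \<Rightarrow> (nat \<Rightarrow> nat) set" where
  "start i = {\<omega> \<in> \<Omega>. \<omega> 0 = i}"

lemma mem_start: "\<omega> \<in> start i \<longleftrightarrow> \<omega> \<in> \<Omega> \<and> \<omega> 0 = i"
  by (simp add: start_def)

lemma coordinate_sets: "{\<omega> \<in> \<Omega>. \<omega> n = i} \<in> sets \<B>"
proof -
  have "openin (shift_topology N A) {\<omega> \<in> \<Omega>. \<omega> n = i}"
    unfolding openin_shift_iff by (auto simp: mem_cyl intro!: exI[of _ "Suc n"])
  then show ?thesis unfolding sets_shift_borel_open by auto
qed

lemma start_measurable [measurable]: "start i \<in> sets \<B>"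
  unfolding start_def by (rule coordinate_sets)

lemma shift_preimage_cyl:
  assumes "\<omega> \<in> \<Omega>" shows "shift -` cyl n \<omega> \<inter> \<Omega> \<in> sets \<B>"
proof -
  have "openin (shift_topology N A) (shift -` cyl n \<omega> \<inter> \<Omega>)"
    unfolding openin_shift_iff
    by (auto simp: mem_cyl shift_def shift_in intro!: exI[of _ "Suc n"])
      (auto simp: shift_space_iff)
  then show ?thesis unfolding sets_shift_borel_open by auto
qed

lemma shift_measurable [measurable]: "shift \<in> \<B> \<rightarrow>\<^sub>M \<B>"
  by (rule measurable_shift_borelI) (auto simp: shift_in shift_preimage_cyl)

lemma shift_pow_measurable [measurable]: "(shift ^^ k) \<in> \<B> \<rightarrow>\<^sub>M \<B>"
  by (induction k) auto

lemma preimage_shift_pow_sets: "B \<in> sets \<B> \<Longrightarrow> (shift ^^ k) -` B \<inter> \<Omega> \<in> sets \<B>"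
  using measurable_sets[OF shift_pow_measurable] by simp

lemma preimage_shift_sets: "B \<in> sets \<B> \<Longrightarrow> shift -` B \<inter> \<Omega> \<in> sets \<B>"
  using measurable_sets[OF shift_measurable] by simp

subsection \<open>Comparing measures on cylinders\<close>

text \<open>These are the unions of cylinders of length \<open>n\<close>. The length is recorded
  because measures are compared on cylinders of one common length.\<close>

definition clopen_level :: "nat \<Rightarrow> (nat \<Rightarrow> nat) set \<Rightarrow> bool" where
  "clopen_level n D \<longleftrightarrow> D \<subseteq> \<Omega> \<and> (\<forall>\<omega>\<in>D. cyl n \<omega> \<subseteq> D)"

lemma clopen_level_mono: "clopen_level n D \<Longrightarrow> n \<le> m \<Longrightarrow> clopen_level m D"
  unfolding clopen_level_def by (fastforce simp: mem_cyl subset_iff)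

lemma clopen_level_Diff: "clopen_level n D \<Longrightarrow> clopen_level n (\<Omega> - D)"
  unfolding clopen_level_def by (fastforce simp: mem_cyl subset_iff)

lemma clopen_level_sets: "clopen_level n D \<Longrightarrow> D \<in> sets \<B>"
  unfolding sets_shift_borel_open
  by (rule sigma_sets.Basic) (auto simp: clopen_level_def openin_shift_iff)

lemma clopen_level_partition:
  assumes "clopen_level n D" shows "D = \<Union>(cyl n ` D)" "disjoint_family_on id (cyl n ` D)"
    "finite (cyl n ` D)"
proof -
  show "D = \<Union>(cyl n ` D)" using assms unfolding clopen_level_def by (fastforce simp: mem_cyl)
  show "disjoint_family_on id (cyl n ` D)"
    unfolding disjoint_family_on_def
  proof (intro ballI impI)
    fix C C' assume "C \<in> cyl n ` D" "C' \<in> cyl n ` D" "C \<noteq> C'"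
    then show "id C \<inter> id C' = {}" by (auto simp: cylinder_def)
  qed
  show "finite (cyl n ` D)"
    by (rule finite_subset[OF _ finite_cyl_image[of n]]) (use assms clopen_level_def in blast)
qed

lemma finite_UN_clopen_level:
  assumes "\<And>i. i < (k::nat) \<Longrightarrow> \<exists>n. clopen_level n (D i)"
  shows "\<exists>n. clopen_level n (\<Union>i<k. D i)"
  using assms
proof (induction k)
  case 0 then show ?case by (auto simp: clopen_level_def)
next
  case (Suc k)
  then obtain n m where "clopen_level n (\<Union>i<k. D i)" "clopen_level m (D k)" by (meson less_Suc_eq)
  then have "clopen_level (max n m) (\<Union>i<k. D i)" "clopen_level (max n m) (D k)"
    using clopen_level_mono by (meson max.cobounded1 max.cobounded2)+
  then have "clopen_level (max n m) (D k \<union> (\<Union>i<k. D i))"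
    unfolding clopen_level_def by blast
  then show ?case by (auto simp: lessThan_Suc)
qed

text \<open>Approximation in two measures at once, so that an inequality between them on clopen sets
  passes to Borel sets.\<close>

lemma clopen_approximation:
  assumes "finite_measure M1" "finite_measure M2" "sets M1 = sets \<B>" "sets M2 = sets \<B>"
    and "B \<in> sets \<B>" "e > 0"
  shows "\<exists>D n. clopen_level n D \<and> measure M1 (sym_diff B D) < e \<and> measure M2 (sym_diff B D) < e"
proof -
  interpret M1: finite_measure M1 by fact
  interpret M2: finite_measure M2 by fact
  note [simp] = assms(3,4)
  have "B \<in> sigma_sets \<Omega> cylinders" using assms(5) by (simp add: sets_shift_borel)
  then show ?thesis using \<open>e > 0\<close>
  proof (induction arbitrary: e)
    case (Basic C)
    then obtain n \<omega> where "C = cyl n \<omega>" unfolding cylinders_def by blast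
    then have "clopen_level n C" by (auto simp: clopen_level_def mem_cyl)
    with Basic show ?case by (intro exI[of _ C] exI[of _ n]) auto
  next
    case Empty
    then show ?case by (intro exI[of _ "{}"] exI[of _ 0]) (auto simp: clopen_level_def)
  next
    case (Compl a)
    then obtain D n where D: "clopen_level n D" "measure M1 (sym_diff a D) < e"
      "measure M2 (sym_diff a D) < e" by blast
    have "a \<subseteq> \<Omega>" "D \<subseteq> \<Omega>" using Compl.hyps sets.sets_into_space[of a \<B>] D
      by (auto simp: sets_shift_borel clopen_level_def)
    then have "sym_diff (\<Omega> - a) (\<Omega> - D) = sym_diff a D" by blast
    with D show ?case using clopen_level_Diff by metis
  next
    case (Union a)
    have a: "a i \<in> sets \<B>" for i using Union.hyps by (simp add: sets_shift_borel)
    \<comment> \<open>Half of \<open>e\<close> pays for cutting the union off at \<open>k\<close>;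
      the other half is spread over the sets \<open>a i\<close> as a geometric series.\<close>
    have "\<exists>D. (\<exists>n. clopen_level n D) \<and> measure M1 (sym_diff (a i) D) < e / 2 * (1/2)^Suc i \<and>
       measure M2 (sym_diff (a i) D) < e / 2 * (1/2)^Suc i" for i
      using Union.IH[of "e / 2 * (1/2)^Suc i" i] Union.prems by (auto simp del: power_Suc)
    then obtain D where D: "\<And>i. \<exists>n. clopen_level n (D i)"
      "\<And>i. measure M1 (sym_diff (a i) (D i)) < e / 2 * (1/2)^Suc i"
      "\<And>i. measure M2 (sym_diff (a i) (D i)) < e / 2 * (1/2)^Suc i" by metis
    have Ds: "D i \<in> sets \<B>" for i using D(1) clopen_level_sets by blast
    let ?U = "\<lambda>k. \<Union>i<k. a i"
    have ev: "\<forall>\<^sub>F k in sequentially. measure M (\<Union>(range a) - ?U k) < e / 2"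
      if M: "finite_measure M" "sets M = sets \<B>" for M
    proof -
      interpret finite_measure M by fact
      note [simp] = M(2)
      have "(\<lambda>k. measure M (\<Union>(range a) - ?U k)) \<longlonglongrightarrow> measure M (\<Inter>k. \<Union>(range a) - ?U k)"
      proof (rule finite_Lim_measure_decseq)
        show "range (\<lambda>k. \<Union>(range a) - ?U k) \<subseteq> sets M"
          using a by (simp add: image_subset_iff sets.Diff sets.countable_UN)
        have "?U k \<subseteq> ?U l" if "k \<le> l" for k l
          using that by (intro UN_mono) auto
        then show "decseq (\<lambda>k. \<Union>(range a) - ?U k)" unfolding decseq_def by blast
      qed
      moreover have empty: "(\<Inter>k. \<Union>(range a) - ?U k) = {}" by auto
      ultimately have "(\<lambda>k. measure M (\<Union>(range a) - ?U k)) \<longlonglongrightarrow> 0"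
        by (simp only: empty measure_empty)
      then show ?thesis by (rule order_tendstoD) (use Union.prems in simp)
    qed
    \<comment> \<open>One \<open>k\<close> has to serve both measures.\<close>
    obtain k where k: "measure M1 (\<Union>(range a) - ?U k) < e / 2"
      "measure M2 (\<Union>(range a) - ?U k) < e / 2"
      using eventually_happens'[OF _ eventually_conj[OF ev[OF assms(1,3)] ev[OF assms(2,4)]]]
      by auto
    have bound: "measure M (sym_diff (\<Union>(range a)) (\<Union>i<k. D i)) < e"
      if M: "finite_measure M" "sets M = sets \<B>" "measure M (\<Union>(range a) - ?U k) < e / 2"
        "\<And>i. measure M (sym_diff (a i) (D i)) < e / 2 * (1/2)^Suc i" for M
    proof -
      interpret finite_measure M by fact
      note [simp] = M(2)
      have sets: "\<Union>(range a) - ?U k \<in> sets \<B>" "(\<Union>i<k. sym_diff (a i) (D i)) \<in> sets \<B>"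
        using a Ds by (auto intro!: sets.Diff sets.countable_UN sets.finite_UN)
      have "sym_diff (\<Union>(range a)) (\<Union>i<k. D i)
          \<subseteq> (\<Union>(range a) - ?U k) \<union> (\<Union>i<k. sym_diff (a i) (D i))"
        by blast
      then have "measure M (sym_diff (\<Union>(range a)) (\<Union>i<k. D i))
          \<le> measure M ((\<Union>(range a) - ?U k) \<union> (\<Union>i<k. sym_diff (a i) (D i)))"
        using sets by (intro finite_measure_mono) auto
      also have "\<dots> \<le> measure M (\<Union>(range a) - ?U k) + measure M (\<Union>i<k. sym_diff (a i) (D i))"
        using sets by (intro measure_Un_le) auto
      also have "measure M (\<Union>i<k. sym_diff (a i) (D i)) \<le> (\<Sum>i<k. measure M (sym_diff (a i) (D i)))"
        using a Ds by (intro measure_UNION_le) auto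
      also have "\<dots> \<le> (\<Sum>i<k. e / 2 * (1/2)^Suc i)"
        using M(4) by (intro sum_mono) (simp add: less_imp_le)
      also have "\<dots> = e / 2 * (\<Sum>i<k. (1/2)^Suc i)" by (simp add: sum_distrib_left)
      also have "(\<Sum>i<k. (1/2)^Suc i) = 1 - (1/2::real)^k"
        by (induction k) (auto simp: field_simps)
      also have "e / 2 * (1 - (1/2::real)^k) \<le> e / 2" using Union.prems by simp
      finally show ?thesis using M(3) by simp
    qed
    obtain n where "clopen_level n (\<Union>i<k. D i)" using finite_UN_clopen_level D(1) by blast
    then show ?case
      using bound[OF assms(1,3) k(1) D(2)] bound[OF assms(2,4) k(2) D(3)] by blast
  qed
qed

text \<open>A clopen set splits into finitely many cylinders of any sufficiently large length, so it
  is enough to control lengths from \<open>n\<^sub>0\<close> on; simultaneous approximation carries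
  the inequality to \<open>B\<close>.\<close>

lemma cylinder_domination:
  assumes M: "finite_measure M1" "finite_measure M2" "sets M1 = sets \<B>" "sets M2 = sets \<B>"
    and le: "\<And>\<omega> n. \<omega> \<in> \<Omega> \<Longrightarrow> n\<^sub>0 \<le> n \<Longrightarrow> measure M1 (cyl n \<omega>) \<le> c * measure M2 (cyl n \<omega>)"
    and B: "B \<in> sets \<B>" and c: "0 \<le> c"
  shows "measure M1 B \<le> c * measure M2 B"
proof -
  interpret M1: finite_measure M1 by fact
  interpret M2: finite_measure M2 by fact
  note [simp] = M(3,4)
  have clopen: "measure M1 D \<le> c * measure M2 D" if "clopen_level n D" for n D
  proof -
    define m where "m = max n n\<^sub>0"
    have D: "clopen_level m D" using that clopen_level_mono by (simp add: m_def)
    note part = clopen_level_partition[OF D]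
    have D\<Omega>: "D \<subseteq> \<Omega>" using that by (simp add: clopen_level_def)
    have eq: "measure M D = (\<Sum>C\<in>cyl m ` D. measure M C)"
      if M: "finite_measure M" "sets M = sets \<B>" for M
    proof -
      have "id ` cyl m ` D \<subseteq> sets M" by (simp add: M(2) image_subset_iff)
      then have "measure M (\<Union>(id ` cyl m ` D)) = (\<Sum>C\<in>cyl m ` D. measure M (id C))"
        by (intro finite_measure.finite_measure_finite_Union[OF M(1)] part)
      then show ?thesis using part(1) by simp
    qed
    have "(\<Sum>C\<in>cyl m ` D. measure M1 C) \<le> (\<Sum>C\<in>cyl m ` D. c * measure M2 C)"
      using le D\<Omega> by (intro sum_mono) (auto simp: m_def)
    then show ?thesis by (simp add: eq M sum_distrib_left)
  qed
  show ?thesis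
  proof (rule field_le_epsilon)
    fix e :: real assume "e > 0"
    \<comment> \<open>Replacing \<open>B\<close> by \<open>D\<close> costs \<open>e'\<close> in the
      first measure and \<open>c * e'\<close> in the second.\<close>
    define e' where "e' = e / (1 + c)"
    have e': "e' > 0" using \<open>e > 0\<close> c by (simp add: e'_def)
    obtain D n where D: "clopen_level n D" "measure M1 (sym_diff B D) < e'" "measure M2 (sym_diff B D) < e'"
      using clopen_approximation[OF M B e'] by blast
    have Ds: "D \<in> sets \<B>" using D clopen_level_sets by blast
    have "measure M1 B \<le> measure M1 (D \<union> sym_diff B D)"
      using B Ds by (intro M1.finite_measure_mono) auto
    also have "\<dots> \<le> measure M1 D + measure M1 (sym_diff B D)"
      using B Ds by (intro measure_Un_le) auto
    also have "\<dots> \<le> c * measure M2 D + e'" using clopen[OF D(1)] D(2) by simp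
    also have "measure M2 D \<le> measure M2 (B \<union> sym_diff B D)"
      using B Ds by (intro M2.finite_measure_mono) auto
    also have "measure M2 (B \<union> sym_diff B D) \<le> measure M2 B + measure M2 (sym_diff B D)"
      using B Ds by (intro measure_Un_le) auto
    also have "c * (measure M2 B + measure M2 (sym_diff B D)) + e' \<le> c * (measure M2 B + e') + e'"
      using D(3) c by (intro add_right_mono mult_left_mono) auto
    also have "\<dots> = c * measure M2 B + (1 + c) * e'" by (simp add: field_simps)
    also have "\<dots> = c * measure M2 B + e" using c by (simp add: e'_def)
    finally show "measure M1 B \<le> c * measure M2 B + e" using c by (simp add: mult_left_mono)
  qed
qed

lemma cylinder_uniqueness:
  assumes "finite_measure M1" "finite_measure M2" "sets M1 = sets \<B>" "sets M2 = sets \<B>"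
    and "\<And>\<omega> n. \<omega> \<in> \<Omega> \<Longrightarrow> n\<^sub>0 \<le> n \<Longrightarrow> measure M1 (cyl n \<omega>) = c * measure M2 (cyl n \<omega>)"
    and "B \<in> sets \<B>" "0 < c"
  shows "measure M1 B = c * measure M2 B"
proof (rule antisym)
  show "measure M1 B \<le> c * measure M2 B"
    by (rule cylinder_domination[of M1 M2 n\<^sub>0]) (use assms in \<open>simp_all only: less_imp_le order_refl\<close>)
  have "measure M2 B \<le> inverse c * measure M1 B"
  proof (rule cylinder_domination[of M2 M1 n\<^sub>0])
    fix \<omega> n assume "\<omega> \<in> \<Omega>" "n\<^sub>0 \<le> n"
    from assms(5)[OF this] show "measure M2 (cyl n \<omega>) \<le> inverse c * measure M1 (cyl n \<omega>)"
      using \<open>0 < c\<close> by (simp add: mult.assoc[symmetric])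
  qed (use assms in simp_all)
  then show "c * measure M2 B \<le> measure M1 B" using \<open>0 < c\<close> by (simp add: field_simps)
qed

end

subsection \<open>Perron eigenvectors\<close>

definition vec_mat :: "'a set \<Rightarrow> ('a \<Rightarrow> 'a \<Rightarrow> real) \<Rightarrow> ('a \<Rightarrow> real) \<Rightarrow> 'a \<Rightarrow> real" where
  "vec_mat S M x j = (\<Sum>i\<in>S. x i * M i j)"

lemma vec_mat_cong: "(\<And>i. i \<in> S \<Longrightarrow> x i = y i) \<Longrightarrow> vec_mat S M x = vec_mat S M y"
  by (auto simp: vec_mat_def intro!: sum.cong)

lemma vec_mat_diff: "vec_mat S M (\<lambda>i. x i - c * y i) j = vec_mat S M x j - c * vec_mat S M y j"
  by (simp add: vec_mat_def algebra_simps sum_subtractf sum_distrib_left)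

lemma vec_mat_scale: "vec_mat S M (\<lambda>i. c * y i) j = c * vec_mat S M y j"
  by (simp add: vec_mat_def mult.assoc sum_distrib_left)

lemma vec_mat_pow_diff:
  "(vec_mat S M ^^ m) (\<lambda>i. x i - c * y i) = (\<lambda>j. (vec_mat S M ^^ m) x j - c * (vec_mat S M ^^ m) y j)"
proof (induction m)
  case (Suc m)
  then show ?case by (simp add: vec_mat_diff[abs_def])
qed simp

lemma vec_mat_pow_nonneg:
  assumes "\<And>i j. i \<in> S \<Longrightarrow> j \<in> S \<Longrightarrow> 0 \<le> M i j" "\<And>i. i \<in> S \<Longrightarrow> 0 \<le> x i" "j \<in> S"
  shows "0 \<le> (vec_mat S M ^^ m) x j"
  using assms(3) by (induction m arbitrary: j) (auto simp: vec_mat_def assms intro!: sum_nonneg)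

lemma vec_mat_pow_eigen:
  assumes "\<And>j. j \<in> S \<Longrightarrow> vec_mat S M x j = l * x j" "j \<in> S"
  shows "(vec_mat S M ^^ m) x j = l ^ m * x j"
  using assms(2)
proof (induction m arbitrary: j)
  case (Suc m)
  have "(vec_mat S M ^^ Suc m) x j = vec_mat S M (\<lambda>i. l ^ m * x i) j"
    using Suc.IH by (simp add: vec_mat_cong[of S "(vec_mat S M ^^ m) x" "\<lambda>i. l ^ m * x i"])
  with Suc.prems show ?case by (simp add: vec_mat_scale assms(1))
qed simp

text \<open>\<open>R\<close> is kept apart from \<open>M\<close>: it records entries known to be
  positive, and the locale is used for the transfer matrix, for a kernel and for the transposed
  kernel, where \<open>R\<close> is reversed.\<close>

locale primitive_matrix =
  fixes S :: "'a set" and M :: "'a \<Rightarrow> 'a \<Rightarrow> real" and R :: "'a \<Rightarrow> 'a \<Rightarrow> bool" and m :: nat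
  assumes finite_S: "finite S" and S_nonempty: "S \<noteq> {}"
    and nonneg: "i \<in> S \<Longrightarrow> j \<in> S \<Longrightarrow> 0 \<le> M i j"
    and R_pos: "R i j \<Longrightarrow> i \<in> S \<and> j \<in> S \<and> 0 < M i j"
    and m_pos: "1 \<le> m" and R_pow: "i \<in> S \<Longrightarrow> j \<in> S \<Longrightarrow> (R ^^ m) i j"
begin

abbreviation T :: "('a \<Rightarrow> real) \<Rightarrow> 'a \<Rightarrow> real" where
  "T \<equiv> vec_mat S M"

text \<open>The constant is the product of the entries of \<open>M\<close> along a path from
  \<open>i\<close> to \<open>j\<close>, hence independent of \<open>x\<close>.\<close>

lemma pow_ge:
  assumes "(R ^^ k) i j" "i \<in> S"
  shows "\<exists>c>0. \<forall>x. (\<forall>i\<in>S. 0 \<le> x i) \<longrightarrow> c * x i \<le> (T ^^ k) x j"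
  using assms(1)
proof (induction k arbitrary: j)
  case 0 then show ?case by (intro exI[of _ 1]) auto
next
  case (Suc k)
  then obtain j' where j': "(R ^^ k) i j'" "R j' j" by auto
  then obtain c where c: "c > 0" "\<And>x. (\<forall>i\<in>S. 0 \<le> x i) \<Longrightarrow> c * x i \<le> (T ^^ k) x j'"
    using Suc.IH by blast
  note jj = R_pos[OF j'(2)]
  show ?case
  proof (intro exI[of _ "c * M j' j"] conjI allI impI)
    show "0 < c * M j' j" using c jj by simp
    fix x assume x: "\<forall>i\<in>S. (0::real) \<le> x i"
    have "c * M j' j * x i = (c * x i) * M j' j" by simp
    also have "\<dots> \<le> (T ^^ k) x j' * M j' j"
      using c(2)[OF x] jj by (intro mult_right_mono) auto
    also have "\<dots> \<le> T ((T ^^ k) x) j"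
      unfolding vec_mat_def[of _ _ "(T ^^ k) x"]
      by (rule member_le_sum[where f = "\<lambda>i. (T ^^ k) x i * M i j"])
         (use jj finite_S x nonneg in \<open>auto intro!: mult_nonneg_nonneg vec_mat_pow_nonneg\<close>)
    finally show "c * M j' j * x i \<le> (T ^^ Suc k) x j" by simp
  qed
qed

text \<open>A Doeblin minorisation. It is what controls oscillations in the perturbation estimate
  for kernels.\<close>

lemma uniform_pow_ge:
  "\<exists>c>0. \<forall>i\<in>S. \<forall>j\<in>S. \<forall>x. (\<forall>i\<in>S. 0 \<le> x i) \<longrightarrow> c * x i \<le> (T ^^ m) x j"
proof -
  have "\<exists>c>0. \<forall>x. (\<forall>i\<in>S. 0 \<le> x i) \<longrightarrow> c * x (fst p) \<le> (T ^^ m) x (snd p)" if "p \<in> S \<times> S" for p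
    using pow_ge[OF R_pow] that by auto
  then obtain c where c: "\<And>p. p \<in> S \<times> S \<Longrightarrow> c p > 0"
    "\<And>p x. p \<in> S \<times> S \<Longrightarrow> (\<forall>i\<in>S. 0 \<le> x i) \<Longrightarrow> c p * x (fst p) \<le> (T ^^ m) x (snd p)"
    by metis
  have fin: "finite (c ` (S \<times> S))" "c ` (S \<times> S) \<noteq> {}" using finite_S S_nonempty by auto
  show ?thesis
  proof (intro exI[of _ "Min (c ` (S \<times> S))"] conjI ballI allI impI)
    show "0 < Min (c ` (S \<times> S))" using fin c(1) by (simp add: Min_gr_iff)
    fix i j x assume ij: "i \<in> S" "j \<in> S" and x: "\<forall>i\<in>S. (0::real) \<le> x i"
    have "Min (c ` (S \<times> S)) * x i \<le> c (i, j) * x i"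
      using fin ij x by (intro mult_right_mono Min_le) auto
    also have "\<dots> \<le> (T ^^ m) x j" using c(2)[of "(i, j)"] ij x by simp
    finally show "Min (c ` (S \<times> S)) * x i \<le> (T ^^ m) x j" .
  qed
qed

lemma pow_pos:
  assumes "\<forall>i\<in>S. 0 \<le> x i" "i \<in> S" "x i \<noteq> 0" "j \<in> S"
  shows "0 < (T ^^ m) x j"
proof -
  obtain c where "c > 0" "c * x i \<le> (T ^^ m) x j" using pow_ge[OF R_pow] assms by blast
  moreover have "0 < x i" using assms by (metis order_le_less)
  ultimately show ?thesis by (metis mult_pos_pos order_less_le_trans)
qed

text \<open>The Collatz--Wielandt argument: a maximal \<open>l\<close> with \<open>l x \<le> x M\<close> for some probability
  vector \<open>x\<close> is an eigenvalue, for otherwise \<open>x M\<^sup>m\<close> would allow a larger one.\<close>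

theorem perron_eigenvector:
  "\<exists>l>0. \<exists>x. (\<forall>j\<in>S. 0 < x j) \<and> (\<forall>j\<in>S. T x j = l * x j)"
proof -
  \<comment> \<open>An upper bound for every \<open>l\<close> with \<open>l x \<le> x M\<close> for
    some probability vector \<open>x\<close>, so that restricting to \<open>{0..B}\<close> loses no
    candidate.\<close>
  define B where "B = (\<Sum>i\<in>S. \<Sum>j\<in>S. M i j)"
  \<comment> \<open>Vectors are set to 0 off \<open>S\<close>, so that \<open>K\<close> is a product
    of compact sets over the whole type.\<close>
  define K where "K = {x :: 'a \<Rightarrow> real. \<forall>i. x i \<in> (if i \<in> S then {0..1} else {0})}"
  define G where "G = (K \<times> {0..B}) \<inter> ({p. (\<Sum>i\<in>S. fst p i) = 1} \<inter>
     (\<Inter>j\<in>S. {p. snd p * fst p j \<le> T (fst p) j}))"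
  have "compactin (product_topology (\<lambda>i. euclidean) UNIV)
      (PiE (UNIV :: 'a set) (\<lambda>i. if i \<in> S then {0..1::real} else {0}))"
    unfolding compactin_PiE by auto
  moreover have "PiE (UNIV :: 'a set) (\<lambda>i. if i \<in> S then {0..1::real} else {0}) = K"
    unfolding K_def by (auto simp: PiE_def Pi_def)
  ultimately have K: "compact K" by (simp add: euclidean_product_topology)
  have cont: "continuous_on UNIV (\<lambda>p :: ('a \<Rightarrow> real) \<times> real. fst p i)" for i
    by (rule continuous_on_product_then_coordinatewise) (intro continuous_intros)
  have "compact G" unfolding G_def
    by (intro compact_Int_closed compact_Times K compact_Icc closed_Int closed_INT ballI
        closed_Collect_eq closed_Collect_le) (auto simp: vec_mat_def intro!: continuous_intros cont)
  moreover have "((\<lambda>i. if i \<in> S then 1 / card S else 0), 0) \<in> G"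
  proof -
    have "1 \<le> card S" using finite_S S_nonempty by (simp add: Suc_leI card_gt_0_iff)
    then show ?thesis using finite_S S_nonempty nonneg
      by (auto simp: G_def K_def B_def vec_mat_def intro!: sum_nonneg)
  qed
  ultimately obtain p where p: "p \<in> G" "\<And>p'. p' \<in> G \<Longrightarrow> snd p' \<le> snd p"
    using continuous_attains_sup[of G snd] continuous_on_snd[OF continuous_on_id] by fastforce
  obtain x l where xl: "p = (x, l)" by (cases p)
  have x: "\<forall>i\<in>S. 0 \<le> x i" "(\<Sum>i\<in>S. x i) = 1" "0 \<le> l" "\<And>j. j \<in> S \<Longrightarrow> l * x j \<le> T x j"
    using p(1) by (auto simp: xl G_def K_def split: if_splits)
  have "\<exists>i\<in>S. x i \<noteq> 0" using x(2) by (metis sum.neutral zero_neq_one)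
  then have Tm_pos: "0 < (T ^^ m) x j" if "j \<in> S" for j using pow_pos[OF x(1)] that by blast
  have eigen: "T x j = l * x j" if "j \<in> S" for j
  proof (rule ccontr)
    assume "T x j \<noteq> l * x j"
    \<comment> \<open>The slack of the inequality. Since \<open>z\<close> is nonnegative and not
      zero on \<open>S\<close>, \<open>T ^^ m\<close> makes it positive in every coordinate, so
      \<open>y\<close> satisfies the inequality strictly everywhere.\<close>
    define z where "z i = T x i - l * x i" for i
    have z: "\<forall>i\<in>S. 0 \<le> z i" "z j \<noteq> 0" using x(4) \<open>T x j \<noteq> l * x j\<close> by (auto simp: z_def)
    define y where "y = (T ^^ m) x"
    have "(T ^^ m) z = (\<lambda>i. T y i - l * y i)"
      unfolding z_def y_def vec_mat_pow_diff by (simp add: funpow_swap1)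
    then have strict: "l * y i < T y i" if "i \<in> S" for i
      using pow_pos[OF z(1) \<open>j \<in> S\<close> z(2) that] by simp
    have y: "0 < y i" if "i \<in> S" for i using Tm_pos[OF that] by (simp add: y_def)
    define l' where "l' = Min ((\<lambda>i. T y i / y i) ` S)"
    have l': "l' * y i \<le> T y i" if "i \<in> S" for i
    proof -
      have "l' \<le> T y i / y i" unfolding l'_def using finite_S that by (intro Min_le) auto
      then show ?thesis using y[OF that] by (simp add: field_simps)
    qed
    have "l < l'" unfolding l'_def using finite_S S_nonempty strict y
      by (subst Min_gr_iff) (auto simp: field_simps)
    define s where "s = (\<Sum>i\<in>S. y i)"
    have s: "s > 0" unfolding s_def using finite_S S_nonempty y by (intro sum_pos) auto
    have ys: "y i \<le> s" if "i \<in> S" for i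
      unfolding s_def using that finite_S y by (intro member_le_sum) (auto intro: less_imp_le)
    have "l' * s = (\<Sum>j\<in>S. l' * y j)" by (simp add: s_def sum_distrib_left)
    also have "\<dots> \<le> (\<Sum>j\<in>S. T y j)" using l' by (intro sum_mono)
    also have "\<dots> = (\<Sum>i\<in>S. \<Sum>j\<in>S. y i * M i j)" unfolding vec_mat_def by (rule sum.swap)
    also have "\<dots> \<le> (\<Sum>i\<in>S. \<Sum>j\<in>S. s * M i j)"
      using ys nonneg by (intro sum_mono mult_right_mono) auto
    also have "\<dots> = B * s" by (simp add: B_def sum_distrib_left mult.commute)
    finally have "l' \<le> B" using s by simp
    define y' where "y' i = (if i \<in> S then y i / s else 0)" for i
    have T': "T y' j = T y j / s" for j
      by (simp add: vec_mat_def y'_def sum_divide_distrib)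
    have "(y', l') \<in> G"
      using s ys y \<open>l' \<le> B\<close> \<open>l < l'\<close> x(3) l'
      by (auto simp: G_def K_def T' y'_def divide_simps sum_divide_distrib[symmetric] less_imp_le
          s_def[symmetric])
    from p(2)[OF this] \<open>l < l'\<close> show False by (simp add: xl)
  qed
  obtain i where i: "i \<in> S" using S_nonempty by blast
  \<comment> \<open>The \<open>m\<close>-th power of the eigenvalue equation has a positive
    left-hand side, which gives positivity of \<open>l\<close> and of \<open>x\<close> at
    once.\<close>
  have lm: "0 < l ^ m * x j" if "j \<in> S" for j
    using Tm_pos[OF that] vec_mat_pow_eigen[of S M x l j m] eigen that by simp
  then have "0 < l ^ m" using i x(1) zero_less_mult_iff[of "l ^ m" "x i"] by (smt (verit))
  then have "l > 0" using x(3) m_pos by (metis order_le_less power_0_left less_irrefl not_one_le_zero)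
  moreover have "\<forall>j\<in>S. 0 < x j" using lm \<open>0 < l ^ m\<close> zero_less_mult_pos by blast
  ultimately show ?thesis using eigen by blast
qed

end

context markov_shift
begin

subsection \<open>Backward kernels\<close>

definition kernel :: "(nat \<Rightarrow> nat \<Rightarrow> real) \<Rightarrow> bool" where
  "kernel q \<longleftrightarrow> (\<forall>i j. edge i j \<longrightarrow> 0 < q i j) \<and> (\<forall>i j. \<not> edge i j \<longrightarrow> q i j = 0) \<and>
     (\<forall>j\<in>states. (\<Sum>i\<in>states. q i j) = 1)"

text \<open>For 2-locally constant \<open>f\<close> the choice of a path through the edge is
  immaterial.\<close>

definition potential :: "((nat \<Rightarrow> nat) \<Rightarrow> real) \<Rightarrow> nat \<Rightarrow> nat \<Rightarrow> real" where
  "potential f i j = f (SOME \<omega>. \<omega> \<in> \<Omega> \<and> \<omega> 0 = i \<and> \<omega> 1 = j)"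

text \<open>\<open>u\<close> is a left Perron eigenvector of the transfer matrix of \<open>f\<close>; passing from \<open>f\<close> to
  \<open>ln q\<close> changes \<open>f\<close> by a coboundary and a constant.\<close>

definition kernel_of :: "((nat \<Rightarrow> nat) \<Rightarrow> real) \<Rightarrow> (nat \<Rightarrow> nat \<Rightarrow> real) \<Rightarrow> bool" where
  "kernel_of f q \<longleftrightarrow> kernel q \<and> (\<exists>u l. 0 < l \<and> (\<forall>i\<in>states. 0 < u i) \<and>
     (\<forall>i j. edge i j \<longrightarrow> exp (potential f i j) * u i = l * u j * q i j))"

definition separating :: "(nat \<Rightarrow> nat \<Rightarrow> real) \<Rightarrow> bool" where
  "separating q \<longleftrightarrow> (\<forall>i j i' j'. edge i j \<and> edge i' j' \<and> q i j = q i' j' \<and> q i j \<noteq> 1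
     \<longrightarrow> i = i' \<and> j = j')"

lemma potential_eq:
  assumes "f \<in> locally_constant N A 2" "\<omega> \<in> \<Omega>"
  shows "potential f (\<omega> 0) (\<omega> 1) = f \<omega>"
proof -
  let ?P = "\<lambda>\<eta>. \<eta> \<in> \<Omega> \<and> \<eta> 0 = \<omega> 0 \<and> \<eta> 1 = \<omega> 1"
  have "?P (SOME \<eta>. ?P \<eta>)" by (rule someI[of ?P \<omega>]) (use assms in auto)
  moreover from this have "\<forall>k<2. (SOME \<eta>. ?P \<eta>) k = \<omega> k"
    by (auto simp: numeral_2_eq_2 less_Suc_eq)
  ultimately show ?thesis
    using assms unfolding locally_constant_def potential_def by blast
qed

lemma finite_edges: "finite {(i, j). edge i j}"
  by (rule finite_subset[of _ "states \<times> states"]) (auto simp: edge_def)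

lemma kernel_pos: "kernel q \<Longrightarrow> edge i j \<Longrightarrow> 0 < q i j"
  by (simp add: kernel_def)

lemma kernel_0: "kernel q \<Longrightarrow> \<not> edge i j \<Longrightarrow> q i j = 0"
  by (simp add: kernel_def)

lemma kernel_nonneg: "kernel q \<Longrightarrow> 0 \<le> q i j"
  by (metis kernel_0 kernel_pos order.refl less_imp_le)

lemma kernel_sum: "kernel q \<Longrightarrow> j \<in> states \<Longrightarrow> (\<Sum>i\<in>states. q i j) = 1"
  by (simp add: kernel_def)

lemma kernel_sum_remove:
  assumes "kernel q" "edge i j"
  shows "q i j + (\<Sum>i'\<in>states - {i}. q i' j) = 1"
proof -
  have "i \<in> states" "j \<in> states" using assms(2) edge_states by blast+
  then show ?thesis using kernel_sum[OF assms(1)] by (subst sum.remove[symmetric]) auto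
qed

lemma kernel_le_1: "kernel q \<Longrightarrow> q i j \<le> 1"
proof (cases "edge i j")
  case True
  assume q: "kernel q"
  have "0 \<le> (\<Sum>i'\<in>states - {i}. q i' j)" by (intro sum_nonneg kernel_nonneg q)
  with kernel_sum_remove[OF q True] show ?thesis by linarith
qed (simp add: kernel_0)

text \<open>The value is 1 exactly when the other entries of column \<open>j\<close> vanish. The
  right-hand side involves the graph only, so all kernels take the value 1 on the same
  edges.\<close>

lemma kernel_eq_1_iff:
  assumes q: "kernel q" and ij: "edge i j"
  shows "q i j = 1 \<longleftrightarrow> (\<forall>i'. edge i' j \<longrightarrow> i' = i)"
proof -
  have "q i j = 1 \<longleftrightarrow> (\<Sum>i'\<in>states - {i}. q i' j) = 0"
    using kernel_sum_remove[OF q ij] by linarith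
  also have "\<dots> \<longleftrightarrow> (\<forall>i'\<in>states - {i}. q i' j = 0)"
    by (intro sum_nonneg_eq_0_iff) (auto intro: kernel_nonneg q)
  also have "\<dots> \<longleftrightarrow> (\<forall>i'. edge i' j \<longrightarrow> i' = i)"
    using q edge_states[of _ j] kernel_pos[OF q] kernel_0[OF q] by (metis Diff_iff empty_iff insert_iff less_irrefl)
  finally show ?thesis .
qed

lemma kernel_primitive_matrix:
  assumes "kernel q" "1 \<le> m" "\<And>i j. i \<in> states \<Longrightarrow> j \<in> states \<Longrightarrow> (edge ^^ m) i j"
  shows "primitive_matrix states q edge m"
  by unfold_locales
    (use assms states_nonempty kernel_nonneg[OF assms(1)] kernel_pos[OF assms(1)] edge_states in auto)

text \<open>The Doob transform of the transfer matrix: its columns sum to 1 because \<open>u\<close>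
  is a left eigenvector, and the conjugation by \<open>u\<close> is the coboundary.\<close>

lemma ex_kernel_of: "\<exists>q. kernel_of f q"
proof -
  obtain m where m: "1 \<le> m" "\<And>i j. i \<in> states \<Longrightarrow> j \<in> states \<Longrightarrow> (edge ^^ m) i j"
    using primitive by blast
  define M where "M i j = (if edge i j then exp (potential f i j) else 0)" for i j
  interpret primitive_matrix states M edge m
    by unfold_locales (use m states_nonempty edge_states in \<open>auto simp: M_def\<close>)
  obtain l u where u: "0 < l" "\<forall>j\<in>states. 0 < u j" "\<forall>j\<in>states. T u j = l * u j"
    using perron_eigenvector by blast
  define q where "q i j = M i j * u i / (l * u j)" for i j
  have "kernel q" unfolding kernel_def
  proof (intro conjI allI impI ballI)
    fix i j assume "edge i j"
    with edge_states[OF this] u show "0 < q i j" by (simp add: q_def M_def)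
  next
    fix i j assume "\<not> edge i j" then show "q i j = 0" by (simp add: q_def M_def)
  next
    fix j assume j: "j \<in> states"
    have "(\<Sum>i\<in>states. q i j) = T u j / (l * u j)"
      by (simp add: q_def vec_mat_def sum_divide_distrib mult.commute)
    also have "\<dots> = 1" using u j by (metis divide_self less_irrefl mult_pos_pos)
    finally show "(\<Sum>i\<in>states. q i j) = 1" .
  qed
  moreover have "exp (potential f i j) * u i = l * u j * q i j" if "edge i j" for i j
  proof -
    have "l * u j \<noteq> 0" using u edge_states[OF that] by (metis less_irrefl mult_pos_pos)
    then show ?thesis using that by (simp add: q_def M_def)
  qed
  ultimately have "kernel_of f q" unfolding kernel_of_def using u by blast
  then show ?thesis by blast
qed

lemma conversep_relpowp: fixes R :: "'a \<Rightarrow> 'a \<Rightarrow> bool" shows "(conversep R ^^ m) i j \<longleftrightarrow> (R ^^ m) j i"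
proof (induction m arbitrary: i j)
  case (Suc m)
  have "(conversep R ^^ Suc m) i j \<longleftrightarrow> (\<exists>k. (conversep R ^^ m) i k \<and> conversep R k j)"
    by (simp only: relpowp.simps relcompp_apply)
  also have "\<dots> \<longleftrightarrow> (\<exists>k. R j k \<and> (R ^^ m) k i)" unfolding Suc conversep_iff by blast
  also have "\<dots> \<longleftrightarrow> (R ^^ Suc m) j i" by (metis relpowp_Suc_D2 relpowp_Suc_I2)
  finally show ?case .
qed auto

text \<open>Perron's theorem for the transposed kernel. The eigenvalue is 1, as summing the
  eigenvalue equation over all states and using the column sums shows.\<close>

lemma ex_stationary:
  assumes q: "kernel q"
  shows "\<exists>p. (\<forall>i\<in>states. 0 < p i) \<and> (\<Sum>i\<in>states. p i) = 1 \<and>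
           (\<forall>i\<in>states. (\<Sum>j\<in>states. q i j * p j) = p i)"
proof -
  obtain m where m: "1 \<le> m" "\<And>i j. i \<in> states \<Longrightarrow> j \<in> states \<Longrightarrow> (edge ^^ m) i j"
    using primitive by blast
  interpret primitive_matrix states "\<lambda>i j. q j i" "conversep edge" m
    by unfold_locales (use m states_nonempty edge_states kernel_nonneg[OF q] kernel_pos[OF q]
        in \<open>auto simp: conversep_relpowp\<close>)
  obtain l x where x: "0 < l" "\<forall>j\<in>states. 0 < x j" "\<forall>j\<in>states. T x j = l * x j"
    using perron_eigenvector by blast
  define s where "s = (\<Sum>j\<in>states. x j)"
  have s: "0 < s" unfolding s_def using x states_nonempty by (intro sum_pos) auto
  have "l * s = (\<Sum>i\<in>states. T x i)" using x by (simp add: s_def sum_distrib_left)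
  also have "\<dots> = (\<Sum>j\<in>states. \<Sum>i\<in>states. x j * q i j)" unfolding vec_mat_def by (rule sum.swap)
  also have "\<dots> = s" using kernel_sum[OF q] by (simp add: s_def sum_distrib_left[symmetric])
  finally have "l = 1" using s by simp
  then have "(\<Sum>j\<in>states. q i j * (x j / s)) = x i / s" if "i \<in> states" for i
    using x that by (simp add: vec_mat_def sum_divide_distrib[symmetric] mult.commute)
  moreover have "(\<Sum>j\<in>states. x j / s) = 1" using s by (simp add: s_def sum_divide_distrib[symmetric])
  ultimately show ?thesis using x s by (intro exI[of _ "\<lambda>j. x j / s"]) auto
qed

text \<open>With \<open>v = u' / u\<close> and \<open>w = l' / l\<close>, the kernel of a perturbation is
  \<open>q' i j = e i j * q i j * v i / (w * v j)\<close> with \<open>e\<close> close to 1. At a maximum of \<open>v\<close>, comparing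
  \<open>w\<^sup>m v\<close> with \<open>v q\<^sup>m\<close> forces \<open>min v / max v\<close> to be close to 1.\<close>

lemma perturbed_kernel_bound:
  assumes q: "kernel q" and m: "1 \<le> m"
    and c: "0 < c" "\<forall>i\<in>states. \<forall>j\<in>states. \<forall>x. (\<forall>i\<in>states. 0 \<le> x i) \<longrightarrow> c * x i \<le> (vec_mat states q ^^ m) x j"
    and q': "kernel q'" "\<And>i j. edge i j \<Longrightarrow> q' i j * (w * v j) = e i j * q i j * v i"
    and v: "\<And>i. i \<in> states \<Longrightarrow> 0 < v i" and w: "0 < w"
    and e: "\<And>i j. edge i j \<Longrightarrow> exp (- d) \<le> e i j \<and> e i j \<le> exp d" and d: "0 \<le> d"
    and r: "r = 1 - (1 - exp (- 2 * real m * d)) / c" "0 < r"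
    and ij: "edge i j"
  shows "exp (- 2 * d) * r * q i j \<le> q' i j \<and> q' i j \<le> exp (2 * d) / r * q i j"
proof -
  let ?T = "vec_mat states q"
  define a b where "a = Min (v ` states)" and "b = Max (v ` states)"
  have fin: "finite (v ` states)" "v ` states \<noteq> {}" using states_nonempty by auto
  have ab: "a \<le> v i \<and> v i \<le> b" if "i \<in> states" for i
    unfolding a_def b_def using that fin by auto
  obtain i0 where i0: "i0 \<in> states" "a = v i0" using Min_in[OF fin] by (auto simp: a_def)
  obtain j0 where j0: "j0 \<in> states" "b = v j0" using Max_in[OF fin] by (auto simp: b_def)
  have pos: "0 < a" "0 < b" using i0 j0 v by auto
  have eq: "w * v j = (\<Sum>i\<in>states. e i j * q i j * v i)" if "j \<in> states" for j
  proof -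
    have "w * v j = (\<Sum>i\<in>states. q' i j * (w * v j))"
      using kernel_sum[OF q'(1) that] by (simp add: sum_distrib_right[symmetric])
    also have "\<dots> = (\<Sum>i\<in>states. e i j * q i j * v i)"
      using q'(2) kernel_0[OF q] kernel_0[OF q'(1)] by (intro sum.cong) (metis mult_zero_left mult_zero_right)+
    finally show ?thesis .
  qed
  have low: "exp (- d) * (q i j * v i) \<le> e i j * q i j * v i"
    and up: "e i j * q i j * v i \<le> exp d * (q i j * v i)" if "i \<in> states" for i j
  proof -
    have "0 \<le> q i j * v i" using kernel_nonneg[OF q] v[OF that] by (simp add: less_imp_le)
    moreover have "q i j * v i = 0" if "\<not> edge i j" using kernel_0[OF q that] by simp
    ultimately show "exp (- d) * (q i j * v i) \<le> e i j * q i j * v i"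
      "e i j * q i j * v i \<le> exp d * (q i j * v i)"
      using e mult_right_mono by (metis mult.assoc mult_zero_right order.refl)+
  qed
  have Tv: "?T x j = (\<Sum>i\<in>states. q i j * x i)" for x j
    by (simp add: vec_mat_def mult.commute)
  have wv: "exp (- d) * ?T v j \<le> w * v j" "w * v j \<le> exp d * ?T v j" if "j \<in> states" for j
    unfolding eq[OF that] Tv sum_distrib_left using low up by (auto intro!: sum_mono)
  have const: "(?T ^^ k) (\<lambda>_. b) j = b" if "j \<in> states" for k j
    using vec_mat_pow_eigen[of states q "\<lambda>_. b" 1 j k] kernel_sum[OF q] that
    by (simp add: vec_mat_def sum_distrib_left[symmetric])
  have le_T: "a \<le> ?T v j" "?T v j \<le> b" if "j \<in> states" for j
  proof -
    have "(\<Sum>i\<in>states. q i j * a) \<le> ?T v j" "?T v j \<le> (\<Sum>i\<in>states. q i j * b)"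
      unfolding Tv using ab kernel_nonneg[OF q] by (auto intro!: sum_mono mult_left_mono)
    then show "a \<le> ?T v j" "?T v j \<le> b"
      using kernel_sum[OF q that] by (simp_all add: sum_distrib_right[symmetric])
  qed
  \<comment> \<open>Averaging by \<open>q\<close> stays between \<open>a\<close> and
    \<open>b\<close>, so the relation at a minimum and at a maximum of \<open>v\<close> confines
    \<open>w\<close> to the interval from \<open>exp (- d)\<close> to \<open>exp d\<close>.\<close>
  have "exp (- d) * a \<le> exp (- d) * ?T v i0" by (intro mult_left_mono le_T i0) auto
  also have "\<dots> \<le> w * a" unfolding i0(2) by (rule wv(1)[OF i0(1)])
  finally have "exp (- d) * a \<le> w * a" .
  then have w1: "exp (- d) \<le> w" using pos by simp
  have "w * b \<le> exp d * ?T v j0" unfolding j0(2) by (rule wv(2)[OF j0(1)])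
  also have "\<dots> \<le> exp d * b" by (intro mult_left_mono le_T j0) auto
  finally have "w * b \<le> exp d * b" .
  then have w2: "w \<le> exp d" using pos by simp
  \<comment> \<open>Iterates \<open>w v \<le> exp d * T v\<close>. Each of the \<open>m\<close>
    steps costs one factor \<open>exp (- d)\<close>, and \<open>w\<close> may be as small as another
    one, whence \<open>2 * m * d\<close> in \<open>r\<close>.\<close>
  have iter: "(exp (- d) * w) ^ k * v j \<le> (?T ^^ k) v j" if "j \<in> states" for k j
    using that
  proof (induction k arbitrary: j)
    case (Suc k)
    have "w * v j \<le> exp d * ?T v j" by (rule wv) fact
    then have "exp (- d) * (w * v j) \<le> exp (- d) * (exp d * ?T v j)" by (intro mult_left_mono) auto
    then have 1: "exp (- d) * w * v j \<le> ?T v j" by (simp add: exp_minus mult.assoc[symmetric])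
    have "(exp (- d) * w) ^ Suc k * v j = (exp (- d) * w) ^ k * (exp (- d) * w * v j)" by simp
    also have "\<dots> \<le> (exp (- d) * w) ^ k * ?T v j" using 1 w by (intro mult_left_mono) auto
    also have "\<dots> = ?T (\<lambda>i. (exp (- d) * w) ^ k * v i) j" by (simp add: vec_mat_scale)
    also have "\<dots> \<le> ?T ((?T ^^ k) v) j"
      unfolding Tv[of "(?T ^^ k) v"] Tv[of "\<lambda>i. (exp (- d) * w) ^ k * v i"]
      by (intro sum_mono mult_left_mono Suc.IH kernel_nonneg[OF q])
    finally show ?case by simp
  qed simp
  have "exp (- 2 * real m * d) = (exp (- d) * exp (- d)) ^ m"
    by (simp add: exp_of_nat_mult[symmetric] exp_add[symmetric] mult.commute)
  also have "\<dots> \<le> (exp (- d) * w) ^ m" using w1 by (intro power_mono mult_left_mono) auto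
  finally have "exp (- 2 * real m * d) * b \<le> (exp (- d) * w) ^ m * b"
    using pos by (intro mult_right_mono) auto
  also have "\<dots> \<le> (?T ^^ m) v j0" using iter j0 by simp
  also have "\<dots> \<le> b - c * (b - a)"
  proof -
    \<comment> \<open>The minorisation is applied to the nonnegative vector \<open>b - v\<close>,
      whose value at the minimum \<open>i0\<close> is the full oscillation
      \<open>b - a\<close>.\<close>
    have "c * (b - v i0) \<le> (?T ^^ m) (\<lambda>i. b - 1 * v i) j0"
      using c(2)[rule_format, OF i0(1) j0(1), of "\<lambda>i. b - v i"] ab by simp
    also have "\<dots> = b - (?T ^^ m) v j0" unfolding vec_mat_pow_diff using const j0(1) by simp
    finally show ?thesis using i0(2) by simp
  qed
  finally have "c * (b - a) \<le> (1 - exp (- 2 * real m * d)) * b" by (simp add: algebra_simps)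
  then have "b - a \<le> (1 - exp (- 2 * real m * d)) / c * b" using c(1) by (simp add: field_simps)
  \<comment> \<open>So \<open>r\<close> bounds the ratio of the minimum to the maximum of
    \<open>v\<close> from below, and every quotient \<open>v i / v j\<close> lies between
    \<open>r\<close> and \<open>1 / r\<close>.\<close>
  then have rb: "r * b \<le> a" by (simp add: r(1) algebra_simps)
  have ist: "i \<in> states" "j \<in> states" using ij edge_states by blast+
  have q'_eq: "q' i j = e i j * q i j * (v i / (w * v j))"
    using q'(2)[OF ij] w v[OF ist(2)] by (simp add: field_simps)
  have "r * v j \<le> r * b" using ab[OF ist(2)] r(2) by simp
  with rb ab[OF ist(1)] have rv: "r * v j \<le> v i" by linarith
  have "r * v i \<le> r * b" using ab[OF ist(1)] r(2) by simp
  with rb ab[OF ist(2)] have rv': "r * v i \<le> v j" by linarith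
  have vpos: "0 < v i" "0 < v j" using v ist by auto
  \<comment> \<open>One factor \<open>exp (- d)\<close> comes from \<open>w\<close> and a second one
    from \<open>e\<close>, hence \<open>exp (- 2 * d)\<close> in the claim.\<close>
  have "exp (- d) * r \<le> v i / (w * v j)"
  proof -
    have "exp (- d) * r * (w * v j) = (exp (- d) * w) * (r * v j)" by simp
    also have "\<dots> \<le> 1 * v i"
      using rv w2 w r(2) vpos by (intro mult_mono) (auto simp: exp_minus field_simps)
    finally show ?thesis using w vpos by (simp add: pos_le_divide_eq)
  qed
  moreover have "v i / (w * v j) \<le> exp d / r"
  proof -
    have "v i * r \<le> 1 * v j" using rv' by (simp add: mult.commute)
    also have "\<dots> \<le> (exp d * w) * v j"
    proof (intro mult_right_mono)
      have "exp d * exp (- d) \<le> exp d * w" using w1 by (intro mult_left_mono) auto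
      then show "1 \<le> exp d * w" by (simp add: exp_minus)
    qed (use vpos in auto)
    finally show ?thesis using w vpos r(2) by (simp add: divide_simps mult.assoc)
  qed
  moreover have "exp (- d) * q i j \<le> e i j * q i j" "e i j * q i j \<le> exp d * q i j" "0 < q i j" "0 < e i j"
    using e[OF ij] kernel_pos[OF q ij] by (auto intro: less_le_trans[OF exp_gt_zero])
  ultimately have "(exp (- d) * q i j) * (exp (- d) * r) \<le> q' i j"
    "q' i j \<le> (exp d * q i j) * (exp d / r)"
    unfolding q'_eq using r(2) vpos w by (intro mult_mono; simp)+
  moreover have "exp (- 2 * d) = exp (- d) * exp (- d)" "exp (2 * d) = exp d * exp d"
    by (simp_all add: mult_exp_exp)
  ultimately show ?thesis by (simp add: mult.assoc mult.left_commute mult.commute)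
qed

text \<open>\<open>m\<close> and \<open>c\<close> belong to \<open>q\<close>, so the estimate is
  uniform in \<open>f'\<close>. Its two factors tend to 1 as \<open>d\<close> tends to 0, and
  \<open>q i j \<le> 1\<close> turns the relative error into an absolute one.\<close>

lemma kernel_of_stable:
  assumes f: "kernel_of f q" and "0 < \<rho>"
  shows "\<exists>d>0. \<forall>f' q'. kernel_of f' q' \<and> (\<forall>i j. edge i j \<longrightarrow> \<bar>potential f' i j - potential f i j\<bar> \<le> d)
           \<longrightarrow> (\<forall>i j. edge i j \<longrightarrow> \<bar>q' i j - q i j\<bar> \<le> \<rho>)"
proof -
  have q: "kernel q" using f by (simp add: kernel_of_def)
  obtain u l where u: "0 < l" "\<forall>i\<in>states. 0 < u i"
    "\<And>i j. edge i j \<Longrightarrow> exp (potential f i j) * u i = l * u j * q i j"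
    using f unfolding kernel_of_def by blast
  obtain m where m: "1 \<le> m" "\<And>i j. i \<in> states \<Longrightarrow> j \<in> states \<Longrightarrow> (edge ^^ m) i j"
    using primitive by blast
  interpret primitive_matrix states q edge m by (rule kernel_primitive_matrix[OF q m])
  obtain c where c: "0 < c" "\<forall>i\<in>states. \<forall>j\<in>states. \<forall>x. (\<forall>i\<in>states. 0 \<le> x i) \<longrightarrow> c * x i \<le> (T ^^ m) x j"
    using uniform_pow_ge by blast
  define r where "r d = 1 - (1 - exp (- 2 * real m * d)) / c" for d
  have r: "(r \<longlongrightarrow> 1 - (1 - exp (- 2 * real m * 0)) / c) (at_right 0)"
    unfolding r_def using c(1) by (intro tendsto_intros) auto
  have lim: "((\<lambda>d. exp (2 * d) / r d) \<longlongrightarrow> 1) (at_right 0)" "((\<lambda>d. exp (- 2 * d) * r d) \<longlongrightarrow> 1) (at_right 0)"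
    by (rule tendsto_eq_intros r | simp)+
  have "\<forall>\<^sub>F d in at_right 0. 0 < d \<and> 0 < r d \<and> exp (2 * d) / r d < 1 + \<rho> \<and> 1 - \<rho> < exp (- 2 * d) * r d"
    using \<open>0 < \<rho>\<close> by (intro eventually_conj order_tendstoD[OF r] order_tendstoD[OF lim(1)] order_tendstoD[OF lim(2)]
        eventually_at_right_less) auto
  then obtain d where d: "0 < d" "0 < r d" "exp (2 * d) / r d < 1 + \<rho>" "1 - \<rho> < exp (- 2 * d) * r d"
    using eventually_happens'[OF trivial_limit_at_right_real] by blast
  show ?thesis
  proof (intro exI[of _ d] conjI allI impI d(1); elim conjE)
    fix f' q' i j
    assume f': "kernel_of f' q'" and close: "\<forall>i j. edge i j \<longrightarrow> \<bar>potential f' i j - potential f i j\<bar> \<le> d"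
      and ij: "edge i j"
    obtain u' l' where u': "0 < l'" "\<forall>i\<in>states. 0 < u' i"
      "\<And>i j. edge i j \<Longrightarrow> exp (potential f' i j) * u' i = l' * u' j * q' i j"
      using f' unfolding kernel_of_def by blast
    have "exp (- 2 * d) * r d * q i j \<le> q' i j \<and> q' i j \<le> exp (2 * d) / r d * q i j"
    proof (rule perturbed_kernel_bound[OF q m(1) c, where v = "\<lambda>i. u' i / u i" and w = "l' / l"
          and e = "\<lambda>i j. exp (potential f' i j - potential f i j)" and d = d])
      show "kernel q'" using f' by (simp add: kernel_of_def)
      fix i j assume ij: "edge i j"
      have p: "0 < u i" "0 < u j" using edge_states[OF ij] u by auto
      have "q' i j * (l' * u' j) * (exp (potential f i j) * u i) = exp (potential f' i j) * u' i * (l * u j * q i j)"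
        using u(3)[OF ij] u'(3)[OF ij] by simp
      then show "q' i j * (l' / l * (u' j / u j)) = exp (potential f' i j - potential f i j) * q i j * (u' i / u i)"
        using p u(1) by (simp add: exp_diff field_simps)
      have "\<bar>potential f' i j - potential f i j\<bar> \<le> d" using close ij by blast
      then show "exp (- d) \<le> exp (potential f' i j - potential f i j) \<and> exp (potential f' i j - potential f i j) \<le> exp d"
        by auto
    qed (use u u' d ij in \<open>auto simp: r_def\<close>)
    moreover have "0 < q i j" "q i j \<le> 1" using kernel_pos[OF q ij] kernel_le_1[OF q] by auto
    moreover have "(1 - \<rho>) * q i j \<le> exp (- 2 * d) * r d * q i j" "exp (2 * d) / r d * q i j \<le> (1 + \<rho>) * q i j"
      using d \<open>0 < q i j\<close> by (intro mult_right_mono; simp)+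
    moreover have "\<rho> * q i j \<le> \<rho>" using \<open>0 < \<rho>\<close> \<open>q i j \<le> 1\<close> by simp
    ultimately show "\<bar>q' i j - q i j\<bar> \<le> \<rho>" by (auto simp: abs_le_iff algebra_simps)
  qed
qed

text \<open>There are finitely many edges, so distinct values of \<open>q\<close> have a least gap,
  which survives small changes of the values. Edges of value 1 do not move at all.\<close>

lemma separating_open:
  assumes f: "kernel_of f q" and sep: "separating q"
  shows "\<exists>d>0. \<forall>f' q'. kernel_of f' q' \<and> (\<forall>i j. edge i j \<longrightarrow> \<bar>potential f' i j - potential f i j\<bar> \<le> d)
           \<longrightarrow> separating q'"
proof -
  have q: "kernel q" using f by (simp add: kernel_of_def)
  let ?E = "{(i, j). edge i j}"
  \<comment> \<open>Inserting 1 makes the set nonempty. A third of the least gap is a sufficient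
    precision because both compared values move by at most \<open>\<rho>\<close>.\<close>
  define gaps where "gaps = insert 1 ((\<lambda>((i, j), (i', j')). \<bar>q i j - q i' j'\<bar>) ` (?E \<times> ?E) - {0})"
  have fin: "finite gaps" unfolding gaps_def using finite_edges by simp
  define \<rho> where "\<rho> = Min gaps / 3"
  have "0 < Min gaps" using fin by (subst Min_gr_iff) (auto simp: gaps_def)
  then have "0 < \<rho>" by (simp add: \<rho>_def)
  obtain d where d: "d > 0" and close: "\<And>f' q' i j. kernel_of f' q' \<Longrightarrow>
      (\<forall>i j. edge i j \<longrightarrow> \<bar>potential f' i j - potential f i j\<bar> \<le> d) \<Longrightarrow> edge i j \<Longrightarrow> \<bar>q' i j - q i j\<bar> \<le> \<rho>"
    using kernel_of_stable[OF f \<open>0 < \<rho>\<close>] by blast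
  show ?thesis
  proof (intro exI[of _ d] conjI allI impI d; elim conjE)
    fix f' q' assume f': "kernel_of f' q'" and c: "\<forall>i j. edge i j \<longrightarrow> \<bar>potential f' i j - potential f i j\<bar> \<le> d"
    have q': "kernel q'" using f' by (simp add: kernel_of_def)
    show "separating q'" unfolding separating_def
    proof (intro allI impI, elim conjE)
      fix i j i' j' assume e: "edge i j" "edge i' j'" and eq: "q' i j = q' i' j'" and "q' i j \<noteq> 1"
      then have "q i j \<noteq> 1" using kernel_eq_1_iff q q' by metis
      show "i = i' \<and> j = j'"
      proof (rule ccontr)
        assume "\<not> ?thesis"
        then have "q i j \<noteq> q i' j'" using sep e \<open>q i j \<noteq> 1\<close> unfolding separating_def by blast
        then have "\<bar>q i j - q i' j'\<bar> \<in> gaps" using e by (force simp: gaps_def)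
        then have "3 * \<rho> \<le> \<bar>q i j - q i' j'\<bar>" using fin by (simp add: \<rho>_def)
        moreover have "\<bar>q' i j - q i j\<bar> \<le> \<rho>" "\<bar>q' i' j' - q i' j'\<bar> \<le> \<rho>" using close[OF f' c] e by auto
        ultimately show False using eq \<open>0 < \<rho>\<close> by linarith
      qed
    qed
  qed
qed

text \<open>The amount added at \<open>i\<close> is taken away at \<open>i2\<close>, so column sums
  are preserved; \<open>t < q i2 j\<close> keeps the entry at \<open>i2\<close> positive.\<close>

lemma kernel_transfer:
  assumes q: "kernel q" and e: "edge i j" "edge i2 j" "i \<noteq> i2" and t: "0 < t" "t < q i2 j"
  defines "q' \<equiv> \<lambda>k l. q k l + t * (if l = j then (if k = i then 1 else if k = i2 then -1 else 0) else 0)"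
  shows "kernel q'"
  unfolding kernel_def
proof (intro conjI allI impI ballI)
  fix k l assume "edge k l"
  then show "0 < q' k l" using kernel_pos[OF q] t by (auto simp: q'_def intro: add_pos_pos)
next
  fix k l assume "\<not> edge k l"
  then show "q' k l = 0" using kernel_0[OF q] e by (auto simp: q'_def)
next
  fix l assume l: "l \<in> states"
  have st: "i \<in> states" "i2 \<in> states" using e edge_states by blast+
  have "(\<Sum>k\<in>states. if k = i then 1 else if k = i2 then -1 else 0 :: real)
     = (\<Sum>k\<in>states. (if k = i then 1 else 0) + (if k = i2 then -1 else 0))"
    using e by (intro sum.cong) auto
  also have "\<dots> = 0" using st by (simp add: sum.distrib)
  finally have z: "(\<Sum>k\<in>states. if k = i then 1 else if k = i2 then -1 else 0 :: real) = 0" .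
  show "(\<Sum>k\<in>states. q' k l) = 1"
    using kernel_sum[OF q l] z
    by (cases "l = j") (simp_all add: q'_def sum.distrib sum_distrib_left[symmetric])
qed

text \<open>Moving mass \<open>t\<close> within one column separates a given pair of edges and, apart from finitely
  many values of \<open>t\<close>, keeps all pairs separated that were so before.\<close>

lemma separating_dense_pairs:
  assumes q: "kernel q" and S: "finite S"
    "S \<subseteq> {((i, j), (i', j')). edge i j \<and> edge i' j' \<and> (i, j) \<noteq> (i', j') \<and> (\<exists>k. edge k j \<and> k \<noteq> i)}"
    and "0 < d"
  shows "\<exists>q'. kernel q' \<and> (\<forall>i j. \<bar>q' i j - q i j\<bar> < d) \<and>
    (\<forall>((i, j), (i', j'))\<in>S. q' i j \<noteq> q' i' j')"
  using S \<open>0 < d\<close>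
proof (induction S arbitrary: d rule: finite_induct)
  case empty
  then show ?case using q by (intro exI[of _ q]) auto
next
  case (insert p S)
  obtain i j i' j' where p: "p = ((i, j), (i', j'))" by (metis surj_pair)
  have e: "edge i j" "edge i' j'" "(i, j) \<noteq> (i', j')" and "\<exists>k. edge k j \<and> k \<noteq> i"
    using insert.prems by (auto simp: p)
  \<comment> \<open>If the second edge lies in the same column, mass is taken from that edge itself;
    otherwise from any other predecessor of \<open>j\<close>. In both cases the two values of
    \<open>D\<close> on the pair differ.\<close>
  have "\<exists>i2. edge i2 j \<and> i2 \<noteq> i \<and> (j' = j \<longrightarrow> i2 = i')"
    using e \<open>\<exists>k. edge k j \<and> k \<noteq> i\<close> by (cases "j' = j") auto
  then obtain i2 where i2: "edge i2 j" "i2 \<noteq> i" "j' = j \<Longrightarrow> i2 = i'" by blast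
  have "\<exists>q1. kernel q1 \<and> (\<forall>i j. \<bar>q1 i j - q i j\<bar> < d / 2) \<and>
      (\<forall>((i, j), (i', j'))\<in>S. q1 i j \<noteq> q1 i' j')"
    by (rule insert.IH) (use insert.prems in auto)
  then obtain q1 where q1: "kernel q1" "\<And>i j. \<bar>q1 i j - q i j\<bar> < d / 2"
    "\<forall>((i, j), (i', j'))\<in>S. q1 i j \<noteq> q1 i' j'"
    by (elim exE conjE) simp
  define D where "D k l = (if l = j then (if k = i then 1 else if k = i2 then -1 else 0) else (0::real))" for k l
  \<comment> \<open>The values of \<open>t\<close> at which some pair would coincide. A pair with
    equal \<open>D\<close> contributes only 0, by the convention for division by zero, and
    \<open>t\<close> is positive.\<close>
  define bad where "bad = (\<lambda>((k, l), (k', l')). (q1 k' l' - q1 k l) / (D k l - D k' l')) ` insert p S"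
  have "finite bad" unfolding bad_def using insert.hyps by simp
  define t0 where "t0 = min (d / 2) (q1 i2 j)"
  have "0 < t0" using insert.prems kernel_pos[OF q1(1) i2(1)] by (simp add: t0_def)
  then have "infinite ({0<..<t0} - bad)" using \<open>finite bad\<close> by (simp add: infinite_Ioo)
  then obtain t where t: "0 < t" "t < t0" "t \<notin> bad" by (metis Diff_iff finite.emptyI greaterThanLessThan_iff equals0I)
  define q' where "q' k l = q1 k l + t * D k l" for k l
  have "kernel q'"
    using kernel_transfer[OF q1(1) e(1) i2(1) _ t(1)] i2 t by (simp add: q'_def[abs_def] D_def[abs_def] t0_def)
  moreover have "\<bar>q' k l - q k l\<bar> < d" for k l
  proof -
    have "\<bar>t * D k l\<bar> \<le> t" using t by (auto simp: D_def)
    moreover have "t < d / 2" using t by (simp add: t0_def)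
    moreover have "q' k l - q k l = (q1 k l - q k l) + t * D k l" by (simp add: q'_def)
    ultimately show ?thesis using q1(2)[of k l] by linarith
  qed
  moreover have "q' k l \<noteq> q' k' l'" if "((k, l), (k', l')) \<in> insert p S" for k l k' l'
  proof
    assume eq: "q' k l = q' k' l'"
    then have *: "t * (D k l - D k' l') = q1 k' l' - q1 k l" by (simp add: q'_def algebra_simps)
    show False
    proof (cases "D k l = D k' l'")
      case True
      then have "((k, l), (k', l')) \<notin> S" using * q1(3) by fastforce
      with that have "k = i" "l = j" "k' = i'" "l' = j'" by (auto simp: p)
      with True e i2 show False by (auto simp: D_def split: if_splits)
    next
      case False
      with * have "t = (q1 k' l' - q1 k l) / (D k l - D k' l')" by (simp add: field_simps)
      then have "t \<in> bad" unfolding bad_def by (intro image_eqI[OF _ that]) simp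
      with t show False by simp
    qed
  qed
  ultimately show ?case by (intro exI[of _ q']) auto
qed

lemma separating_dense:
  assumes q: "kernel q" and "0 < d"
  shows "\<exists>q'. kernel q' \<and> separating q' \<and> (\<forall>i j. \<bar>q' i j - q i j\<bar> < d)"
proof -
  let ?S = "{((i, j), (i', j')). edge i j \<and> edge i' j' \<and> (i, j) \<noteq> (i', j') \<and> (\<exists>k. edge k j \<and> k \<noteq> i)}"
  have "finite ?S"
    by (rule finite_subset[of _ "{(i, j). edge i j} \<times> {(i, j). edge i j}"]) (auto intro: finite_edges)
  then obtain q' where q': "kernel q'" "\<forall>i j. \<bar>q' i j - q i j\<bar> < d"
    "\<forall>((i, j), (i', j'))\<in>?S. q' i j \<noteq> q' i' j'"
    using separating_dense_pairs[OF q _ order.refl \<open>0 < d\<close>] by blast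
  have "separating q'" unfolding separating_def
  proof (intro allI impI, elim conjE)
    fix i j i' j' assume *: "edge i j" "edge i' j'" "q' i j = q' i' j'" "q' i j \<noteq> 1"
    then have "\<exists>k. edge k j \<and> k \<noteq> i" using kernel_eq_1_iff[OF q'(1)] by blast
    with q'(3) * show "i = i' \<and> j = j'" by fastforce
  qed
  with q' show ?thesis by blast
qed

subsection \<open>The generic set\<close>

definition generic :: "((nat \<Rightarrow> nat) \<Rightarrow> real) set" where
  "generic = {f \<in> locally_constant N A 2. \<exists>q. kernel_of f q \<and> separating q}"

lemma potential_dist:
  assumes "f \<in> locally_constant N A 2" "g \<in> locally_constant N A 2" "edge i j"
  shows "\<bar>potential f i j - potential g i j\<bar> \<le> sup_dist N A (locally_constant N A 2) f g"
proof -
  obtain \<omega> where w: "\<omega> \<in> \<Omega>" "\<omega> 0 = i" "\<omega> 1 = j" using ex_edge_path assms(3) by blast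
  then have "\<bar>potential f i j - potential g i j\<bar> = \<bar>f \<omega> - g \<omega>\<bar>"
    using potential_eq[OF assms(1) w(1)] potential_eq[OF assms(2) w(1)] by simp
  also have "\<dots> \<le> sup_dist N A (locally_constant N A 2) f g"
    using assms w(1) by (auto simp: sup_dist_def intro!: cSUP_upper bdd_above_sup_dist)
  finally show ?thesis .
qed

lemma generic_open: "openin (function_topology N A (locally_constant N A 2)) generic"
proof -
  let ?C = "locally_constant N A 2"
  interpret Metric_space ?C "sup_dist N A ?C"
    by (rule Metric_space_locally_constant[OF shift_space_nonempty])
  have "\<exists>r>0. mball f r \<subseteq> generic" if f: "f \<in> generic" for f
  proof -
    obtain q where q: "f \<in> ?C" "kernel_of f q" "separating q" using f by (auto simp: generic_def)
    obtain d where d: "d > 0" and sep: "\<And>f' q'. kernel_of f' q' \<Longrightarrow>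
      (\<forall>i j. edge i j \<longrightarrow> \<bar>potential f' i j - potential f i j\<bar> \<le> d) \<Longrightarrow> separating q'"
      using separating_open[OF q(2,3)] by blast
    have "mball f d \<subseteq> generic"
    proof
      fix g assume g: "g \<in> mball f d"
      obtain q' where q': "kernel_of g q'" using ex_kernel_of by blast
      have "\<bar>potential g i j - potential f i j\<bar> \<le> d" if "edge i j" for i j
        using potential_dist[of f g, OF _ _ that] g by (auto simp: abs_minus_commute)
      then have "separating q'" using sep q' by blast
      with q' g show "g \<in> generic" by (auto simp: generic_def)
    qed
    with d show ?thesis by blast
  qed
  then show ?thesis unfolding function_topology_def openin_mtopology by (auto simp: generic_def)
qed

text \<open>The kernel is perturbed first and \<open>ln q' - ln q\<close> is then added to
  \<open>f\<close>: the same \<open>u\<close> and \<open>l\<close> witness the new kernel, so no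
  Perron data have to be followed.\<close>

lemma generic_dense: "(function_topology N A (locally_constant N A 2)) closure_of generic = locally_constant N A 2"
proof -
  let ?C = "locally_constant N A 2"
  interpret Metric_space ?C "sup_dist N A ?C"
    by (rule Metric_space_locally_constant[OF shift_space_nonempty])
  have "\<exists>g\<in>generic. g \<in> mball f r" if f: "f \<in> ?C" and "0 < r" for f r
  proof -
    obtain q where q: "kernel_of f q" using ex_kernel_of by blast
    then have k: "kernel q" by (simp add: kernel_of_def)
    \<comment> \<open>Half of \<open>r\<close> is asked for because the strict bound on paths
      becomes a weak one for the supremum.\<close>
    have "\<exists>d>0. \<forall>x. \<bar>x - q i j\<bar> < d \<longrightarrow> 0 < x \<and> \<bar>ln x - ln (q i j)\<bar> < r / 2" if "edge i j" for i j
    proof -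
      have "isCont ln (q i j)" using kernel_pos[OF k that] by (intro isCont_ln) auto
      then obtain s where s: "s > 0" "\<And>x. \<bar>x - q i j\<bar> < s \<Longrightarrow> \<bar>ln x - ln (q i j)\<bar> < r / 2"
        using \<open>0 < r\<close> unfolding continuous_at_eps_delta dist_real_def by (metis half_gt_zero)
      then show ?thesis using kernel_pos[OF k that] by (intro exI[of _ "min s (q i j)"]) auto
    qed
    then have "\<forall>e\<in>{(i, j). edge i j}. \<exists>d>0. \<forall>x. \<bar>x - q (fst e) (snd e)\<bar> < d
        \<longrightarrow> 0 < x \<and> \<bar>ln x - ln (q (fst e) (snd e))\<bar> < r / 2" by auto
    then obtain d where d: "\<And>i j. edge i j \<Longrightarrow> 0 < d (i, j)"
      "\<And>i j x. edge i j \<Longrightarrow> \<bar>x - q i j\<bar> < d (i, j) \<Longrightarrow> \<bar>ln x - ln (q i j)\<bar> < r / 2"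
      unfolding bchoice_iff by (metis (mono_tags, lifting) case_prodI fst_conv mem_Collect_eq snd_conv)
    define d0 where "d0 = Min (insert 1 (d ` {(i, j). edge i j}))"
    have fin: "finite (insert 1 (d ` {(i, j). edge i j}))" using finite_edges by simp
    have "0 < d0" unfolding d0_def using fin d(1) by (subst Min_gr_iff) auto
    have d0: "d0 \<le> d (i, j)" if "edge i j" for i j
      unfolding d0_def using fin that by (intro Min_le) auto
    obtain q' where q': "kernel q'" "separating q'" "\<And>i j. \<bar>q' i j - q i j\<bar> < d0"
      using separating_dense[OF k \<open>0 < d0\<close>] by blast
    have ln: "\<bar>ln (q' i j) - ln (q i j)\<bar> < r / 2" if "edge i j" for i j
      using d(2)[OF that] q'(3) d0[OF that] by (meson less_le_trans)
    define g where "g \<omega> = (if \<omega> \<in> \<Omega> then f \<omega> + (ln (q' (\<omega> 0) (\<omega> 1)) - ln (q (\<omega> 0) (\<omega> 1))) else 0)" for \<omega>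
    have g: "g \<in> ?C"
      unfolding locally_constant_def
    proof (intro CollectI conjI ballI allI impI)
      fix \<omega> \<eta> assume "\<omega> \<in> \<Omega>" "\<eta> \<in> \<Omega>" and *: "\<forall>k<2. \<omega> k = \<eta> k"
      moreover have "f \<omega> = f \<eta>" using f calculation unfolding locally_constant_def by blast
      moreover have "\<omega> 0 = \<eta> 0" "\<omega> 1 = \<eta> 1" using * by auto
      ultimately show "g \<omega> = g \<eta>" by (simp add: g_def)
    qed (simp add: g_def)
    have pot: "potential g i j = potential f i j + (ln (q' i j) - ln (q i j))" if e: "edge i j" for i j
    proof -
      obtain \<omega> where w: "\<omega> \<in> \<Omega>" "\<omega> 0 = i" "\<omega> 1 = j" using ex_edge_path[OF e] by blast
      then show ?thesis
        using potential_eq[OF f w(1)] potential_eq[OF g w(1)] by (simp add: g_def)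
    qed
    obtain u l where u: "0 < l" "\<forall>i\<in>states. 0 < u i"
      "\<And>i j. edge i j \<Longrightarrow> exp (potential f i j) * u i = l * u j * q i j"
      using q unfolding kernel_of_def by blast
    have "exp (potential g i j) * u i = l * u j * q' i j" if "edge i j" for i j
    proof -
      have "exp (potential g i j) * u i = exp (potential f i j) * u i * (q' i j / q i j)"
        using kernel_pos[OF k that] kernel_pos[OF q'(1) that] by (simp add: pot[OF that] exp_add exp_diff)
      also have "\<dots> = l * u j * q' i j"
        using u(3)[OF that] kernel_pos[OF k that] by simp
      finally show ?thesis .
    qed
    then have "kernel_of g q'" unfolding kernel_of_def using q'(1) u(1,2) by blast
    then have "g \<in> generic" using g q'(2) by (auto simp: generic_def)
    moreover have "\<bar>f \<omega> - g \<omega>\<bar> \<le> r / 2" if "\<omega> \<in> \<Omega>" for \<omega>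
      using ln[OF shift_space_edge[OF that, of 0]] that
      unfolding abs_minus_commute[of "f \<omega>"] by (simp add: g_def)
    then have "(\<Squnion>\<omega>\<in>\<Omega>. \<bar>f \<omega> - g \<omega>\<bar>) \<le> r / 2"
      by (intro cSUP_least shift_space_nonempty)
    then have "sup_dist N A ?C f g \<le> r / 2"
      using f g by (simp only: sup_dist_def if_True simp_thms)
    ultimately show ?thesis using f g \<open>0 < r\<close> by (intro bexI[of _ g]) auto
  qed
  then show ?thesis unfolding function_topology_def metric_closure_of by (auto simp: generic_def)
qed

subsection \<open>Markov measures\<close>

text \<open>The weight \<open>p\<close> stands at the last symbol because the chain runs backwards.
  Invariance follows from the column sums of \<open>q\<close>, in
  \<open>measure_shift\<close>.\<close>

definition markov :: "(nat \<Rightarrow> nat \<Rightarrow> real) \<Rightarrow> (nat \<Rightarrow> nat) measure \<Rightarrow> bool" where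
  "markov q \<mu> \<longleftrightarrow> kernel q \<and> prob_space \<mu> \<and> sets \<mu> = sets \<B> \<and>
     (\<exists>p. (\<forall>i\<in>states. 0 < p i) \<and> (\<Sum>i\<in>states. p i) = 1 \<and>
       (\<forall>\<omega>\<in>\<Omega>. \<forall>n. measure \<mu> (cyl (Suc n) \<omega>) = (\<Prod>k<n. q (\<omega> k) (\<omega> (Suc k))) * p (\<omega> n)))"

text \<open>A Markov chain is a function of independent random maps \<open>u\<close>, each of which proposes a
  successor \<open>u i\<close> for every state \<open>i\<close>; the argument 0 serves for the initial state. Off a null set
  the proposals are admissible, and \<open>step\<close> overrides the others.\<close>

lemma ex_markov:
  assumes q: "kernel q"
  shows "\<exists>\<mu>. markov q \<mu>"
proof -
  obtain p where p: "\<forall>i\<in>states. 0 < p i" "(\<Sum>i\<in>states. p i) = 1"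
    "\<forall>i\<in>states. (\<Sum>j\<in>states. q i j * p j) = p i" using ex_stationary[OF q] by blast
  define adm where "adm i j \<longleftrightarrow> (if i = 0 then j \<in> states else edge i j)" for i j
  \<comment> \<open>The forward transition probabilities, obtained from \<open>q\<close> by time
    reversal; their rows sum to 1 by stationarity of \<open>p\<close>.\<close>
  define w where "w i j = (if adm i j then if i = 0 then p j else q i j * p j / p i else 0)" for i j
  have adm_states: "adm i j \<Longrightarrow> j \<in> states" for i j
    using edge_states by (auto simp: adm_def split: if_splits)
  have w_nonneg: "0 \<le> w i j" if "i \<le> N" for i j
  proof -
    have "0 < p j" if "adm i j" using adm_states[OF that] p by blast
    moreover have "0 < p i" if "adm i j" "i \<noteq> 0" using that edge_states p by (auto simp: adm_def)
    ultimately show ?thesis using kernel_nonneg[OF q] by (auto simp: w_def less_imp_le)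
  qed
  have w_sum: "(\<Sum>j\<in>states. w i j) = 1" if "i \<le> N" for i
  proof (cases "i = 0")
    case True then show ?thesis using p(2) by (simp add: w_def adm_def)
  next
    case False
    then have i: "i \<in> states" using that by simp
    have "(\<Sum>j\<in>states. w i j) = (\<Sum>j\<in>states. q i j * p j / p i)"
      using False kernel_0[OF q] by (intro sum.cong) (auto simp: w_def adm_def)
    also have "\<dots> = p i / p i" using p(3) i by (simp add: sum_divide_distrib[symmetric])
    also have "\<dots> = 1" using p(1) i by (metis divide_self less_irrefl)
    finally show ?thesis .
  qed
  have pmf_w: "pmf (embed_pmf (w i)) j = w i j" if "i \<le> N" for i j
  proof (rule pmf_embed_pmf)
    have "(\<integral>\<^sup>+ x. ennreal (w i x) \<partial>count_space UNIV) = (\<Sum>j\<in>states. ennreal (w i j))"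
      using adm_states by (intro nn_integral_count_space') (auto simp: w_def)
    also have "\<dots> = 1" using w_sum[OF that] w_nonneg[OF that] by simp
    finally show "(\<integral>\<^sup>+ x. ennreal (w i x) \<partial>count_space UNIV) = 1" .
  qed (rule w_nonneg[OF that])
  define Q where "Q = Pi_pmf {0..N} 0 (\<lambda>i. embed_pmf (w i))"
  define step where "step i u = (if adm i (u i) then u i else (SOME j. adm i j))" for i and u :: "nat \<Rightarrow> nat"
  have adm_step: "adm i (step i u)" if "i \<le> N" for i u
  proof -
    have "\<exists>j. adm i j" using ex_successor[of i] that states_nonempty
      by (cases "i = 0") (auto simp: adm_def)
    then show ?thesis by (auto simp: step_def intro: someI_ex)
  qed
  have prob_step: "measure Q {u. step i u = j} = w i j" if "i \<le> N" for i j
  proof -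
    have comp: "map_pmf (\<lambda>u. u i) Q = embed_pmf (w i)"
      using that by (simp add: Q_def Pi_pmf_component)
    have "step i u = u i" if u: "u \<in> set_pmf Q" for u
    proof -
      have "u i \<in> set_pmf (embed_pmf (w i))" using u comp[symmetric] by simp
      then have "w i (u i) \<noteq> 0" using pmf_w[OF \<open>i \<le> N\<close>] by (simp add: set_pmf_iff)
      then show ?thesis by (auto simp: w_def step_def split: if_splits)
    qed
    then have "map_pmf (step i) Q = embed_pmf (w i)"
      unfolding comp[symmetric] by (intro map_pmf_cong) auto
    then have "pmf (map_pmf (step i) Q) j = w i j" using pmf_w that by simp
    then show ?thesis by (simp add: pmf_map vimage_def)
  qed
  define x where "x u = rec_nat (step 0 (u 0)) (\<lambda>n y. step y (u (Suc n)))" for u :: "nat \<Rightarrow> nat \<Rightarrow> nat"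
  have x_0: "x u 0 = step 0 (u 0)" and x_Suc: "x u (Suc n) = step (x u n) (u (Suc n))" for u n
    by (simp_all add: x_def)
  have x_states: "x u n \<in> states" for u n
  proof (induction n)
    case 0 show ?case using adm_step[of 0 "u 0"] adm_states by (simp only: x_0) blast
  next
    case (Suc n)
    then have "x u n \<le> N" by simp
    then show ?case using adm_step[of "x u n" "u (Suc n)"] adm_states by (simp only: x_Suc) blast
  qed
  have x_in: "x u \<in> \<Omega>" for u
    unfolding shift_space_iff
  proof
    fix n
    have "x u n \<le> N" "x u n \<noteq> 0" using x_states[of u n] by auto
    then show "edge (x u n) (x u (Suc n))" using adm_step[of "x u n" "u (Suc n)"]
      by (simp add: x_Suc adm_def)
  qed
  define M where "M = PiM (UNIV :: nat set) (\<lambda>_. measure_pmf Q)"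
  interpret product_prob_space "\<lambda>_. measure_pmf Q" "UNIV :: nat set" by unfold_locales
  have sp: "space M = UNIV" by (auto simp: M_def space_PiM)
  define prev where "prev \<omega> k = (case k of 0 \<Rightarrow> 0 | Suc k \<Rightarrow> \<omega> k)" for \<omega> :: "nat \<Rightarrow> nat" and k
  \<comment> \<open>Following \<open>\<omega>\<close> is rewritten as one condition on each
    \<open>u k\<close> separately, with the previous symbol prescribed. The event thus becomes a
    product set, whose measure is a product by independence.\<close>
  have agree: "(\<forall>k\<le>n. x u k = \<omega> k) \<longleftrightarrow> (\<forall>k\<le>n. step (prev \<omega> k) (u k) = \<omega> k)" for u \<omega> n
  proof (induction n)
    case 0 show ?case by (simp add: x_0 prev_def)
  next
    case (Suc n)
    have split: "(\<forall>k\<le>Suc n. R k) \<longleftrightarrow> (\<forall>k\<le>n. R k) \<and> R (Suc n)" for R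
      by (auto simp: le_Suc_eq)
    have "(\<forall>k\<le>Suc n. x u k = \<omega> k) \<longleftrightarrow> (\<forall>k\<le>n. x u k = \<omega> k) \<and> step (\<omega> n) (u (Suc n)) = \<omega> (Suc n)"
      unfolding split x_Suc by auto
    also have "\<dots> \<longleftrightarrow> (\<forall>k\<le>Suc n. step (prev \<omega> k) (u k) = \<omega> k)"
      unfolding Suc.IH split by (simp add: prev_def)
    finally show ?case .
  qed
  define F where "F \<omega> k = {u. step (prev \<omega> k) u = \<omega> k}" for \<omega> k
  have pre: "x -` cyl (Suc n) \<omega> \<inter> space M = prod_emb UNIV (\<lambda>_. measure_pmf Q) {..n} (PiE {..n} (F \<omega>))" for n \<omega>
  proof -
    have "x u \<in> cyl (Suc n) \<omega> \<longleftrightarrow> restrict u {..n} \<in> PiE {..n} (F \<omega>)" for u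
      using agree[of n u \<omega>] x_in[of u] by (auto simp: mem_cyl less_Suc_eq_le F_def PiE_def Pi_def)
    then show ?thesis by (auto simp: prod_emb_def sp)
  qed
  have x_meas: "x \<in> M \<rightarrow>\<^sub>M \<B>"
  proof (rule measurable_shift_borelI)
    fix n \<omega>
    show "x -` cyl n \<omega> \<inter> space M \<in> sets M"
    proof (cases n)
      case 0
      then have "x -` cyl n \<omega> \<inter> space M = space M" using x_in by (auto simp: sp)
      then show ?thesis by simp
    next
      case (Suc n')
      show ?thesis unfolding Suc pre unfolding M_def by (intro sets_PiM_I) auto
    qed
  qed (rule x_in)
  define \<mu> where "\<mu> = distr M \<B> x"
  have "prob_space \<mu>" unfolding \<mu>_def M_def using x_meas by (intro prob_space_distr) (auto simp: M_def)
  moreover have "measure \<mu> (cyl (Suc n) \<omega>) = (\<Prod>k<n. q (\<omega> k) (\<omega> (Suc k))) * p (\<omega> n)"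
    if w\<Omega>: "\<omega> \<in> \<Omega>" for \<omega> n
  proof -
    note st = shift_space_states[OF w\<Omega>]
    have "measure \<mu> (cyl (Suc n) \<omega>) = measure M (x -` cyl (Suc n) \<omega> \<inter> space M)"
      unfolding \<mu>_def using x_meas by (intro measure_distr) auto
    also have "\<dots> = (\<Prod>k\<in>{..n}. measure Q (F \<omega> k))"
      unfolding pre unfolding M_def by (rule measure_PiM_emb) auto
    also have "\<dots> = (\<Prod>k\<in>{..n}. w (prev \<omega> k) (\<omega> k))"
    proof (intro prod.cong refl)
      fix k
      have "prev \<omega> k \<le> N" using st by (auto simp: prev_def split: nat.split)
      then show "measure Q (F \<omega> k) = w (prev \<omega> k) (\<omega> k)" unfolding F_def by (rule prob_step)
    qed
    \<comment> \<open>The ratios of \<open>p\<close> telescope and leave the weight of the last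
      symbol.\<close>
    also have "\<dots> = (\<Prod>k<n. q (\<omega> k) (\<omega> (Suc k))) * p (\<omega> n)"
    proof (induction n)
      case 0 show ?case using st[of 0] by (simp add: prev_def w_def adm_def)
    next
      case (Suc n)
      have "w (\<omega> n) (\<omega> (Suc n)) = q (\<omega> n) (\<omega> (Suc n)) * p (\<omega> (Suc n)) / p (\<omega> n)"
        using st[of n] shift_space_edge[OF w\<Omega>, of n] by (simp add: w_def adm_def)
      moreover have "p (\<omega> n) \<noteq> 0" using p(1) st by (metis less_irrefl)
      ultimately show ?case using Suc by (simp add: prev_def)
    qed
    finally show ?thesis .
  qed
  ultimately have "markov q \<mu>" using q p unfolding markov_def by (auto simp: \<mu>_def)
  then show ?thesis by blast
qed

section \<open>Invariance of Markov measures\<close>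

lemma start_cover:
  assumes "finite_measure M" "sets M = sets \<B>" "B \<in> sets \<B>"
  shows "measure M B = (\<Sum>i\<in>states. measure M (start i \<inter> B))"
proof -
  interpret finite_measure M by fact
  note [simp] = assms(2)
  have "B \<subseteq> \<Omega>" using assms(3) sets.sets_into_space[of B \<B>] by simp
  then have "B = (\<Union>i\<in>states. start i \<inter> B)" using shift_space_states by (auto simp: start_def)
  then have "measure M B = measure M (\<Union>i\<in>states. start i \<inter> B)" by simp
  also have "\<dots> = (\<Sum>i\<in>states. measure M (start i \<inter> B))"
    using assms(3) by (intro finite_measure_finite_Union) (auto simp: disjoint_family_on_def mem_start)
  finally show ?thesis .
qed

lemma start_shift_sets: "B \<in> sets \<B> \<Longrightarrow> start i \<inter> (shift ^^ k) -` B \<in> sets \<B>"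
proof -
  assume "B \<in> sets \<B>"
  then have "start i \<inter> ((shift ^^ k) -` B \<inter> \<Omega>) \<in> sets \<B>" using preimage_shift_pow_sets by simp
  moreover have "start i \<inter> ((shift ^^ k) -` B \<inter> \<Omega>) = start i \<inter> (shift ^^ k) -` B" by (auto simp: start_def)
  ultimately show ?thesis by simp
qed

lemma start_cons:
  assumes "edge i (\<omega> 0)" "\<omega> \<in> \<Omega>"
  shows "start i \<inter> shift -` cyl (Suc n) \<omega> = cyl (Suc (Suc n)) (case_nat i \<omega>)"
proof (intro Set.set_eqI iffI)
  fix \<eta> assume *: "\<eta> \<in> start i \<inter> shift -` cyl (Suc n) \<omega>"
  show "\<eta> \<in> cyl (Suc (Suc n)) (case_nat i \<omega>)"
    unfolding mem_cyl
  proof (intro conjI allI impI)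
    fix k assume "k < Suc (Suc n)"
    with * show "\<eta> k = (case k of 0 \<Rightarrow> i | Suc x \<Rightarrow> \<omega> x)"
      by (cases k) (auto simp: mem_start mem_cyl shift_def)
  qed (use * in \<open>simp add: mem_start\<close>)
next
  fix \<eta> assume *: "\<eta> \<in> cyl (Suc (Suc n)) (case_nat i \<omega>)"
  then have "\<eta> \<in> \<Omega>" "\<And>k. k < Suc (Suc n) \<Longrightarrow> \<eta> k = (case k of 0 \<Rightarrow> i | Suc x \<Rightarrow> \<omega> x)"
    by (auto simp: mem_cyl)
  then have "\<eta> 0 = i" "shift \<eta> \<in> \<Omega>" "\<And>k. k < Suc n \<Longrightarrow> \<eta> (Suc k) = \<omega> k"
    using shift_in by auto
  then show "\<eta> \<in> start i \<inter> shift -` cyl (Suc n) \<omega>"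
    using \<open>\<eta> \<in> \<Omega>\<close> by (auto simp: mem_start mem_cyl shift_def)
qed

end

locale markov_measure = markov_shift +
  fixes q :: "nat \<Rightarrow> nat \<Rightarrow> real" and \<mu> :: "(nat \<Rightarrow> nat) measure"
  assumes markov: "markov q \<mu>"
begin

lemma q: "kernel q"
  using markov by (simp add: markov_def)

lemma sets_\<mu> [simp]: "sets \<mu> = sets \<B>"
  using markov by (simp add: markov_def)

lemma space_\<mu> [simp]: "space \<mu> = \<Omega>"
  using sets_eq_imp_space_eq[OF sets_\<mu>] by simp

sublocale prob_space \<mu>
  using markov by (simp add: markov_def)

definition stat :: "nat \<Rightarrow> real" where
  "stat = (SOME p. (\<forall>i\<in>states. 0 < p i) \<and> (\<Sum>i\<in>states. p i) = 1 \<and>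
     (\<forall>\<omega>\<in>\<Omega>. \<forall>n. measure \<mu> (cyl (Suc n) \<omega>) = (\<Prod>k<n. q (\<omega> k) (\<omega> (Suc k))) * p (\<omega> n)))"

lemma stat: "i \<in> states \<Longrightarrow> 0 < stat i" "(\<Sum>i\<in>states. stat i) = 1"
  and measure_cyl: "\<omega> \<in> \<Omega> \<Longrightarrow> measure \<mu> (cyl (Suc n) \<omega>) = (\<Prod>k<n. q (\<omega> k) (\<omega> (Suc k))) * stat (\<omega> n)"
proof -
  have "\<exists>p. (\<forall>i\<in>states. 0 < p i) \<and> (\<Sum>i\<in>states. p i) = 1 \<and>
     (\<forall>\<omega>\<in>\<Omega>. \<forall>n. measure \<mu> (cyl (Suc n) \<omega>) = (\<Prod>k<n. q (\<omega> k) (\<omega> (Suc k))) * p (\<omega> n))"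
    using markov by (simp add: markov_def)
  from someI_ex[OF this, folded stat_def]
  show "i \<in> states \<Longrightarrow> 0 < stat i" "(\<Sum>i\<in>states. stat i) = 1"
    "\<omega> \<in> \<Omega> \<Longrightarrow> measure \<mu> (cyl (Suc n) \<omega>) = (\<Prod>k<n. q (\<omega> k) (\<omega> (Suc k))) * stat (\<omega> n)"
    by auto
qed

lemma stat_le_1: "i \<in> states \<Longrightarrow> stat i \<le> 1"
  unfolding stat(2)[symmetric] using stat(1) by (intro member_le_sum) (auto intro: less_imp_le)

lemma prod_q_pos: "\<omega> \<in> \<Omega> \<Longrightarrow> 0 < (\<Prod>k<n. q (\<omega> k) (\<omega> (Suc k)))"
  by (intro prod_pos kernel_pos[OF q] shift_space_edge) auto

lemma measure_cyl_pos: "\<omega> \<in> \<Omega> \<Longrightarrow> 0 < measure \<mu> (cyl n \<omega>)"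
proof (cases n)
  case 0
  then show ?thesis using prob_space by simp
next
  case (Suc k)
  moreover assume "\<omega> \<in> \<Omega>"
  ultimately show ?thesis
    using measure_cyl prod_q_pos stat(1) shift_space_states by simp
qed

text \<open>Prefixing \<open>i\<close> adds one factor \<open>q i j\<close> to the product formula,
  so both sides agree on cylinders, and hence on Borel sets. Invariance, mixing and the
  transformation of images all rest on this identity.\<close>

lemma measure_branch:
  assumes "B \<in> sets \<B>"
  shows "measure \<mu> (start i \<inter> shift -` (start j \<inter> B)) = q i j * measure \<mu> (start j \<inter> B)"
proof (cases "edge i j")
  case False
  have "start i \<inter> shift -` (start j \<inter> B) = {}"
  proof (rule ccontr)
    assume "\<not> ?thesis"
    then obtain \<omega> where "\<omega> \<in> \<Omega>" "\<omega> 0 = i" "\<omega> (Suc 0) = j" by (auto simp: start_def shift_def)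
    with shift_space_edge[of \<omega> 0] False show False by simp
  qed
  with False show ?thesis by (simp add: kernel_0[OF q])
next
  case True
  define M1 where "M1 = distr (density \<mu> (indicator (start i))) \<B> shift"
  define M1' where "M1' = density M1 (indicator (start j))"
  define M2 where "M2 = density \<mu> (indicator (start j))"
  have m: "shift \<in> density \<mu> (indicator (start i)) \<rightarrow>\<^sub>M \<B>"
    using shift_measurable by (simp cong: measurable_cong_sets)
  have fin: "finite_measure M1" unfolding M1_def
    by (intro finite_measure.finite_measure_distr m finite_measure_restricted) simp
  have M1: "measure M1 X = measure \<mu> (start i \<inter> shift -` X)" if "X \<in> sets \<B>" for X
  proof -
    have "measure M1 X = measure (density \<mu> (indicator (start i))) (shift -` X \<inter> \<Omega>)"
      unfolding M1_def using measure_distr[OF m that] by simp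
    also have "\<dots> = measure \<mu> (start i \<inter> (shift -` X \<inter> \<Omega>))"
      using preimage_shift_sets[OF that] by (intro measure_restricted) auto
    also have "start i \<inter> (shift -` X \<inter> \<Omega>) = start i \<inter> shift -` X" by (auto simp: start_def)
    finally show ?thesis .
  qed
  have M1': "measure M1' X = measure \<mu> (start i \<inter> shift -` (start j \<inter> X))" if "X \<in> sets \<B>" for X
    unfolding M1'_def using that M1 by (subst measure_restricted) (auto simp: M1_def)
  have M2: "measure M2 X = measure \<mu> (start j \<inter> X)" if "X \<in> sets \<B>" for X
    unfolding M2_def using that by (intro measure_restricted) auto
  have "measure M1' B = q i j * measure M2 B"
  \<comment> \<open>From length 1 on, a cylinder is either contained in \<open>start j\<close> or
    disjoint from it.\<close>
  proof (rule cylinder_uniqueness[where n\<^sub>0 = 1])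
    show "finite_measure M1'" unfolding M1'_def
      by (intro finite_measure.finite_measure_restricted fin) (simp add: M1_def)
    show "finite_measure M2" unfolding M2_def by (intro finite_measure_restricted) simp
    show "0 < q i j" using kernel_pos[OF q True] .
    fix \<omega> and n :: nat assume w: "\<omega> \<in> \<Omega>" and "1 \<le> n"
    then obtain k where n: "n = Suc k" by (cases n) auto
    show "measure M1' (cyl n \<omega>) = q i j * measure M2 (cyl n \<omega>)"
    proof (cases "\<omega> 0 = j")
      case wj: True
      then have s: "start j \<inter> cyl n \<omega> = cyl n \<omega>" by (auto simp: start_def mem_cyl n)
      have e: "edge i (\<omega> 0)" using True wj by simp
      have "measure \<mu> (cyl (Suc (Suc k)) (case_nat i \<omega>)) = q i j * measure \<mu> (cyl (Suc k) \<omega>)"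
        unfolding measure_cyl[OF w] measure_cyl[OF cons_in_shift_space[OF e w]]
        by (simp add: prod.lessThan_Suc_shift wj del: prod.lessThan_Suc)
      then show ?thesis using M1'[of "cyl n \<omega>"] M2[of "cyl n \<omega>"] s n start_cons[OF e w, of k] by (simp del: vimage_Int)
    next
      case False
      then have s: "start j \<inter> cyl n \<omega> = {}" by (auto simp: start_def mem_cyl n)
      then show ?thesis using M1'[of "cyl n \<omega>"] M2[of "cyl n \<omega>"] by (simp del: vimage_Int)
    qed
  qed (auto simp: M1'_def M1_def M2_def assms)
  then show ?thesis using M1' M2 assms by simp
qed

text \<open>Summing \<open>measure_branch\<close> over the prefixed symbol \<open>i\<close> leaves
  the column sums of \<open>q\<close>, which are 1.\<close>

lemma measure_shift:
  assumes B: "B \<in> sets \<B>"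
  shows "measure \<mu> (shift -` B \<inter> \<Omega>) = measure \<mu> B"
proof -
  have "measure \<mu> (start i \<inter> (shift -` B \<inter> \<Omega>)) = (\<Sum>j\<in>states. q i j * measure \<mu> (start j \<inter> B))" for i
  proof -
    have "start i \<inter> (shift -` B \<inter> \<Omega>) = (\<Union>j\<in>states. start i \<inter> shift -` (start j \<inter> B))"
      using shift_space_states shift_in by (fastforce simp: start_def)
    moreover have "measure \<mu> (\<Union>j\<in>states. start i \<inter> shift -` (start j \<inter> B))
        = (\<Sum>j\<in>states. measure \<mu> (start i \<inter> shift -` (start j \<inter> B)))"
    proof (rule finite_measure_finite_Union)
      show "(\<lambda>j. start i \<inter> shift -` (start j \<inter> B)) ` states \<subseteq> events"
        using start_shift_sets[of "start _ \<inter> B" i 1] B by (auto simp del: vimage_Int)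
    qed (auto simp: disjoint_family_on_def mem_start)
    ultimately show ?thesis by (simp only: measure_branch[OF B])
  qed
  then have "measure \<mu> (shift -` B \<inter> \<Omega>) = (\<Sum>i\<in>states. \<Sum>j\<in>states. q i j * measure \<mu> (start j \<inter> B))"
    using start_cover[of \<mu>, OF _ _ preimage_shift_sets[OF B]] finite_measure_axioms by simp
  also have "\<dots> = (\<Sum>j\<in>states. (\<Sum>i\<in>states. q i j) * measure \<mu> (start j \<inter> B))"
    unfolding sum_distrib_right by (rule sum.swap)
  also have "\<dots> = (\<Sum>j\<in>states. measure \<mu> (start j \<inter> B))"
    using kernel_sum[OF q] by (intro sum.cong) auto
  also have "\<dots> = measure \<mu> B" using start_cover[of \<mu>, OF _ _ B] finite_measure_axioms by simp
  finally show ?thesis .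
qed

lemma measure_shift_pow: "B \<in> sets \<B> \<Longrightarrow> measure \<mu> ((shift ^^ k) -` B \<inter> \<Omega>) = measure \<mu> B"
proof (induction k)
  case 0
  then show ?case using sets.sets_into_space[of B \<B>] by (simp add: Int_absorb2)
next
  case (Suc k)
  have "(shift ^^ Suc k) -` B \<inter> \<Omega> = shift -` ((shift ^^ k) -` B \<inter> \<Omega>) \<inter> \<Omega>"
    using shift_in by (auto simp: shift_pow_Suc simp del: funpow.simps)
  then have "measure \<mu> ((shift ^^ Suc k) -` B \<inter> \<Omega>) = measure \<mu> ((shift ^^ k) -` B \<inter> \<Omega>)"
    by (simp only: measure_shift[OF preimage_shift_pow_sets[OF Suc.prems]])
  then show ?case using Suc by (simp only:)
qed

subsection \<open>Ergodicity\<close>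

lemma measure_start_shift_cover:
  assumes B: "B \<in> sets \<B>"
  shows "measure \<mu> (start i \<inter> (shift ^^ k) -` B) = (\<Sum>j\<in>states. measure \<mu> (start i \<inter> (shift ^^ k) -` (start j \<inter> B)))"
proof -
  have "start i \<inter> (shift ^^ k) -` B = (\<Union>j\<in>states. start i \<inter> (shift ^^ k) -` (start j \<inter> B))"
    using shift_pow_in shift_space_states by (fastforce simp: start_def)
  moreover have "measure \<mu> (\<Union>j\<in>states. start i \<inter> (shift ^^ k) -` (start j \<inter> B))
      = (\<Sum>j\<in>states. measure \<mu> (start i \<inter> (shift ^^ k) -` (start j \<inter> B)))"
  proof (rule finite_measure_finite_Union)
    show "(\<lambda>j. start i \<inter> (shift ^^ k) -` (start j \<inter> B)) ` states \<subseteq> events"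
      using start_shift_sets[of "start _ \<inter> B" i k] B by (auto simp del: vimage_Int)
  qed (auto simp: disjoint_family_on_def mem_start)
  ultimately show ?thesis by (simp only:)
qed

text \<open>The constant is the product of \<open>q\<close> along a path from \<open>i\<close> to
  \<open>j\<close>, by repeated use of \<open>measure_branch\<close>.\<close>

lemma path_lower_bound:
  assumes "(edge ^^ k) i j" "i \<in> states"
  shows "\<exists>c>0. \<forall>B\<in>sets \<B>. c * measure \<mu> (start j \<inter> B) \<le> measure \<mu> (start i \<inter> (shift ^^ k) -` (start j \<inter> B))"
  using assms
proof (induction k arbitrary: i)
  case 0
  then show ?case by (intro exI[of _ 1]) auto
next
  case (Suc k)
  then obtain i' where i': "edge i i'" "(edge ^^ k) i' j" by (metis relpowp_Suc_D2)
  then obtain c where c: "c > 0"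
    "\<And>B. B \<in> sets \<B> \<Longrightarrow> c * measure \<mu> (start j \<inter> B) \<le> measure \<mu> (start i' \<inter> (shift ^^ k) -` (start j \<inter> B))"
    using Suc.IH edge_states by blast
  note qp = kernel_pos[OF q i'(1)]
  show ?case
  proof (intro exI[of _ "q i i' * c"] conjI ballI)
    show "0 < q i i' * c" using qp c(1) by simp
    fix B assume B: "B \<in> sets \<B>"
    let ?X = "start i' \<inter> (shift ^^ k) -` (start j \<inter> B)"
    have X: "?X \<in> sets \<B>" using start_shift_sets[of "start j \<inter> B" i' k] B by simp
    have "q i i' * c * measure \<mu> (start j \<inter> B) \<le> q i i' * measure \<mu> ?X"
      using mult_left_mono[OF c(2)[OF B], of "q i i'"] qp by (simp add: mult.assoc)
    also have "\<dots> = measure \<mu> (start i \<inter> shift -` (start i' \<inter> ?X))"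
      using measure_branch[OF X, of i i'] by (simp del: vimage_Int)
    also have "\<dots> \<le> measure \<mu> (start i \<inter> (shift ^^ Suc k) -` (start j \<inter> B))"
    proof (rule finite_measure_mono)
      show "start i \<inter> shift -` (start i' \<inter> ?X) \<subseteq> start i \<inter> (shift ^^ Suc k) -` (start j \<inter> B)"
        by (auto simp: shift_pow_Suc simp del: funpow.simps)
      show "start i \<inter> (shift ^^ Suc k) -` (start j \<inter> B) \<in> events"
        using start_shift_sets[of "start j \<inter> B" i "Suc k"] B by simp
    qed
    finally show "q i i' * c * measure \<mu> (start j \<inter> B) \<le> measure \<mu> (start i \<inter> (shift ^^ Suc k) -` (start j \<inter> B))" .
  qed
qed

text \<open>Aperiodicity provides one path length for all pairs of states, so a single time works
  for all \<open>i\<close> and \<open>B\<close>.\<close>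

lemma start_mixing:
  "\<exists>m. \<exists>c>0. \<forall>i\<in>states. \<forall>B\<in>sets \<B>. c * measure \<mu> B \<le> measure \<mu> (start i \<inter> (shift ^^ m) -` B)"
proof -
  obtain m where m: "1 \<le> m" "\<And>i j. i \<in> states \<Longrightarrow> j \<in> states \<Longrightarrow> (edge ^^ m) i j"
    using primitive by blast
  have "\<forall>p\<in>states \<times> states. \<exists>c>0. \<forall>B\<in>sets \<B>. c * measure \<mu> (start (snd p) \<inter> B)
      \<le> measure \<mu> (start (fst p) \<inter> (shift ^^ m) -` (start (snd p) \<inter> B))"
    using path_lower_bound m by auto
  then obtain c where c: "\<forall>p\<in>states \<times> states. c p > 0 \<and> (\<forall>B\<in>sets \<B>. c p * measure \<mu> (start (snd p) \<inter> B)
      \<le> measure \<mu> (start (fst p) \<inter> (shift ^^ m) -` (start (snd p) \<inter> B)))"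
    unfolding bchoice_iff by blast
  define c0 where "c0 = Min (c ` (states \<times> states))"
  have fin: "finite (c ` (states \<times> states))" "c ` (states \<times> states) \<noteq> {}" using states_nonempty by auto
  have "0 < c0" unfolding c0_def using fin c by (subst Min_gr_iff) auto
  moreover have "c0 * measure \<mu> B \<le> measure \<mu> (start i \<inter> (shift ^^ m) -` B)"
    if i: "i \<in> states" and B: "B \<in> sets \<B>" for i B
  proof -
    have "c0 * measure \<mu> B = (\<Sum>j\<in>states. c0 * measure \<mu> (start j \<inter> B))"
      using start_cover[of \<mu>, OF _ _ B] finite_measure_axioms by (simp add: sum_distrib_left)
    also have "\<dots> \<le> (\<Sum>j\<in>states. measure \<mu> (start i \<inter> (shift ^^ m) -` (start j \<inter> B)))"
    proof (rule sum_mono)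
      fix j assume j: "j \<in> states"
      have "c0 \<le> c (i, j)" unfolding c0_def using fin i j by (intro Min_le) auto
      then have "c0 * measure \<mu> (start j \<inter> B) \<le> c (i, j) * measure \<mu> (start j \<inter> B)"
        by (intro mult_right_mono) auto
      also have "\<dots> \<le> measure \<mu> (start i \<inter> (shift ^^ m) -` (start j \<inter> B))"
        using bspec[OF c, of "(i, j)"] i j B by (simp del: vimage_Int)
      finally show "c0 * measure \<mu> (start j \<inter> B) \<le> measure \<mu> (start i \<inter> (shift ^^ m) -` (start j \<inter> B))" .
    qed
    also have "\<dots> = measure \<mu> (start i \<inter> (shift ^^ m) -` B)"
      by (rule measure_start_shift_cover[OF B, symmetric])
    finally show ?thesis .
  qed
  ultimately show ?thesis by blast
qed

text \<open>The Markov property read backwards: given the symbol at \<open>n\<close>, the prefix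
  contributes the same factor whatever happens after \<open>n\<close>.\<close>

lemma measure_cyl_shift:
  assumes B: "B \<in> sets \<B>" and "\<omega> \<in> \<Omega>"
  shows "measure \<mu> (cyl (Suc n) \<omega> \<inter> (shift ^^ n) -` (start (\<omega> n) \<inter> B))
    = (\<Prod>k<n. q (\<omega> k) (\<omega> (Suc k))) * measure \<mu> (start (\<omega> n) \<inter> B)"
  using assms(2)
proof (induction n arbitrary: \<omega>)
  case 0
  then have "cyl (Suc 0) \<omega> \<inter> (start (\<omega> 0) \<inter> B) = start (\<omega> 0) \<inter> B"
    by (auto simp: mem_cyl start_def)
  then show ?case by simp
next
  case (Suc n)
  let ?X = "cyl (Suc n) (shift \<omega>) \<inter> (shift ^^ n) -` (start (\<omega> (Suc n)) \<inter> B)"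
  have sh: "shift \<omega> k = \<omega> (Suc k)" for k by (simp add: shift_def)
  have e: "edge (\<omega> 0) (shift \<omega> 0)" using shift_space_edge[OF Suc.prems, of 0] by (simp add: shift_def)
  have sX: "start (\<omega> 1) \<inter> ?X = ?X" by (auto simp: mem_start mem_cyl shift_def)
  have "?X = cyl (Suc n) (shift \<omega>) \<inter> ((shift ^^ n) -` (start (\<omega> (Suc n)) \<inter> B) \<inter> \<Omega>)"
    by (auto simp: mem_cyl)
  then have X: "?X \<in> sets \<B>"
    using preimage_shift_pow_sets[of "start (\<omega> (Suc n)) \<inter> B" n] B by (metis cyl_measurable sets.Int start_measurable)
  have "cyl (Suc (Suc n)) \<omega> = start (\<omega> 0) \<inter> shift -` cyl (Suc n) (shift \<omega>)"
    using start_cons[OF e shift_in[OF Suc.prems], of n] by (simp add: cons_shift)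
  then have eq: "cyl (Suc (Suc n)) \<omega> \<inter> (shift ^^ Suc n) -` (start (\<omega> (Suc n)) \<inter> B) = start (\<omega> 0) \<inter> shift -` ?X"
    by (auto simp: shift_pow_Suc simp del: funpow.simps)
  have "measure \<mu> (cyl (Suc (Suc n)) \<omega> \<inter> (shift ^^ Suc n) -` (start (\<omega> (Suc n)) \<inter> B))
      = q (\<omega> 0) (\<omega> 1) * measure \<mu> ?X"
    unfolding eq using measure_branch[OF X, of "\<omega> 0" "\<omega> 1"] unfolding sX .
  also have "measure \<mu> ?X = (\<Prod>k<n. q (shift \<omega> k) (shift \<omega> (Suc k))) * measure \<mu> (start (shift \<omega> n) \<inter> B)"
    using Suc.IH[OF shift_in[OF Suc.prems]] by (simp only: sh[of n])
  finally show ?case by (simp add: sh prod.lessThan_Suc_shift del: prod.lessThan_Suc funpow.simps)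
qed

text \<open>The constant depends neither on the cylinder nor on its length; this uniformity is what
  ergodicity needs. The time \<open>k\<close> is \<open>m + n\<close>: \<open>n\<close> steps to
  reach the last symbol of the cylinder and \<open>m\<close> more to mix from it.\<close>

lemma cyl_mixing:
  "\<exists>c>0. \<forall>n. \<forall>\<omega>\<in>\<Omega>. \<exists>k. \<forall>B\<in>sets \<B>. c * measure \<mu> (cyl (Suc n) \<omega>) * measure \<mu> B \<le> measure \<mu> (cyl (Suc n) \<omega> \<inter> (shift ^^ k) -` B)"
proof -
  obtain m c where c: "c > 0" "\<forall>i\<in>states. \<forall>B\<in>sets \<B>. c * measure \<mu> B \<le> measure \<mu> (start i \<inter> (shift ^^ m) -` B)"
    using start_mixing by blast
  show ?thesis
  proof (intro exI[of _ c] conjI c(1) allI ballI)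
    fix n \<omega> assume w: "\<omega> \<in> \<Omega>"
    let ?p = "\<Prod>k<n. q (\<omega> k) (\<omega> (Suc k))"
    have "c * measure \<mu> (cyl (Suc n) \<omega>) * measure \<mu> B \<le> measure \<mu> (cyl (Suc n) \<omega> \<inter> (shift ^^ (m + n)) -` B)"
      if B: "B \<in> sets \<B>" for B
    proof -
      let ?X = "start (\<omega> n) \<inter> (shift ^^ m) -` B"
      have X: "?X \<in> sets \<B>" using start_shift_sets[OF B] .
      have "stat (\<omega> n) \<le> 1" using stat_le_1 shift_space_states[OF w] by blast
      then have "measure \<mu> (cyl (Suc n) \<omega>) \<le> ?p"
        unfolding measure_cyl[OF w] using prod_q_pos[OF w, of n] by (simp add: mult_left_le)
      then have "c * measure \<mu> (cyl (Suc n) \<omega>) * measure \<mu> B \<le> c * ?p * measure \<mu> B"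
        using c(1) by (intro mult_right_mono mult_left_mono) auto
      also have "\<dots> = ?p * (c * measure \<mu> B)" by simp
      also have "\<dots> \<le> ?p * measure \<mu> ?X"
        using c(2) shift_space_states[OF w] B prod_q_pos[OF w, of n] by (intro mult_left_mono) (blast, simp)
      also have "\<dots> = measure \<mu> (cyl (Suc n) \<omega> \<inter> (shift ^^ n) -` (start (\<omega> n) \<inter> ?X))"
        using measure_cyl_shift[OF X w, of n] by (simp del: vimage_Int)
      also have "cyl (Suc n) \<omega> \<inter> (shift ^^ n) -` (start (\<omega> n) \<inter> ?X) = cyl (Suc n) \<omega> \<inter> (shift ^^ (m + n)) -` B"
        using shift_pow_in by (auto simp: mem_cyl start_def funpow_add shift_pow)
      finally show ?thesis .
    qed
    then show "\<exists>k. \<forall>B\<in>sets \<B>. c * measure \<mu> (cyl (Suc n) \<omega>) * measure \<mu> B \<le> measure \<mu> (cyl (Suc n) \<omega> \<inter> (shift ^^ k) -` B)"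
      by blast
  qed
qed

lemma almost_invariant_pow:
  assumes E: "E \<in> sets \<B>" and inv: "measure \<mu> (sym_diff E (shift -` E \<inter> \<Omega>)) = 0"
  shows "measure \<mu> (sym_diff E ((shift ^^ k) -` E \<inter> \<Omega>)) = 0"
proof (induction k)
  case 0
  have "E \<inter> \<Omega> = E" using sets.sets_into_space[OF E] by auto
  then show ?case by simp
next
  case (Suc k)
  let ?Ek = "(shift ^^ k) -` E \<inter> \<Omega>"
  let ?D = "sym_diff E (shift -` E \<inter> \<Omega>)" and ?Dk = "shift -` (sym_diff E ?Ek) \<inter> \<Omega>"
  have Ek: "?Ek \<in> sets \<B>" "shift -` E \<inter> \<Omega> \<in> sets \<B>"
    using preimage_shift_pow_sets[OF E] preimage_shift_sets[OF E] by auto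
  have s: "?D \<in> sets \<B>" "sym_diff E ?Ek \<in> sets \<B>" using E Ek by auto
  have sub: "sym_diff E ((shift ^^ Suc k) -` E \<inter> \<Omega>) \<subseteq> ?D \<union> ?Dk"
    using shift_in by (auto simp: shift_pow_Suc simp del: funpow.simps)
  have "measure \<mu> (sym_diff E ((shift ^^ Suc k) -` E \<inter> \<Omega>)) \<le> measure \<mu> (?D \<union> ?Dk)"
    using s preimage_shift_sets[OF s(2)] by (intro finite_measure_mono[OF sub]) auto
  also have "\<dots> \<le> measure \<mu> ?D + measure \<mu> ?Dk"
    using s preimage_shift_sets[OF s(2)] by (intro measure_Un_le) auto
  also have "\<dots> = 0" using inv Suc measure_shift[OF s(2)] by simp
  finally show ?case using measure_nonneg[of \<mu>] by (meson order_antisym)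
qed

text \<open>Up to null sets \<open>E\<close> equals all its preimages under
  \<open>shift ^^ k\<close>, so mixing bounds the measure of \<open>E \<inter> C\<close> from below
  by \<open>c\<close> times the product of the measures of \<open>E\<close> and \<open>C\<close>,
  for every cylinder \<open>C\<close> of positive length. Unless \<open>E\<close> is null,
  domination extends this from \<open>C\<close> to the complement of \<open>E\<close>, which does
  not meet \<open>E\<close> and therefore is null.\<close>

lemma ergodic:
  assumes E: "E \<in> sets \<B>" and inv: "measure \<mu> (sym_diff E (shift -` E \<inter> \<Omega>)) = 0"
  shows "measure \<mu> E = 0 \<or> measure \<mu> E = 1"
proof (rule ccontr)
  assume contra: "\<not> ?thesis"
  obtain c where c: "c > 0" "\<And>n \<omega>. \<omega> \<in> \<Omega> \<Longrightarrow> \<exists>k. \<forall>B\<in>sets \<B>.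
      c * measure \<mu> (cyl (Suc n) \<omega>) * measure \<mu> B \<le> measure \<mu> (cyl (Suc n) \<omega> \<inter> (shift ^^ k) -` B)"
    using cyl_mixing by blast
  have cE: "0 < c * measure \<mu> E" using c(1) contra measure_nonneg[of \<mu> E] by (metis mult_pos_pos order_le_less)
  define M where "M = density \<mu> (indicator E)"
  have M: "measure M B = measure \<mu> (E \<inter> B)" if "B \<in> sets \<B>" for B
    unfolding M_def using E that by (intro measure_restricted) auto
  have E\<Omega>: "E \<subseteq> \<Omega>" using sets.sets_into_space[OF E] by simp
  have cyl: "c * measure \<mu> E * measure \<mu> (cyl n \<omega>) \<le> measure M (cyl n \<omega>)" if w: "\<omega> \<in> \<Omega>" and "1 \<le> n" for \<omega> n
  proof -
    obtain n' where n: "n = Suc n'" using \<open>1 \<le> n\<close> by (cases n) auto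
    obtain k where k: "c * measure \<mu> (cyl n \<omega>) * measure \<mu> E \<le> measure \<mu> (cyl n \<omega> \<inter> (shift ^^ k) -` E)"
      using c(2)[OF w, of n'] E n by blast
    let ?Ek = "(shift ^^ k) -` E \<inter> \<Omega>"
    have Ek: "?Ek \<in> sets \<B>" using preimage_shift_pow_sets[OF E] .
    have "measure \<mu> (cyl n \<omega> \<inter> (shift ^^ k) -` E) \<le> measure \<mu> ((E \<inter> cyl n \<omega>) \<union> sym_diff E ?Ek)"
      using E Ek by (intro finite_measure_mono) (auto simp: mem_cyl)
    also have "\<dots> \<le> measure \<mu> (E \<inter> cyl n \<omega>) + measure \<mu> (sym_diff E ?Ek)"
      using E Ek by (intro measure_Un_le) auto
    also have "\<dots> = measure M (cyl n \<omega>)" using almost_invariant_pow[OF E inv] M[of "cyl n \<omega>"] by simp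
    finally show ?thesis using k by (simp add: mult.commute mult.left_commute)
  qed
  have "measure \<mu> (\<Omega> - E) \<le> inverse (c * measure \<mu> E) * measure M (\<Omega> - E)"
  proof (rule cylinder_domination[where n\<^sub>0 = 1])
    show "finite_measure M" unfolding M_def using E by (intro finite_measure_restricted) simp
    show "\<Omega> - E \<in> sets \<B>" using sets.compl_sets[OF E] by simp
    show "0 \<le> inverse (c * measure \<mu> E)" using cE by (metis inverse_positive_iff_positive less_imp_le)
    fix \<omega> and n :: nat assume "\<omega> \<in> \<Omega>" "1 \<le> n"
    from cyl[OF this] have "measure \<mu> (cyl n \<omega>) \<le> measure M (cyl n \<omega>) / (c * measure \<mu> E)"
      using cE by (subst pos_le_divide_eq) (simp_all only: mult.commute)
    then show "measure \<mu> (cyl n \<omega>) \<le> inverse (c * measure \<mu> E) * measure M (cyl n \<omega>)"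
      by (simp only: divide_inverse mult.commute)
  qed (simp_all add: M_def finite_measure_axioms)
  also have "measure M (\<Omega> - E) = 0" using M[of "\<Omega> - E"] sets.compl_sets[OF E] by simp
  finally have "measure \<mu> (\<Omega> - E) = 0" using measure_nonneg[of \<mu> "\<Omega> - E"] by simp
  then have "measure \<mu> E = 1" using prob_compl[of E] E by simp
  with contra show False by simp
qed

subsection \<open>Uniqueness of the Gibbs measure\<close>

text \<open>For \<open>E = {d\<nu>/d\<mu> > 1}\<close>, invariance of both measures makes \<open>E\<close> invariant modulo null sets.\<close>

lemma invariant_dominated_unique:
  assumes \<nu>: "prob_space \<nu>" "sets \<nu> = sets \<B>"
    and inv: "\<And>B. B \<in> sets \<B> \<Longrightarrow> measure \<nu> (shift -` B \<inter> \<Omega>) = measure \<nu> B"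
    and dom: "\<And>B. B \<in> sets \<B> \<Longrightarrow> measure \<nu> B \<le> c * measure \<mu> B"
  shows "\<nu> = \<mu>"
proof -
  interpret \<nu>: prob_space \<nu> by fact
  note [simp] = \<nu>(2)
  have sp\<nu>: "space \<nu> = \<Omega>" using sets_eq_imp_space_eq[OF \<nu>(2)] by simp
  have "absolutely_continuous \<mu> \<nu>"
    unfolding absolutely_continuous_def
  proof
    fix B assume B: "B \<in> null_sets \<mu>"
    then have "B \<in> sets \<B>" "measure \<mu> B = 0" by (auto simp: null_sets_def measure_def)
    then have "measure \<nu> B \<le> 0" using dom[of B] by simp
    then have "measure \<nu> B = 0" using measure_nonneg[of \<nu> B] by linarith
    then show "B \<in> null_sets \<nu>" using \<open>B \<in> sets \<B>\<close> by (auto simp: null_sets_def \<nu>.emeasure_eq_measure)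
  qed
  then have "\<exists>f\<in>borel_measurable \<mu>. density \<mu> f = \<nu>" by (rule Radon_Nikodym) simp
  then obtain f where f: "f \<in> borel_measurable \<mu>" "density \<mu> f = \<nu>" by (rule bexE)
  have em: "emeasure \<nu> B = (\<integral>\<^sup>+ x. f x * indicator B x \<partial>\<mu>)" if "B \<in> sets \<B>" for B
    unfolding f(2)[symmetric] using f(1) that by (intro emeasure_density) auto
  define E where "E = {x \<in> \<Omega>. 1 < f x}"
  have E: "E \<in> sets \<B>" using borel_measurable_less[OF measurable_const f(1), of 1] by (simp add: E_def)
  have above: "measure \<mu> D \<le> measure \<nu> D \<and> (measure \<nu> D \<le> measure \<mu> D \<longrightarrow> measure \<mu> D = 0)"
    if D: "D \<in> sets \<B>" "D \<subseteq> E" for D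
  proof -
    have [measurable]: "D \<in> sets \<mu>" "f \<in> borel_measurable \<mu>" using D f by auto
    have ind: "emeasure \<mu> D = (\<integral>\<^sup>+ x. indicator D x \<partial>\<mu>)" using D by simp
    have "emeasure \<mu> D \<le> emeasure \<nu> D" unfolding ind em[OF D(1)]
      using D by (intro nn_integral_mono) (auto simp: indicator_def E_def subset_iff intro: less_imp_le)
    moreover have "measure \<mu> D = 0" if le: "measure \<nu> D \<le> measure \<mu> D"
    proof -
      have "(\<integral>\<^sup>+ x. f x * indicator D x - indicator D x \<partial>\<mu>)
          = (\<integral>\<^sup>+ x. f x * indicator D x \<partial>\<mu>) - (\<integral>\<^sup>+ x. indicator D x \<partial>\<mu>)"
      proof (rule nn_integral_diff)
        show "(\<integral>\<^sup>+ x. indicator D x \<partial>\<mu>) \<noteq> \<infinity>" unfolding ind[symmetric] by (simp add: emeasure_eq_measure)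
        show "AE x in \<mu>. indicator D x \<le> f x * indicator D x"
          using D by (intro AE_I2) (auto simp: indicator_def E_def subset_iff intro: less_imp_le)
      qed measurable
      also have "\<dots> = 0"
        using le unfolding ind[symmetric] em[OF D(1), symmetric]
        by (simp add: emeasure_eq_measure \<nu>.emeasure_eq_measure ennreal_minus ennreal_neg)
      finally have "AE x in \<mu>. f x * indicator D x - indicator D x = 0"
        by (subst (asm) nn_integral_0_iff_AE) measurable
      then have "AE x in \<mu>. x \<notin> D"
      proof (eventually_elim)
        fix x assume z: "f x * indicator D x - indicator D x = 0"
        show "x \<notin> D"
        proof
          assume "x \<in> D"
          then have "1 < f x" "f x - 1 = 0" using D z by (auto simp: E_def)
          then show False by (metis ennreal_minus_eq_0 leD)
        qed
      qed
      then have "D \<in> null_sets \<mu>" using D by (subst AE_iff_null_sets) auto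
      then show ?thesis by (simp add: null_sets_def measure_def)
    qed
    ultimately show ?thesis by (simp add: emeasure_eq_measure \<nu>.emeasure_eq_measure)
  qed
  have below: "measure \<nu> D \<le> measure \<mu> D" if D: "D \<in> sets \<B>" "D \<inter> E = {}" for D
  proof -
    have "D \<subseteq> \<Omega>" using sets.sets_into_space[OF D(1)] by simp
    then have "f x * indicator D x \<le> indicator D x" for x
      using D(2) by (auto simp: indicator_def E_def not_less)
    then have "emeasure \<nu> D \<le> (\<integral>\<^sup>+ x. indicator D x \<partial>\<mu>)" unfolding em[OF D(1)]
      by (intro nn_integral_mono)
    then show ?thesis using D by (simp add: emeasure_eq_measure \<nu>.emeasure_eq_measure)
  qed
  let ?E' = "shift -` E \<inter> \<Omega>"
  have E': "?E' \<in> sets \<B>" using preimage_shift_sets[OF E] .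
  have swap: "measure M (E - ?E') = measure M (?E' - E)"
    if M: "finite_measure M" "sets M = sets \<B>" "measure M ?E' = measure M E" for M
  proof -
    interpret M: finite_measure M by fact
    note [simp] = M(2)
    have "measure M (E - ?E') = measure M E - measure M (E \<inter> ?E')"
      using E E' by (subst M.finite_measure_Diff'[symmetric]) auto
    moreover have "measure M (?E' - E) = measure M ?E' - measure M (?E' \<inter> E)"
      using E E' by (subst M.finite_measure_Diff'[symmetric]) auto
    ultimately show ?thesis using M(3) by (simp add: Int_commute)
  qed
  have s\<mu>: "measure \<mu> (E - ?E') = measure \<mu> (?E' - E)"
    by (intro swap finite_measure_axioms measure_shift[OF E]) simp
  have s\<nu>: "measure \<nu> (E - ?E') = measure \<nu> (?E' - E)"
    by (intro swap \<nu>.finite_measure_axioms inv[OF E]) simp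
  \<comment> \<open>\<open>?E' - E\<close> lies outside \<open>E\<close> and \<open>E - ?E'\<close>
    inside, where the two measures compare in opposite ways. As invariance gives both differences
    the same mass, in either measure, \<open>E - ?E'\<close> must be null.\<close>
  have "measure \<nu> (?E' - E) \<le> measure \<mu> (?E' - E)" using E E' by (intro below) auto
  then have "measure \<nu> (E - ?E') \<le> measure \<mu> (E - ?E')" unfolding s\<mu> s\<nu> .
  then have 1: "measure \<mu> (E - ?E') = 0" using above[of "E - ?E'"] E E' by auto
  have "measure \<mu> (sym_diff E ?E') \<le> measure \<mu> (E - ?E') + measure \<mu> (?E' - E)"
    using E E' by (intro measure_Un_le) auto
  with 1 s\<mu> have "measure \<mu> (sym_diff E ?E') = 0" using measure_nonneg[of \<mu> "sym_diff E ?E'"] by linarith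
  then have "measure \<mu> E = 0 \<or> measure \<mu> E = 1" by (rule ergodic[OF E])
  \<comment> \<open>If \<open>E\<close> had measure 1, then \<nu> could not exceed \<mu> on it,
    which would force \<open>E\<close> to be null.\<close>
  then have \<mu>E: "measure \<mu> E = 0" using above[OF E order.refl] \<nu>.prob_le_1[of E] by auto
  have \<nu>E: "measure \<nu> E = 0" using dom[OF E] \<mu>E measure_nonneg[of \<nu> E] by simp
  have le: "measure \<nu> B \<le> measure \<mu> B" if B: "B \<in> sets \<B>" for B
  proof -
    have "measure \<nu> B \<le> measure \<nu> ((B - E) \<union> E)" using B E by (intro \<nu>.finite_measure_mono) auto
    also have "\<dots> \<le> measure \<nu> (B - E) + measure \<nu> E" using B E by (intro measure_Un_le) auto
    also have "\<dots> \<le> measure \<mu> (B - E)" using below[of "B - E"] B E \<nu>E by auto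
    also have "\<dots> \<le> measure \<mu> B" using B by (intro finite_measure_mono) auto
    finally show ?thesis .
  qed
  show ?thesis
  proof (rule measure_eqI)
    fix B assume "B \<in> sets \<nu>"
    then have B: "B \<in> sets \<B>" by simp
    have "measure \<nu> (\<Omega> - B) \<le> measure \<mu> (\<Omega> - B)" using le sets.compl_sets[OF B] by simp
    then have "measure \<mu> B \<le> measure \<nu> B" using prob_compl[of B] \<nu>.prob_compl[of B] B by (simp add: sp\<nu>)
    with le[OF B] show "emeasure \<nu> B = emeasure \<mu> B"
      by (simp add: emeasure_eq_measure \<nu>.emeasure_eq_measure)
  qed simp
qed

end

section \<open>Identification of the Gibbs measure\<close>

lemma finite_positive_bounds:
  fixes F :: "real set"
  assumes "finite F" "\<And>x. x \<in> F \<Longrightarrow> 0 < x"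
  shows "\<exists>C>0. \<forall>x\<in>F. inverse C \<le> x \<and> x \<le> C"
proof -
  define G where "G = insert 1 (F \<union> inverse ` F)"
  have G: "finite G" using assms by (simp add: G_def)
  have le: "y \<le> Max G" if "y \<in> G" for y using Max_ge[OF G that] .
  have C: "0 < Max G" using le[of 1] by (simp add: G_def)
  show ?thesis
  proof (intro exI[of _ "Max G"] conjI ballI C)
    fix x assume x: "x \<in> F"
    show "x \<le> Max G" using x by (intro le) (simp add: G_def)
    have "inverse x \<le> Max G" using x by (intro le) (simp add: G_def)
    then have "inverse (Max G) \<le> inverse (inverse x)" using assms(2)[OF x] by (intro le_imp_inverse_le) auto
    then show "inverse (Max G) \<le> x" by simp
  qed
qed

context markov_measure
begin

text \<open>Along an orbit the eigenvector factors telescope, so the exponential of the Birkhoff sum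
  of \<open>f\<close> is \<open>l ^ n\<close> times the product of \<open>q\<close>, up to the
  weights of the first and the last symbol. The pressure is \<open>ln l\<close>.\<close>

lemma gibbs:
  assumes f: "f \<in> locally_constant N A 2" and k: "kernel_of f q"
  shows "is_gibbs N A f \<mu>"
proof -
  obtain u l where u: "0 < l" "\<forall>i\<in>states. 0 < u i"
    "\<And>i j. edge i j \<Longrightarrow> exp (potential f i j) * u i = l * u j * q i j"
    using k unfolding kernel_of_def by blast
  \<comment> \<open>The possible values of the Gibbs ratio, with \<open>i\<close>, \<open>j\<close>,
    \<open>a\<close> standing for the symbols at \<open>n - 1\<close>, \<open>n\<close> and
    \<open>0\<close>. The symbol at \<open>n\<close> enters although the cylinder ends at
    \<open>n - 1\<close>, because the last summand of the Birkhoff sum reads it.\<close>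
  define F where "F = (\<lambda>(i, j, a). stat i * u a / (u j * q i j)) ` {(i, j, a). edge i j \<and> a \<in> states}"
  have "finite {(i, j, a). edge i j \<and> a \<in> states}"
    by (rule finite_subset[of _ "states \<times> states \<times> states"]) (auto simp: edge_def)
  then have "finite F" by (simp add: F_def)
  moreover have "0 < x" if "x \<in> F" for x
    using that u(2) stat(1) edge_states kernel_pos[OF q] by (auto simp: F_def intro!: divide_pos_pos mult_pos_pos)
  ultimately obtain C where C: "0 < C" "\<And>x. x \<in> F \<Longrightarrow> inverse C \<le> x \<and> x \<le> C"
    using finite_positive_bounds by metis
  have birkhoff: "exp (\<Sum>k<n. f ((shift ^^ k) \<omega>)) = l ^ n * (u (\<omega> n) / u (\<omega> 0)) * (\<Prod>k<n. q (\<omega> k) (\<omega> (Suc k)))"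
    if w: "\<omega> \<in> \<Omega>" for \<omega> n
  proof (induction n)
    case 0
    have "0 < u (\<omega> 0)" using u(2) shift_space_states[OF w] by blast
    then show ?case by simp
  next
    case (Suc n)
    have pos: "0 < u (\<omega> 0)" "0 < u (\<omega> n)" using u(2) shift_space_states[OF w] by blast+
    have "f ((shift ^^ n) \<omega>) = potential f (\<omega> n) (\<omega> (Suc n))"
      using potential_eq[OF f shift_pow_in[OF w, of n]] by (simp add: shift_pow)
    then have "exp (f ((shift ^^ n) \<omega>)) = l * u (\<omega> (Suc n)) * q (\<omega> n) (\<omega> (Suc n)) / u (\<omega> n)"
      using u(3)[OF shift_space_edge[OF w, of n]] pos by (simp add: field_simps)
    then show ?case using Suc pos by (simp add: exp_add)
  qed
  have ratio: "measure \<mu> (cyl n \<omega>) / exp (- real n * ln l + (\<Sum>k<n. f ((shift ^^ k) \<omega>))) \<in> F"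
    if w: "\<omega> \<in> \<Omega>" and "1 \<le> n" for \<omega> n
  proof -
    obtain n' where n: "n = Suc n'" using \<open>1 \<le> n\<close> by (cases n) auto
    let ?p = "\<Prod>k<n'. q (\<omega> k) (\<omega> (Suc k))"
    have pos: "0 < u (\<omega> 0)" "0 < u (\<omega> n)" "0 < q (\<omega> n') (\<omega> n)" "0 < ?p"
      using u(2) shift_space_states[OF w] kernel_pos[OF q shift_space_edge[OF w, of n']] prod_q_pos[OF w] n
      by blast+
    have "exp (- real n * ln l) = inverse (l ^ n)"
      using u(1) by (simp add: exp_minus exp_of_nat_mult)
    moreover have "inverse (l ^ n) * l ^ n = 1" using u(1) by simp
    moreover have "(\<Prod>k<n. q (\<omega> k) (\<omega> (Suc k))) = ?p * q (\<omega> n') (\<omega> n)" by (simp add: n)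
    ultimately have "exp (- real n * ln l + (\<Sum>k<n. f ((shift ^^ k) \<omega>)))
        = u (\<omega> n) / u (\<omega> 0) * (?p * q (\<omega> n') (\<omega> n))"
      by (simp only: exp_add birkhoff[OF w] mult.assoc[symmetric] mult_1_left)
    then have "measure \<mu> (cyl n \<omega>) / exp (- real n * ln l + (\<Sum>k<n. f ((shift ^^ k) \<omega>)))
        = stat (\<omega> n') * u (\<omega> 0) / (u (\<omega> n) * q (\<omega> n') (\<omega> n))"
      using pos measure_cyl[OF w, of n'] n kernel_pos[OF q shift_space_edge[OF w]]
      by (simp add: less_imp_neq[symmetric])
    moreover have "\<dots> \<in> F" unfolding F_def
      using shift_space_edge[OF w, of n'] shift_space_states[OF w, of 0] n
      by (intro image_eqI[of _ _ "(\<omega> n', \<omega> n, \<omega> 0)"]) auto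
    ultimately show ?thesis by simp
  qed
  have "continuous_map (shift_topology N A) euclideanreal f"
    unfolding continuous_map_def
  proof (intro conjI allI impI)
    fix U :: "real set"
    have "f \<eta> = f \<omega>" if "\<omega> \<in> \<Omega>" "\<eta> \<in> cyl 2 \<omega>" for \<omega> \<eta>
      using f that unfolding locally_constant_def mem_cyl by blast
    then have "f \<eta> \<in> U" if "\<omega> \<in> \<Omega>" "f \<omega> \<in> U" "\<eta> \<in> cyl 2 \<omega>" for \<omega> \<eta>
      using that by simp
    then have "cyl 2 \<omega> \<subseteq> {x \<in> \<Omega>. f x \<in> U}" if "\<omega> \<in> \<Omega>" "f \<omega> \<in> U" for \<omega>
      using that cyl_subset by blast
    then show "openin (shift_topology N A) {x \<in> topspace (shift_topology N A). f x \<in> U}"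
      unfolding openin_shift_iff topspace_shift by blast
  qed auto
  moreover have "emeasure \<mu> (shift -` B \<inter> space \<mu>) = emeasure \<mu> B" if "B \<in> sets \<mu>" for B
    using measure_shift[of B] that by (simp add: emeasure_eq_measure)
  moreover have "\<exists>C P. C > 0 \<and> (\<forall>\<omega>\<in>\<Omega>. \<forall>n\<ge>1.
      inverse C \<le> measure \<mu> (cyl n \<omega>) / exp (- real n * P + (\<Sum>k<n. f ((shift ^^ k) \<omega>))) \<and>
      measure \<mu> (cyl n \<omega>) / exp (- real n * P + (\<Sum>k<n. f ((shift ^^ k) \<omega>))) \<le> C)"
    using C ratio by blast
  ultimately show ?thesis
    unfolding is_gibbs_def using prob_space_axioms sets_\<mu> space_\<mu> by blast
qed

text \<open>Comparing two Gibbs bounds on cylinders of length \<open>n\<close> leaves the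
  exponential of \<open>n\<close> times the difference of the pressures. A larger pressure
  \<open>P'\<close> of \<mu> would make \<mu> at most half of \<nu> on long cylinders and so on the
  whole space; hence \<nu> is dominated by a multiple of \<mu>, and ergodicity applies.\<close>

lemma gibbs_unique:
  assumes f: "f \<in> locally_constant N A 2" and k: "kernel_of f q" and \<nu>: "is_gibbs N A f \<nu>"
  shows "\<nu> = \<mu>"
proof -
  define S where "S n \<omega> = (\<Sum>k<n. f ((shift ^^ k) \<omega>))" for n \<omega>
  have cylP: "measure M (cyl n \<omega>) \<le> C * C' * exp (real n * (P' - P)) * measure M' (cyl n \<omega>)"
    if "C > 0" "C' > 0" and "measure M (cyl n \<omega>) / exp (- real n * P + S n \<omega>) \<le> C"
      and "inverse C' \<le> measure M' (cyl n \<omega>) / exp (- real n * P' + S n \<omega>)"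
    for M M' :: "(nat \<Rightarrow> nat) measure" and n \<omega> C C' P P'
  proof -
    have "measure M (cyl n \<omega>) \<le> C * exp (- real n * P + S n \<omega>)"
      using that(3) by (simp add: pos_divide_le_eq)
    also have "\<dots> = C * exp (real n * (P' - P)) * exp (- real n * P' + S n \<omega>)"
      by (simp add: mult_exp_exp algebra_simps)
    also have "\<dots> \<le> C * exp (real n * (P' - P)) * (C' * measure M' (cyl n \<omega>))"
    proof (intro mult_left_mono)
      have "exp (- real n * P' + S n \<omega>) * inverse C' \<le> measure M' (cyl n \<omega>)"
        using that(4) by (simp add: pos_le_divide_eq mult.commute)
      then show "exp (- real n * P' + S n \<omega>) \<le> C' * measure M' (cyl n \<omega>)"
        using \<open>C' > 0\<close> by (simp add: field_simps)
    qed (use that in auto)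
    finally show ?thesis by (simp add: mult.commute mult.left_commute)
  qed
  from \<nu> obtain C P where prob: "prob_space \<nu>" "sets \<nu> = sets \<B>" "space \<nu> = \<Omega>"
    and inv: "\<And>B. B \<in> sets \<nu> \<Longrightarrow> emeasure \<nu> (shift -` B \<inter> space \<nu>) = emeasure \<nu> B"
    and C: "C > 0" "\<And>\<omega> n. \<omega> \<in> \<Omega> \<Longrightarrow> 1 \<le> n \<Longrightarrow> inverse C \<le> measure \<nu> (cyl n \<omega>) / exp (- real n * P + S n \<omega>)
      \<and> measure \<nu> (cyl n \<omega>) / exp (- real n * P + S n \<omega>) \<le> C"
    unfolding is_gibbs_def S_def by blast
  from gibbs[OF f k] obtain C' P'
    where C': "C' > 0" "\<And>\<omega> n. \<omega> \<in> \<Omega> \<Longrightarrow> 1 \<le> n \<Longrightarrow> inverse C' \<le> measure \<mu> (cyl n \<omega>) / exp (- real n * P' + S n \<omega>)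
      \<and> measure \<mu> (cyl n \<omega>) / exp (- real n * P' + S n \<omega>) \<le> C'"
    unfolding is_gibbs_def S_def by blast
  interpret \<nu>: prob_space \<nu> by fact
  have "P' \<le> P"
  proof (rule ccontr)
    assume "\<not> P' \<le> P"
    then have t: "P' - P > 0" by simp
    have "(\<lambda>n. C' * C * exp (P - P') ^ n) \<longlonglongrightarrow> C' * C * 0"
      using t by (intro tendsto_intros LIMSEQ_power_zero) auto
    then have "\<forall>\<^sub>F n in sequentially. C' * C * exp (P - P') ^ n < 1/2"
      by (rule order_tendstoD) simp
    then obtain n0 where n0: "\<And>n. n0 \<le> n \<Longrightarrow> C' * C * exp (P - P') ^ n < 1/2"
      by (auto simp: eventually_sequentially)
    have "measure \<mu> \<Omega> \<le> 1/2 * measure \<nu> \<Omega>"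
    proof (rule cylinder_domination[where n\<^sub>0 = "max 1 n0"])
      fix \<omega> n assume w: "\<omega> \<in> \<Omega>" and n: "max 1 n0 \<le> n"
      have "measure \<mu> (cyl n \<omega>) \<le> C' * C * exp (real n * (P - P')) * measure \<nu> (cyl n \<omega>)"
        using C(2)[OF w] C'(2)[OF w] n by (intro cylP C C') auto
      also have "\<dots> \<le> 1/2 * measure \<nu> (cyl n \<omega>)"
        using n0[of n] n by (intro mult_right_mono) (auto simp: exp_of_nat_mult)
      finally show "measure \<mu> (cyl n \<omega>) \<le> 1/2 * measure \<nu> (cyl n \<omega>)" .
    qed (use prob finite_measure_axioms \<nu>.finite_measure_axioms sets.top[of \<B>] in auto)
    then show False using prob_space \<nu>.prob_space prob(3) by simp
  qed
  have dom: "measure \<nu> B \<le> C * C' * measure \<mu> B" if "B \<in> sets \<B>" for B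
  proof (rule cylinder_domination[where n\<^sub>0 = 1])
    fix \<omega> and n :: nat assume w: "\<omega> \<in> \<Omega>" and n: "1 \<le> n"
    have "measure \<nu> (cyl n \<omega>) \<le> C * C' * exp (real n * (P' - P)) * measure \<mu> (cyl n \<omega>)"
      using C(2)[OF w n] C'(2)[OF w n] by (intro cylP C C') auto
    also have "\<dots> \<le> C * C' * 1 * measure \<mu> (cyl n \<omega>)"
      using \<open>P' \<le> P\<close> C(1) C'(1) by (intro mult_right_mono mult_left_mono) (auto simp: mult_nonneg_nonpos)
    finally show "measure \<nu> (cyl n \<omega>) \<le> C * C' * measure \<mu> (cyl n \<omega>)" by simp
  qed (use prob finite_measure_axioms \<nu>.finite_measure_axioms C(1) C'(1) that in auto)
  show ?thesis
  proof (rule invariant_dominated_unique[OF prob(1,2) _ dom])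
    fix B assume "B \<in> sets \<B>"
    then show "measure \<nu> (shift -` B \<inter> \<Omega>) = measure \<nu> B"
      using inv[of B] prob by (simp add: measure_def)
  qed
qed

lemma gibbs_measure_eq:
  assumes "f \<in> locally_constant N A 2" "kernel_of f q"
  shows "gibbs_measure N A f = \<mu>"
  unfolding gibbs_measure_def using gibbs gibbs_unique assms by (intro the_equality) auto

end

context markov_shift
begin

lemma gibbs_measure_markov:
  assumes "f \<in> locally_constant N A 2" "kernel_of f q"
  shows "markov q (gibbs_measure N A f)"
proof -
  obtain \<mu> where \<mu>: "markov q \<mu>" using ex_markov[of q] assms(2) unfolding kernel_of_def by blast
  interpret markov_measure N A q \<mu> by unfold_locales (rule \<mu>)
  show ?thesis using gibbs_measure_eq[OF assms] \<mu> by simp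
qed

end

subsection \<open>Extending block maps\<close>

text \<open>\<open>K\<close> is the lookahead, the same at all points and for all \<open>n\<close>;
  this uniformity makes the extension from the dense set \<open>D\<close> continuous.\<close>

locale block_map = markov_shift +
  fixes D :: "(nat \<Rightarrow> nat) set" and \<phi> :: "(nat \<Rightarrow> nat) \<Rightarrow> (nat \<Rightarrow> nat)" and K :: nat
  assumes D_subset: "D \<subseteq> \<Omega>"
    and D_dense: "\<omega> \<in> \<Omega> \<Longrightarrow> cyl n \<omega> \<inter> D \<noteq> {}"
    and maps: "\<omega> \<in> D \<Longrightarrow> \<phi> \<omega> \<in> \<Omega>"
    and block: "\<omega> \<in> D \<Longrightarrow> \<eta> \<in> D \<Longrightarrow> (\<And>k. k < n + K \<Longrightarrow> \<eta> k = \<omega> k) \<Longrightarrow> k < n \<Longrightarrow> \<phi> \<eta> k = \<phi> \<omega> k"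
begin

text \<open>Each symbol is read off separately from a point of \<open>D\<close> that agrees with
  \<open>\<omega>\<close> far enough; by \<open>block\<close> the point chosen does not
  matter.\<close>

definition extension :: "(nat \<Rightarrow> nat) \<Rightarrow> (nat \<Rightarrow> nat)" where
  "extension \<omega> n = \<phi> (SOME \<eta>. \<eta> \<in> D \<and> \<eta> \<in> cyl (Suc n + K) \<omega>) n"

lemma approx: "\<omega> \<in> \<Omega> \<Longrightarrow> \<exists>\<eta>. \<eta> \<in> D \<and> \<eta> \<in> cyl n \<omega>"
  using D_dense by blast

lemma extension_eq:
  assumes "\<omega> \<in> \<Omega>" "\<eta> \<in> D" "\<And>k. k < n + K \<Longrightarrow> \<eta> k = \<omega> k" "k < n"
  shows "extension \<omega> k = \<phi> \<eta> k"
proof -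
  let ?\<zeta> = "SOME \<eta>. \<eta> \<in> D \<and> \<eta> \<in> cyl (Suc k + K) \<omega>"
  have "?\<zeta> \<in> D \<and> ?\<zeta> \<in> cyl (Suc k + K) \<omega>" by (rule someI_ex[OF approx[OF assms(1)]])
  then have z: "?\<zeta> \<in> D" "\<And>l. l < Suc k + K \<Longrightarrow> ?\<zeta> l = \<omega> l" by (auto simp: mem_cyl)
  have "\<phi> ?\<zeta> k = \<phi> \<eta> k"
    by (rule block[where n = "Suc k"]) (use assms z in auto)
  then show ?thesis by (simp add: extension_def)
qed

lemma extension_on: "\<omega> \<in> D \<Longrightarrow> extension \<omega> = \<phi> \<omega>"
proof
  fix n assume "\<omega> \<in> D"
  then show "extension \<omega> n = \<phi> \<omega> n" using D_subset by (intro extension_eq[where n = "Suc n"]) auto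
qed

lemma extension_block:
  assumes "\<omega> \<in> \<Omega>" "\<eta> \<in> \<Omega>" "\<And>k. k < n + K \<Longrightarrow> \<eta> k = \<omega> k" "k < n"
  shows "extension \<eta> k = extension \<omega> k"
proof -
  obtain \<zeta> where z: "\<zeta> \<in> D" "\<zeta> \<in> cyl (n + K) \<omega>" using approx[OF assms(1)] by blast
  then have "extension \<omega> k = \<phi> \<zeta> k" "extension \<eta> k = \<phi> \<zeta> k"
    using assms by (auto intro!: extension_eq[where n = n] simp: mem_cyl)
  then show ?thesis by simp
qed

lemma extension_in: "\<omega> \<in> \<Omega> \<Longrightarrow> extension \<omega> \<in> \<Omega>"
  unfolding shift_space_iff[of "extension \<omega>"]
proof
  fix n assume w: "\<omega> \<in> \<Omega>"
  obtain \<eta> where "\<eta> \<in> D" "\<eta> \<in> cyl (Suc (Suc n) + K) \<omega>" using approx[OF w] by blast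
  then have "extension \<omega> n = \<phi> \<eta> n" "extension \<omega> (Suc n) = \<phi> \<eta> (Suc n)" "\<phi> \<eta> \<in> \<Omega>"
    using w maps by (auto intro!: extension_eq[where n = "Suc (Suc n)"] simp: mem_cyl)
  then show "edge (extension \<omega> n) (extension \<omega> (Suc n))" using shift_space_edge by simp
qed

lemma continuous_extension: "continuous_map (shift_topology N A) (shift_topology N A) extension"
  unfolding continuous_map_def
proof (intro conjI allI impI)
  fix U assume U: "openin (shift_topology N A) U"
  have "\<exists>n. cyl n \<omega> \<subseteq> {x \<in> \<Omega>. extension x \<in> U}" if w: "\<omega> \<in> \<Omega>" "extension \<omega> \<in> U" for \<omega>
  proof -
    obtain n where n: "cyl n (extension \<omega>) \<subseteq> U" using U w unfolding openin_shift_iff by blast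
    have "cyl (n + K) \<omega> \<subseteq> {x \<in> \<Omega>. extension x \<in> U}"
    proof
      fix \<eta> assume e: "\<eta> \<in> cyl (n + K) \<omega>"
      then have "\<eta> \<in> \<Omega>" "\<And>k. k < n \<Longrightarrow> extension \<eta> k = extension \<omega> k"
        using w by (auto intro!: extension_block[where n = n] simp: mem_cyl)
      then have "extension \<eta> \<in> cyl n (extension \<omega>)" using extension_in by (simp add: mem_cyl)
      with n \<open>\<eta> \<in> \<Omega>\<close> show "\<eta> \<in> {x \<in> \<Omega>. extension x \<in> U}" by blast
    qed
    then show ?thesis by blast
  qed
  then show "openin (shift_topology N A) {x \<in> topspace (shift_topology N A). extension x \<in> U}"
    unfolding openin_shift_iff by auto
qed (simp add: extension_in)

lemma extension_shift:
  assumes "\<And>\<omega>. \<omega> \<in> D \<Longrightarrow> shift \<omega> \<in> D \<and> \<phi> (shift \<omega>) = shift (\<phi> \<omega>)" and w: "\<omega> \<in> \<Omega>"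
  shows "extension (shift \<omega>) = shift (extension \<omega>)"
proof
  fix n
  obtain \<eta> where e: "\<eta> \<in> D" "\<eta> \<in> cyl (Suc (Suc n) + K) \<omega>" using approx[OF w] by blast
  then have "extension \<omega> (Suc n) = \<phi> \<eta> (Suc n)"
    using w by (intro extension_eq[where n = "Suc (Suc n)"]) (auto simp: mem_cyl)
  moreover have "extension (shift \<omega>) n = \<phi> (shift \<eta>) n"
    using w e assms(1) shift_in by (intro extension_eq[where n = "Suc n"]) (auto simp: mem_cyl shift_def)
  ultimately show "extension (shift \<omega>) n = shift (extension \<omega>) n"
    using assms(1)[OF e(1)] by (simp add: shift_def)
qed

end

lemma (in markov_shift) extension_inverse:
  assumes "block_map N A D \<phi> K" "block_map N A D' \<psi> K'"
    and inv: "\<And>\<omega>. \<omega> \<in> D \<Longrightarrow> \<phi> \<omega> \<in> D' \<and> \<psi> (\<phi> \<omega>) = \<omega>" and w: "\<omega> \<in> \<Omega>"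
  shows "block_map.extension N A D' \<psi> K' (block_map.extension N A D \<phi> K \<omega>) = \<omega>"
proof
  interpret F: block_map N A D \<phi> K by fact
  interpret G: block_map N A D' \<psi> K' by fact
  fix n
  \<comment> \<open>One approximating point serves both extensions: \<open>K\<close> symbols are
    lost by \<open>\<phi>\<close> and \<open>K'\<close> more by \<open>\<psi>\<close>.\<close>
  obtain \<eta> where e: "\<eta> \<in> D" "\<eta> \<in> cyl (Suc n + K' + K) \<omega>" using F.approx[OF w] by blast
  then have "\<phi> \<eta> k = F.extension \<omega> k" if "k < Suc n + K'" for k
    using w that by (intro F.extension_eq[symmetric, where n = "Suc n + K'"]) (auto simp: mem_cyl)
  then have "G.extension (F.extension \<omega>) n = \<psi> (\<phi> \<eta>) n"
    using F.extension_in[OF w] inv[OF e(1)] by (intro G.extension_eq[where n = "Suc n"]) auto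
  also have "\<dots> = \<omega> n" using inv[OF e(1)] e(2) by (simp add: mem_cyl)
  finally show "G.extension (F.extension \<omega>) n = \<omega> n" .
qed

subsection \<open>Isomorphisms\<close>

context markov_measure
begin

text \<open>Cylinders have positive measure, so none fits into a null set.\<close>

lemma full_measure_dense:
  assumes "X \<in> sets \<B>" "measure \<mu> X = 1" "\<omega> \<in> \<Omega>"
  shows "cyl n \<omega> \<inter> X \<noteq> {}"
proof
  assume "cyl n \<omega> \<inter> X = {}"
  then have "cyl n \<omega> \<subseteq> \<Omega> - X" using cyl_subset by blast
  then have "measure \<mu> (cyl n \<omega>) \<le> measure \<mu> (\<Omega> - X)"
    using assms(1) sets.compl_sets[of X \<B>] by (intro finite_measure_mono) auto
  also have "\<dots> = 0" using prob_compl[of X] assms by simp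
  finally show False using measure_cyl_pos[OF assms(3), of n] by simp
qed

lemma measure_Int_full:
  assumes "D \<in> sets \<B>" "measure \<mu> D = 1" "B \<in> sets \<B>"
  shows "measure \<mu> (B \<inter> D) = measure \<mu> B"
proof -
  have "B \<subseteq> \<Omega>" using sets.sets_into_space[OF assms(3)] by simp
  then have "measure \<mu> (B - D) \<le> measure \<mu> (\<Omega> - D)"
    using assms(1) sets.compl_sets[of D \<B>] by (intro finite_measure_mono) auto
  also have "\<dots> = 0" using prob_compl[of D] assms by simp
  finally have "measure \<mu> (B - D) = 0" using measure_nonneg[of \<mu> "B - D"] by linarith
  then show ?thesis using finite_measure_Diff'[of B D] assms by simp
qed

text \<open>On paths through a fixed first edge the shift is injective, with prefixing by
  \<open>i\<close> as inverse. The image is therefore a preimage under a Borel map, intersected with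
  \<open>start j\<close>, and \<open>measure_branch\<close> relates the measures.\<close>

lemma measure_shift_image:
  assumes B: "B \<in> sets \<B>" "B \<subseteq> {\<omega> \<in> \<Omega>. \<omega> 0 = i \<and> \<omega> 1 = j}" and e: "edge i j"
  shows "shift ` B \<in> sets \<B>" "measure \<mu> B = q i j * measure \<mu> (shift ` B)"
proof -
  \<comment> \<open>Off \<open>start j\<close> the map is the identity, so that it sends
    \<open>\<Omega>\<close> into itself.\<close>
  define g where "g \<eta> = (if \<eta> \<in> start j then case_nat i \<eta> else \<eta>)" for \<eta>
  have cons: "case_nat i \<eta> \<in> \<Omega>" if "\<eta> \<in> start j" for \<eta>
    using that e cons_in_shift_space by (simp add: start_def)
  have "g \<in> \<B> \<rightarrow>\<^sub>M \<B>"
  proof (rule measurable_shift_borelI)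
    show "g x \<in> \<Omega>" if "x \<in> space \<B>" for x using that cons by (simp add: g_def)
    fix n \<omega>
    have "cyl (Suc n) \<eta> \<subseteq> {\<eta> \<in> start j. case_nat i \<eta> \<in> cyl n \<omega>}"
      if \<eta>: "\<eta> \<in> start j" "case_nat i \<eta> \<in> cyl n \<omega>" for \<eta>
    proof
      fix \<zeta> assume z: "\<zeta> \<in> cyl (Suc n) \<eta>"
      then have "\<zeta> \<in> start j" using \<eta>(1) by (simp add: mem_start mem_cyl)
      moreover have "case_nat i \<zeta> k = \<omega> k" if "k < n" for k
      proof -
        have "case_nat i \<zeta> k = case_nat i \<eta> k" using z that by (cases k) (auto simp: mem_cyl)
        also have "\<dots> = \<omega> k" using \<eta>(2) that by (simp add: mem_cyl)
        finally show ?thesis .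
      qed
      ultimately show "\<zeta> \<in> {\<eta> \<in> start j. case_nat i \<eta> \<in> cyl n \<omega>}"
        using cons by (simp add: mem_cyl)
    qed
    then have "openin (shift_topology N A) {\<eta> \<in> start j. case_nat i \<eta> \<in> cyl n \<omega>}"
      unfolding openin_shift_iff by (fastforce simp: start_def)
    then have "{\<eta> \<in> start j. case_nat i \<eta> \<in> cyl n \<omega>} \<in> sets \<B>" unfolding sets_shift_borel_open by auto
    moreover have "g -` cyl n \<omega> \<inter> space \<B>
        = {\<eta> \<in> start j. case_nat i \<eta> \<in> cyl n \<omega>} \<union> (cyl n \<omega> - start j)"
    proof (intro Set.set_eqI)
      fix \<eta>
      show "\<eta> \<in> g -` cyl n \<omega> \<inter> space \<B> \<longleftrightarrow>
          \<eta> \<in> {\<eta> \<in> start j. case_nat i \<eta> \<in> cyl n \<omega>} \<union> (cyl n \<omega> - start j)"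
        using cyl_subset[of n \<omega>] by (cases "\<eta> \<in> start j") (auto simp: g_def mem_start)
    qed
    ultimately show "g -` cyl n \<omega> \<inter> space \<B> \<in> sets \<B>" by simp
  qed
  then have "g -` B \<inter> \<Omega> \<in> sets \<B>" using measurable_sets[of g \<B> \<B> B] B by simp
  then have W: "start j \<inter> (g -` B \<inter> \<Omega>) \<in> sets \<B>" by simp
  have eq: "shift ` B = start j \<inter> (g -` B \<inter> \<Omega>)"
  proof (intro Set.set_eqI iffI)
    fix \<eta> assume "\<eta> \<in> shift ` B"
    then obtain \<omega> where w: "\<omega> \<in> B" "\<eta> = shift \<omega>" by blast
    then have "\<omega> \<in> \<Omega>" "\<omega> 0 = i" "\<omega> 1 = j" using B by auto
    then have "\<eta> \<in> start j" "case_nat i \<eta> = \<omega>"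
      using w(2) shift_in cons_shift[of \<omega>] by (auto simp: start_def shift_def)
    then show "\<eta> \<in> start j \<inter> (g -` B \<inter> \<Omega>)" using w(1) by (simp add: g_def start_def)
  next
    fix \<eta> assume "\<eta> \<in> start j \<inter> (g -` B \<inter> \<Omega>)"
    then have "case_nat i \<eta> \<in> B" by (auto simp: g_def)
    then show "\<eta> \<in> shift ` B" by (intro image_eqI[of _ _ "case_nat i \<eta>"]) auto
  qed
  show s: "shift ` B \<in> sets \<B>" unfolding eq by (rule W)
  have "start i \<inter> shift -` (start j \<inter> shift ` B) = B"
  proof (intro Set.set_eqI iffI)
    fix \<omega> assume "\<omega> \<in> start i \<inter> shift -` (start j \<inter> shift ` B)"
    then obtain \<eta> where "\<eta> \<in> B" "shift \<omega> = shift \<eta>" "\<omega> 0 = i" by (auto simp: mem_start)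
    then have "\<omega> = \<eta>" using B(2) by (metis (mono_tags, lifting) cons_shift mem_Collect_eq subsetD)
    with \<open>\<eta> \<in> B\<close> show "\<omega> \<in> B" by simp
  next
    fix \<omega> assume w: "\<omega> \<in> B"
    then have "\<omega> \<in> start i" "shift \<omega> 0 = j" using B(2) by (auto simp: mem_start shift_def)
    then show "\<omega> \<in> start i \<inter> shift -` (start j \<inter> shift ` B)"
      using w shift_in by (simp add: mem_start)
  qed
  moreover have "start j \<inter> shift ` B = shift ` B" unfolding eq by blast
  ultimately show "measure \<mu> B = q i j * measure \<mu> (shift ` B)"
    using measure_branch[OF s, of i j] by simp
qed

end

section \<open>Recovering paths from kernel values\<close>

context markov_shift
begin

text \<open>If the last \<open>m\<close> steps of a path were all forced, it would be the only path of length \<open>m\<close>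
  to its endpoint, contradicting aperiodicity.\<close>

lemma ex_unforced_edge:
  assumes q: "kernel q" and m: "\<And>i j. i \<in> states \<Longrightarrow> j \<in> states \<Longrightarrow> (edge ^^ m) i j"
    and w: "\<omega> \<in> \<Omega>"
  shows "\<exists>k\<ge>n. k < n + m \<and> q (\<omega> k) (\<omega> (Suc k)) \<noteq> 1"
proof (rule ccontr)
  assume "\<not> ?thesis"
  then have forced: "q (\<omega> (n + k)) (\<omega> (Suc (n + k))) = 1" if "k < m" for k using that by auto
  have "i = \<omega> n" if "(edge ^^ k) i (\<omega> (n + k))" "k \<le> m" for i k
    using that
  proof (induction k)
    case (Suc k)
    then obtain i' where "(edge ^^ k) i i'" "edge i' (\<omega> (Suc (n + k)))" by auto
    moreover have "i' = \<omega> (n + k)"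
      using kernel_eq_1_iff[OF q shift_space_edge[OF w, of "n + k"]] forced[of k] Suc.prems calculation by auto
    ultimately show ?case using Suc by simp
  qed simp
  then have "i = \<omega> n" if "i \<in> states" for i
    using m[OF that shift_space_states[OF w]] by blast
  from this[of 1] this[of 2] show False using two_le_N by simp
qed

text \<open>Some edge with index from \<open>n\<close> to \<open>n + m - 1\<close> is unforced, and
  its value identifies it. Induction runs downwards from there, using separation at unforced edges
  and uniqueness of the predecessor at forced ones.\<close>

lemma block_determined:
  assumes q: "kernel q" "separating q" and m: "\<And>i j. i \<in> states \<Longrightarrow> j \<in> states \<Longrightarrow> (edge ^^ m) i j"
    and w: "\<omega> \<in> \<Omega>" "\<eta> \<in> \<Omega>"
    and eq: "\<And>k. k < n + m \<Longrightarrow> q (\<omega> k) (\<omega> (Suc k)) = q (\<eta> k) (\<eta> (Suc k))"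
    and k: "k \<le> n"
  shows "\<omega> k = \<eta> k"
proof -
  obtain l where l: "n \<le> l" "l < n + m" "q (\<omega> l) (\<omega> (Suc l)) \<noteq> 1"
    using ex_unforced_edge[OF q(1) m w(1)] by blast
  note E = shift_space_edge[OF w(1)] shift_space_edge[OF w(2)]
  have step: "\<omega> j = \<eta> j" if "q (\<omega> j) (\<omega> (Suc j)) \<noteq> 1" "j < n + m" for j
    using q(2) E eq[OF that(2)] that(1) unfolding separating_def by blast
  have "k \<le> l" using k l by simp
  then show ?thesis
  proof (induction rule: inc_induct)
    case base
    then show ?case using step l by blast
  next
    case (step j)
    show ?case
    proof (cases "q (\<omega> j) (\<omega> (Suc j)) = 1")
      case True
      then show ?thesis using kernel_eq_1_iff[OF q(1) E(1)] E(2)[of j] step.IH by metis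
    next
      case False
      then show ?thesis using \<open>\<And>j. q (\<omega> j) (\<omega> (Suc j)) \<noteq> 1 \<Longrightarrow> j < n + m \<Longrightarrow> \<omega> j = \<eta> j\<close> step l by simp
    qed
  qed
qed

text \<open>The unforced edges \<open>E1\<close> are the same for both kernels, and both kernels
  have the same set of values on them. As \<open>q\<close> is injective on \<open>E1\<close>, that
  set has as many elements as \<open>E1\<close>, so \<open>q'\<close> is injective as well.\<close>

lemma separating_transfer:
  assumes q: "kernel q" "kernel q'" "separating q"
    and vals: "(\<lambda>(i, j). q i j) ` {(i, j). edge i j} = (\<lambda>(i, j). q' i j) ` {(i, j). edge i j}"
  shows "separating q'"
proof -
  let ?E = "{(i, j). edge i j}" and ?q = "\<lambda>(i, j). q i j" and ?q' = "\<lambda>(i, j). q' i j"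
  define E1 where "E1 = {e \<in> ?E. ?q e \<noteq> 1}"
  have "q i j = 1 \<longleftrightarrow> q' i j = 1" if "edge i j" for i j
    using kernel_eq_1_iff[OF q(1) that] kernel_eq_1_iff[OF q(2) that] by simp
  then have E1': "E1 = {e \<in> ?E. ?q' e \<noteq> 1}" unfolding E1_def by auto
  have image_neq: "f ` {e \<in> S. f e \<noteq> 1} = f ` S - {1}" for f :: "nat \<times> nat \<Rightarrow> real" and S
    by auto
  have fin: "finite E1" using finite_edges by (rule rev_finite_subset) (auto simp: E1_def)
  have "?q' ` E1 = ?q' ` ?E - {1}" unfolding E1' by (rule image_neq)
  also have "\<dots> = ?q ` ?E - {1}" by (simp only: vals)
  also have "\<dots> = ?q ` E1" unfolding E1_def by (rule image_neq[symmetric])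
  finally have "?q' ` E1 = ?q ` E1" .
  moreover have "inj_on ?q E1"
    using q(3) unfolding separating_def E1_def inj_on_def by auto
  then have "card (?q ` E1) = card E1" by (rule card_image)
  ultimately have inj: "inj_on ?q' E1" using fin by (intro eq_card_imp_inj_on) simp_all
  show ?thesis unfolding separating_def
  proof (intro allI impI, elim conjE)
    fix i j i' j' assume "edge i j" "edge i' j'" "q' i j = q' i' j'" "q' i j \<noteq> 1"
    then have "(i, j) \<in> E1" "(i', j') \<in> E1" "?q' (i, j) = ?q' (i', j')" unfolding E1' by auto
    then have "(i, j) = (i', j')" using inj unfolding inj_on_def by blast
    then show "i = i' \<and> j = j'" by simp
  qed
qed

text \<open>Replaces measurability between restricted spaces by statements about Borel sets of the
  whole space; images under \<open>\<Phi>\<close> are Borel as preimages under its inverse.\<close>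

lemma isomorphic_obtain:
  assumes "isomorphic N A \<mu> \<nu>" "prob_space \<mu>" "prob_space \<nu>" "sets \<mu> = sets \<B>" "sets \<nu> = sets \<B>"
  obtains X Y \<Phi> where "X \<in> sets \<B>" "Y \<in> sets \<B>" "bij_betw \<Phi> X Y" "shift ` X \<subseteq> X"
    "measure \<mu> X = 1" "measure \<nu> Y = 1"
    "\<And>B. B \<in> sets \<B> \<Longrightarrow> {\<omega> \<in> X. \<Phi> \<omega> \<in> B} \<in> sets \<B>"
    "\<And>B. B \<in> sets \<B> \<Longrightarrow> B \<subseteq> X \<Longrightarrow> \<Phi> ` B \<in> sets \<B> \<and> measure \<mu> B = measure \<nu> (\<Phi> ` B)"
    "\<And>\<omega>. \<omega> \<in> X \<Longrightarrow> \<Phi> (shift \<omega>) = shift (\<Phi> \<omega>)"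
  using assms(1) unfolding isomorphic_def
proof (elim bexE exE conjE)
  fix X Y \<Phi>
  assume iso: "X \<in> sets \<B>" "Y \<in> sets \<B>" "bij_betw \<Phi> X Y" "shift ` X \<subseteq> X" "shift ` Y \<subseteq> Y"
    "emeasure \<mu> X = 1" "emeasure \<nu> Y = 1"
    "\<Phi> \<in> restrict_space \<B> X \<rightarrow>\<^sub>M restrict_space \<B> Y"
    "the_inv_into X \<Phi> \<in> restrict_space \<B> Y \<rightarrow>\<^sub>M restrict_space \<B> X"
    "\<forall>\<omega>\<in>X. \<Phi> (shift \<omega>) = shift (\<Phi> \<omega>)"
    "\<forall>B\<in>sets \<B>. B \<subseteq> X \<longrightarrow> emeasure \<mu> B = emeasure \<nu> (\<Phi> ` B)"
  have sub: "X \<subseteq> \<Omega>" "Y \<subseteq> \<Omega>"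
    using sets.sets_into_space[OF iso(1)] sets.sets_into_space[OF iso(2)] by simp_all
  have sp: "space (restrict_space \<B> X) = X" "space (restrict_space \<B> Y) = Y"
    using sub by (auto simp: space_restrict_space)
  have in_sets: "B \<in> sets (restrict_space \<B> Z) \<longleftrightarrow> B \<subseteq> Z \<and> B \<in> sets \<B>" if "Z \<in> sets \<B>" for B Z
    using that sets.sets_into_space[OF that] by (subst sets_restrict_space_iff) (auto simp: Int_absorb2)
  have pre: "{\<omega> \<in> X. \<Phi> \<omega> \<in> B} \<in> sets \<B>" if B: "B \<in> sets \<B>" for B
  proof -
    have "\<Phi> -` (B \<inter> Y) \<inter> X \<in> sets (restrict_space \<B> X)"
      using measurable_sets[OF iso(8), of "B \<inter> Y"] B iso(2) by (simp add: in_sets sp)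
    moreover have "\<Phi> -` (B \<inter> Y) \<inter> X = {\<omega> \<in> X. \<Phi> \<omega> \<in> B}"
      using iso(3) by (auto simp: bij_betw_def)
    ultimately show ?thesis using in_sets[OF iso(1)] by simp
  qed
  have img: "\<Phi> ` B \<in> sets \<B>" if B: "B \<in> sets \<B>" "B \<subseteq> X" for B
  proof -
    have "the_inv_into X \<Phi> -` B \<inter> Y \<in> sets (restrict_space \<B> Y)"
      using measurable_sets[OF iso(9), of B] B iso(1) by (simp add: in_sets sp)
    moreover have "the_inv_into X \<Phi> -` B \<inter> Y = \<Phi> ` B"
    proof (intro Set.set_eqI iffI)
      fix y assume y: "y \<in> the_inv_into X \<Phi> -` B \<inter> Y"
      then have "\<Phi> (the_inv_into X \<Phi> y) = y"
        using f_the_inv_into_f[of \<Phi> X y] iso(3) by (simp add: bij_betw_def)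
      with y show "y \<in> \<Phi> ` B" by (metis IntD1 imageI vimageD)
    next
      fix y assume "y \<in> \<Phi> ` B"
      then obtain x where "x \<in> B" "y = \<Phi> x" by blast
      then show "y \<in> the_inv_into X \<Phi> -` B \<inter> Y"
        using B iso(3) the_inv_into_f_f[of \<Phi> X x] by (auto simp: bij_betw_def)
    qed
    ultimately show ?thesis using in_sets[OF iso(2)] by simp
  qed
  show ?thesis
  proof (rule that[OF iso(1-4)])
    show "measure \<mu> X = 1" "measure \<nu> Y = 1" using iso(6,7) by (simp_all add: measure_def)
    show "\<Phi> ` B \<in> sets \<B> \<and> measure \<mu> B = measure \<nu> (\<Phi> ` B)" if "B \<in> sets \<B>" "B \<subseteq> X" for B
      using img[OF that] iso(11) that by (simp add: measure_def)
    show "\<Phi> (shift \<omega>) = shift (\<Phi> \<omega>)" if "\<omega> \<in> X" for \<omega> using iso(10) that by blast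
  qed (rule pre)
qed

text \<open>The Jacobian \<open>1 / q (\<omega> 0) (\<omega> 1)\<close> of the shift is an isomorphism invariant.\<close>

lemma isomorphism_preserves_kernel:
  assumes \<mu>: "markov q \<mu>" and \<nu>: "markov q' \<nu>"
    and X: "X \<in> sets \<B>" "shift ` X \<subseteq> X" "measure \<mu> X = 1"
    and \<Phi>: "\<Phi> ` X \<subseteq> \<Omega>" "\<And>B. B \<in> sets \<B> \<Longrightarrow> {\<omega> \<in> X. \<Phi> \<omega> \<in> B} \<in> sets \<B>"
      "\<And>B. B \<in> sets \<B> \<Longrightarrow> B \<subseteq> X \<Longrightarrow> \<Phi> ` B \<in> sets \<B> \<and> measure \<mu> B = measure \<nu> (\<Phi> ` B)"
      "\<And>\<omega>. \<omega> \<in> X \<Longrightarrow> \<Phi> (shift \<omega>) = shift (\<Phi> \<omega>)"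
  shows "\<exists>X\<^sub>0\<in>sets \<B>. X\<^sub>0 \<subseteq> X \<and> shift ` X\<^sub>0 \<subseteq> X\<^sub>0 \<and> measure \<mu> X\<^sub>0 = 1 \<and>
    (\<forall>\<omega>\<in>X\<^sub>0. \<forall>k. q (\<omega> k) (\<omega> (Suc k)) = q' (\<Phi> \<omega> k) (\<Phi> \<omega> (Suc k)))"
proof -
  interpret \<mu>: markov_measure N A q \<mu> by unfold_locales (rule \<mu>)
  interpret \<nu>: markov_measure N A q' \<nu> by unfold_locales (rule \<nu>)
  let ?E = "{(i, j). edge i j}"
  define Z where "Z i j = {\<omega> \<in> \<Omega>. \<omega> 0 = i \<and> \<omega> 1 = j}" for i j
  have Z: "Z i j \<in> sets \<B>" for i j
  proof -
    have "Z i j = {\<omega> \<in> \<Omega>. \<omega> 0 = i} \<inter> {\<omega> \<in> \<Omega>. \<omega> 1 = j}" by (auto simp: Z_def)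
    then show ?thesis using coordinate_sets by simp
  qed
  have X\<Omega>: "X \<subseteq> \<Omega>" using sets.sets_into_space[OF X(1)] by simp
  define D where "D e e' = X \<inter> Z (fst e) (snd e) \<inter> {\<omega> \<in> X. \<Phi> \<omega> \<in> Z (fst e') (snd e')}" for e e'
  have D: "D e e' \<in> sets \<B>" for e e' unfolding D_def using X Z \<Phi>(2) by simp
  have null: "measure \<mu> (D e e') = 0"
    if e: "e \<in> ?E" "e' \<in> ?E" "q (fst e) (snd e) \<noteq> q' (fst e') (snd e')" for e e'
  proof -
    let ?D = "D e e'"
    have DX: "?D \<subseteq> X" by (auto simp: D_def)
    have DZ: "?D \<subseteq> {\<omega> \<in> \<Omega>. \<omega> 0 = fst e \<and> \<omega> 1 = snd e}" "edge (fst e) (snd e)"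
      using e by (auto simp: D_def Z_def)
    note s = \<mu>.measure_shift_image[OF D DZ]
    have \<Phi>D: "\<Phi> ` ?D \<in> sets \<B>" "measure \<mu> ?D = measure \<nu> (\<Phi> ` ?D)" using \<Phi>(3)[OF D DX] by auto
    \<comment> \<open>The measure of the image is computed in two ways: by the branch factor of
      \<open>e'\<close> in \<nu>, and by transport to \<mu>, where the branch factor is that of
      \<open>e\<close>. Different factors force the shifted set, and with it \<open>?D\<close>, to
      be null.\<close>
    have "measure \<nu> (\<Phi> ` ?D) = q' (fst e') (snd e') * measure \<nu> (shift ` \<Phi> ` ?D)"
      by (rule \<nu>.measure_shift_image[OF \<Phi>D(1)]; use e in \<open>auto simp: D_def Z_def\<close>)
    also have "shift ` \<Phi> ` ?D = \<Phi> ` shift ` ?D" using \<Phi>(4) DX by (force simp: image_image)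
    also have "measure \<nu> (\<Phi> ` shift ` ?D) = measure \<mu> (shift ` ?D)"
    proof -
      have "shift ` ?D \<subseteq> X" using DX X(2) by blast
      then show ?thesis using \<Phi>(3)[OF s(1)] by simp
    qed
    finally have "(q (fst e) (snd e) - q' (fst e') (snd e')) * measure \<mu> (shift ` ?D) = 0"
      using s(2) \<Phi>D(2) by (auto simp: algebra_simps)
    then show ?thesis using e(3) s(2) by simp
  qed
  define bad where "bad = {(e, e'). e \<in> ?E \<and> e' \<in> ?E \<and> q (fst e) (snd e) \<noteq> q' (fst e') (snd e')}"
  have "finite bad"
    by (rule finite_subset[of _ "?E \<times> ?E"]) (use finite_edges in \<open>auto simp: bad_def\<close>)
  define N0 where "N0 = (\<Union>(e, e')\<in>bad. D e e')"
  have "D e e' \<in> null_sets \<mu>" if "(e, e') \<in> bad" for e e'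
    using null[of e e'] that D by (auto simp: bad_def null_sets_def \<mu>.emeasure_eq_measure)
  then have N0: "N0 \<in> null_sets \<mu>"
    unfolding N0_def using \<open>finite bad\<close> by (intro null_sets_UN') (auto intro: countable_finite)
  then have N0s: "N0 \<in> sets \<B>" by auto
  have mem_N0: "\<omega> \<in> N0 \<longleftrightarrow> q (\<omega> 0) (\<omega> 1) \<noteq> q' (\<Phi> \<omega> 0) (\<Phi> \<omega> 1)" if w: "\<omega> \<in> X" for \<omega>
  proof -
    have "\<omega> \<in> \<Omega>" "\<Phi> \<omega> \<in> \<Omega>" using w X\<Omega> \<Phi>(1) by auto
    then have "edge (\<omega> 0) (\<omega> 1)" "edge (\<Phi> \<omega> 0) (\<Phi> \<omega> 1)"
      using shift_space_edge[of _ 0] by auto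
    then show ?thesis using w \<open>\<omega> \<in> \<Omega>\<close> \<open>\<Phi> \<omega> \<in> \<Omega>\<close>
      by (auto simp: N0_def D_def Z_def bad_def)
  qed
  \<comment> \<open>Removing all preimages of \<open>N0\<close> as well makes the remaining set
    invariant under the shift and gives the equality at every index.\<close>
  define N1 where "N1 = (\<Union>k. (shift ^^ k) -` N0 \<inter> \<Omega>)"
  have "(shift ^^ k) -` N0 \<inter> \<Omega> \<in> null_sets \<mu>" for k
    using \<mu>.measure_shift_pow[OF N0s, of k] preimage_shift_pow_sets[OF N0s, of k] N0
    by (auto simp: null_sets_def \<mu>.emeasure_eq_measure)
  then have N1: "N1 \<in> null_sets \<mu>" unfolding N1_def by (intro null_sets_UN)
  have pow: "(shift ^^ k) \<omega> \<in> X \<and> \<Phi> ((shift ^^ k) \<omega>) = (shift ^^ k) (\<Phi> \<omega>)" if "\<omega> \<in> X" for \<omega> k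
    using that by (induction k) (use X(2) \<Phi>(4) in auto)
  have good: "\<omega> \<in> X - N1 \<longleftrightarrow> \<omega> \<in> X \<and> (\<forall>k. q (\<omega> k) (\<omega> (Suc k)) = q' (\<Phi> \<omega> k) (\<Phi> \<omega> (Suc k)))" for \<omega>
  proof (cases "\<omega> \<in> X")
    case True
    then have "\<omega> \<in> N1 \<longleftrightarrow> (\<exists>k. (shift ^^ k) \<omega> \<in> N0)" using X\<Omega> by (auto simp: N1_def)
    also have "\<dots> \<longleftrightarrow> (\<exists>k. q (\<omega> k) (\<omega> (Suc k)) \<noteq> q' (\<Phi> \<omega> k) (\<Phi> \<omega> (Suc k)))"
      using pow[OF True] by (simp add: mem_N0 shift_pow)
    finally show ?thesis using True by simp
  qed simp
  have "shift ` (X - N1) \<subseteq> X - N1"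
  proof
    fix \<eta> assume "\<eta> \<in> shift ` (X - N1)"
    then obtain \<omega> where w: "\<omega> \<in> X - N1" "\<eta> = shift \<omega>" by blast
    then have "\<omega> \<in> X" "\<And>k. q (\<omega> k) (\<omega> (Suc k)) = q' (\<Phi> \<omega> k) (\<Phi> \<omega> (Suc k))" using good by auto
    then show "\<eta> \<in> X - N1" unfolding good using X(2) \<Phi>(4) w(2) by (auto simp: shift_def)
  qed
  moreover have "measure \<mu> (X - N1) = 1"
    using X N1 by (subst measure_Diff_null_set) auto
  moreover have "X - N1 \<in> sets \<B>" using X(1) N1 by auto
  ultimately show ?thesis using good by blast
qed

text \<open>Separation is known for \<open>q\<close> and is transferred to \<open>q'\<close>, since
  both directions need it: recovering \<open>\<Phi> \<omega>\<close> from the common sequence of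
  kernel values uses \<open>q'\<close>, recovering \<open>\<omega>\<close> from it uses
  \<open>q\<close>.\<close>

lemma isomorphic_imp_equivalent:
  assumes \<mu>: "markov q \<mu>" and \<nu>: "markov q' \<nu>" and sep: "separating q"
    and iso: "isomorphic N A \<mu> \<nu>"
  shows "equivalent N A \<mu> \<nu>"
proof -
  interpret \<mu>: markov_measure N A q \<mu> by unfold_locales (rule \<mu>)
  interpret \<nu>: markov_measure N A q' \<nu> by unfold_locales (rule \<nu>)
  obtain X Y \<Phi> where X: "X \<in> sets \<B>" "Y \<in> sets \<B>" "bij_betw \<Phi> X Y" "shift ` X \<subseteq> X"
    "measure \<mu> X = 1" "measure \<nu> Y = 1"
    and pre: "\<And>B. B \<in> sets \<B> \<Longrightarrow> {\<omega> \<in> X. \<Phi> \<omega> \<in> B} \<in> sets \<B>"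
    and img: "\<And>B. B \<in> sets \<B> \<Longrightarrow> B \<subseteq> X \<Longrightarrow> \<Phi> ` B \<in> sets \<B> \<and> measure \<mu> B = measure \<nu> (\<Phi> ` B)"
    and \<Phi>_shift: "\<And>\<omega>. \<omega> \<in> X \<Longrightarrow> \<Phi> (shift \<omega>) = shift (\<Phi> \<omega>)"
    by (rule isomorphic_obtain[OF iso \<mu>.prob_space_axioms \<nu>.prob_space_axioms \<mu>.sets_\<mu> \<nu>.sets_\<mu>]) blast
  have sub: "X \<subseteq> \<Omega>" "Y \<subseteq> \<Omega>"
    using sets.sets_into_space[OF X(1)] sets.sets_into_space[OF X(2)] by simp_all
  have \<Phi>\<Omega>: "\<Phi> ` X \<subseteq> \<Omega>" using X(3) sub by (auto simp: bij_betw_def)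
  obtain D where D: "D \<in> sets \<B>" "D \<subseteq> X" "shift ` D \<subseteq> D" "measure \<mu> D = 1"
    and val: "\<And>\<omega> k. \<omega> \<in> D \<Longrightarrow> q (\<omega> k) (\<omega> (Suc k)) = q' (\<Phi> \<omega> k) (\<Phi> \<omega> (Suc k))"
    using isomorphism_preserves_kernel[OF \<mu> \<nu> X(1,4,5) \<Phi>\<Omega> pre img \<Phi>_shift] by blast
  define D' where "D' = \<Phi> ` D"
  have D': "D' \<in> sets \<B>" "measure \<nu> D' = 1" unfolding D'_def using img[OF D(1,2)] D(4) by auto
  have D\<Omega>: "D \<subseteq> \<Omega>" "D' \<subseteq> \<Omega>" using D(2) sub \<Phi>\<Omega> unfolding D'_def by blast+
  have dense: "cyl n \<omega> \<inter> D \<noteq> {}" "cyl n \<omega> \<inter> D' \<noteq> {}" if "\<omega> \<in> \<Omega>" for n \<omega>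
    using \<mu>.full_measure_dense[OF D(1,4) that] \<nu>.full_measure_dense[OF D' that] by auto
  have witness: "\<exists>\<omega>\<in>S. \<omega> 0 = i \<and> \<omega> 1 = j"
    if S: "\<And>n \<omega>. \<omega> \<in> \<Omega> \<Longrightarrow> cyl n \<omega> \<inter> S \<noteq> {}" and e: "edge i j" for S i j
  proof -
    obtain \<omega> where w: "\<omega> \<in> \<Omega>" "\<omega> 0 = i" "\<omega> 1 = j" using ex_edge_path[OF e] by blast
    obtain \<eta> where "\<eta> \<in> S" "\<eta> \<in> cyl 2 \<omega>" using S[OF w(1), of 2] by blast
    then show ?thesis using w by (intro bexI[of _ \<eta>]) (auto simp: mem_cyl)
  qed
  \<comment> \<open>Every edge begins some path in \<open>D\<close> and some path in
    \<open>D'\<close>, so no value of either kernel is missed.\<close>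
  have vals: "(\<lambda>(i, j). q i j) ` {(i, j). edge i j} = (\<lambda>(i, j). q' i j) ` {(i, j). edge i j}"
  proof (intro equalityI subsetI)
    fix x assume "x \<in> (\<lambda>(i, j). q i j) ` {(i, j). edge i j}"
    then obtain i j where e: "edge i j" "x = q i j" by auto
    obtain \<omega> where w: "\<omega> \<in> D" "\<omega> 0 = i" "\<omega> 1 = j" using witness[OF dense(1) e(1)] by blast
    have "edge (\<Phi> \<omega> 0) (\<Phi> \<omega> 1)" using shift_space_edge[of "\<Phi> \<omega>" 0] w(1) D(2) \<Phi>\<Omega> by auto
    moreover have "x = q' (\<Phi> \<omega> 0) (\<Phi> \<omega> 1)" using val[OF w(1), of 0] w e by simp
    ultimately show "x \<in> (\<lambda>(i, j). q' i j) ` {(i, j). edge i j}" by (intro image_eqI[of _ _ "(\<Phi> \<omega> 0, \<Phi> \<omega> 1)"]) auto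
  next
    fix x assume "x \<in> (\<lambda>(i, j). q' i j) ` {(i, j). edge i j}"
    then obtain i j where e: "edge i j" "x = q' i j" by auto
    obtain \<eta> where \<eta>: "\<eta> \<in> D'" "\<eta> 0 = i" "\<eta> 1 = j" using witness[OF dense(2) e(1)] by blast
    then obtain \<omega> where w: "\<omega> \<in> D" "\<eta> = \<Phi> \<omega>" by (auto simp: D'_def)
    have "edge (\<omega> 0) (\<omega> 1)" using shift_space_edge[of \<omega> 0] w(1) D\<Omega> by auto
    moreover have "x = q (\<omega> 0) (\<omega> 1)" using val[OF w(1), of 0] w \<eta> e by simp
    ultimately show "x \<in> (\<lambda>(i, j). q i j) ` {(i, j). edge i j}" by (intro image_eqI[of _ _ "(\<omega> 0, \<omega> 1)"]) auto
  qed
  have sep': "separating q'" by (rule separating_transfer[OF \<mu>.q \<nu>.q sep vals])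
  obtain m where m: "\<And>i j. i \<in> states \<Longrightarrow> j \<in> states \<Longrightarrow> (edge ^^ m) i j" using primitive by blast
  define \<Psi> where "\<Psi> = the_inv_into X \<Phi>"
  have inj: "inj_on \<Phi> X" using X(3) by (simp add: bij_betw_def)
  have \<Psi>: "\<Psi> (\<Phi> \<omega>) = \<omega>" if "\<omega> \<in> X" for \<omega> unfolding \<Psi>_def by (rule the_inv_into_f_f[OF inj that])
  have \<Phi>D: "\<Phi> \<omega> \<in> \<Omega>" "\<Phi> \<omega> \<in> D'" "\<Psi> (\<Phi> \<omega>) = \<omega>" if "\<omega> \<in> D" for \<omega>
    using that \<Psi> D(2) D\<Omega>(2) by (auto simp: D'_def)
  have \<Psi>D': "\<Psi> \<omega> \<in> D" "\<Phi> (\<Psi> \<omega>) = \<omega>" if "\<omega> \<in> D'" for \<omega>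
    using that \<Phi>D(3) by (auto simp: D'_def)
  \<comment> \<open>The values of the edges with index below \<open>n + m\<close> involve the
    symbols up to index \<open>n + m\<close>, which are \<open>n + Suc m\<close> symbols; hence the
    lookahead \<open>Suc m\<close>.\<close>
  interpret F: block_map N A D \<Phi> "Suc m"
  proof
    fix \<omega> \<eta> n k
    assume w: "\<omega> \<in> D" "\<eta> \<in> D" and agree: "\<And>k. k < n + Suc m \<Longrightarrow> \<eta> k = \<omega> k" and k: "k < n"
    show "\<Phi> \<eta> k = \<Phi> \<omega> k"
    proof (rule block_determined[OF \<nu>.q sep', where n = n and m = m and \<omega> = "\<Phi> \<eta>" and \<eta> = "\<Phi> \<omega>"])
      show "\<Phi> \<eta> \<in> \<Omega>" "\<Phi> \<omega> \<in> \<Omega>" using w D(2) \<Phi>\<Omega> by auto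
      show "q' (\<Phi> \<eta> k) (\<Phi> \<eta> (Suc k)) = q' (\<Phi> \<omega> k) (\<Phi> \<omega> (Suc k))" if "k < n + m" for k
        using val[OF w(1), of k] val[OF w(2), of k] agree[of k] agree[of "Suc k"] that by simp
      show "k \<le> n" using k by simp
    qed (rule m)
  qed (fact D\<Omega>(1), rule dense(1), assumption, rule \<Phi>D)
  interpret G: block_map N A D' \<Psi> "Suc m"
  proof
    fix \<omega>' \<eta>' n k
    assume w': "\<omega>' \<in> D'" "\<eta>' \<in> D'" and agree: "\<And>k. k < n + Suc m \<Longrightarrow> \<eta>' k = \<omega>' k" and k: "k < n"
    obtain \<omega> \<eta> where w: "\<omega> \<in> D" "\<omega>' = \<Phi> \<omega>" "\<eta> \<in> D" "\<eta>' = \<Phi> \<eta>" using w' by (auto simp: D'_def)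
    have "\<eta> k = \<omega> k"
    proof (rule block_determined[OF \<mu>.q sep, where n = n and m = m and \<omega> = \<eta> and \<eta> = \<omega>])
      show "\<eta> \<in> \<Omega>" "\<omega> \<in> \<Omega>" using w D\<Omega> by auto
      show "q (\<eta> k) (\<eta> (Suc k)) = q (\<omega> k) (\<omega> (Suc k))" if "k < n + m" for k
        using val[OF w(1), of k] val[OF w(3), of k] agree[of k] agree[of "Suc k"] that w by simp
      show "k \<le> n" using k by simp
    qed (rule m)
    then show "\<Psi> \<eta>' k = \<Psi> \<omega>' k" using w \<Phi>D(3) by simp
  qed (fact D\<Omega>(2), rule dense(2), assumption, rule subsetD[OF D\<Omega>(1) \<Psi>D'(1)])
  have GF: "G.extension (F.extension \<omega>) = \<omega>" if "\<omega> \<in> \<Omega>" for \<omega>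
    by (rule extension_inverse[OF F.block_map_axioms G.block_map_axioms _ that]) (simp add: \<Phi>D)
  have FG: "F.extension (G.extension \<omega>) = \<omega>" if "\<omega> \<in> \<Omega>" for \<omega>
    by (rule extension_inverse[OF G.block_map_axioms F.block_map_axioms _ that]) (simp add: \<Psi>D')
  have homeo: "homeomorphic_maps (shift_topology N A) (shift_topology N A) F.extension G.extension"
    unfolding homeomorphic_maps_def using F.continuous_extension G.continuous_extension GF FG by simp
  have "F.extension (shift \<omega>) = shift (F.extension \<omega>)" if "\<omega> \<in> \<Omega>" for \<omega>
    using D(2,3) \<Phi>_shift that by (intro F.extension_shift) auto
  moreover have "emeasure \<mu> B = emeasure \<nu> (F.extension ` B)" if B: "B \<in> sets \<B>" for B
  proof -
    have B\<Omega>: "B \<subseteq> \<Omega>" using sets.sets_into_space[OF B] by simp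
    have G_meas: "G.extension \<in> \<B> \<rightarrow>\<^sub>M \<B>"
    proof (rule measurable_shift_borelI)
      fix n \<omega>
      have "openin (shift_topology N A) {x \<in> topspace (shift_topology N A). G.extension x \<in> cyl n \<omega>}"
        by (rule openin_continuous_map_preimage[OF G.continuous_extension openin_cyl])
      moreover have "{x \<in> topspace (shift_topology N A). G.extension x \<in> cyl n \<omega>} = G.extension -` cyl n \<omega> \<inter> space \<B>"
        by auto
      ultimately show "G.extension -` cyl n \<omega> \<inter> space \<B> \<in> sets \<B>"
        unfolding sets_shift_borel_open by auto
    qed (simp add: G.extension_in)
    have "F.extension ` B = G.extension -` B \<inter> \<Omega>"
      using B\<Omega> GF FG F.extension_in by (force simp: image_iff)
    then have FB: "F.extension ` B \<in> sets \<B>" using measurable_sets[OF G_meas B] by simp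
    have BD: "B \<inter> D \<in> sets \<B>" using B D(1) by simp
    \<comment> \<open>Intersecting with the full sets \<open>D\<close> and \<open>D'\<close> reduces
      the claim to \<open>\<Phi>\<close>, with which the extension agrees on
      \<open>D\<close>.\<close>
    have "measure \<mu> B = measure \<mu> (B \<inter> D)" using \<mu>.measure_Int_full[OF D(1,4) B] by simp
    also have "\<dots> = measure \<nu> (\<Phi> ` (B \<inter> D))" using img[OF BD] D(2) by auto
    also have "\<Phi> ` (B \<inter> D) = F.extension ` B \<inter> D'"
    proof -
      have "\<Phi> ` (B \<inter> D) = F.extension ` (B \<inter> D)" using F.extension_on by (intro image_cong) auto
      moreover have "D' = F.extension ` D" unfolding D'_def using F.extension_on by (intro image_cong) auto
      moreover have "inj_on F.extension \<Omega>" by (metis GF inj_onI)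
      ultimately show ?thesis using inj_on_image_Int[of F.extension \<Omega> B D] B\<Omega> D\<Omega> by simp
    qed
    also have "measure \<nu> (F.extension ` B \<inter> D') = measure \<nu> (F.extension ` B)"
      by (rule \<nu>.measure_Int_full[OF D' FB])
    finally show ?thesis by (simp add: \<mu>.emeasure_eq_measure \<nu>.emeasure_eq_measure)
  qed
  ultimately show ?thesis
    unfolding equivalent_def using homeomorphic_maps_imp_map[OF homeo] by blast
qed

text \<open>A conjugating homeomorphism is an isomorphism with \<open>X\<close> and \<open>Y\<close>
  the whole space; its inverse is Borel because it is continuous.\<close>

lemma equivalent_imp_isomorphic:
  assumes "prob_space \<mu>" "prob_space \<nu>" "sets \<mu> = sets \<B>" "sets \<nu> = sets \<B>"
    and "equivalent N A \<mu> \<nu>"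
  shows "isomorphic N A \<mu> \<nu>"
proof -
  obtain \<tau> where \<tau>: "homeomorphic_map (shift_topology N A) (shift_topology N A) \<tau>"
    "\<And>\<omega>. \<omega> \<in> \<Omega> \<Longrightarrow> \<tau> (shift \<omega>) = shift (\<tau> \<omega>)"
    "\<And>B. B \<in> sets \<B> \<Longrightarrow> emeasure \<mu> B = emeasure \<nu> (\<tau> ` B)"
    using assms(5) unfolding equivalent_def by blast
  have bij: "bij_betw \<tau> \<Omega> \<Omega>"
    using homeomorphic_imp_injective_map[OF \<tau>(1)] homeomorphic_imp_surjective_map[OF \<tau>(1)]
    by (simp add: bij_betw_def)
  have meas: "g \<in> \<B> \<rightarrow>\<^sub>M \<B>"
    if "continuous_map (shift_topology N A) (shift_topology N A) g" for g
  proof (rule measurable_shift_borelI)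
    show "g x \<in> \<Omega>" if "x \<in> space \<B>" for x
      using that continuous_map_image_subset_topspace[OF \<open>continuous_map _ _ g\<close>] by auto
    fix n \<omega>
    have "openin (shift_topology N A) {x \<in> topspace (shift_topology N A). g x \<in> cyl n \<omega>}"
      by (rule openin_continuous_map_preimage[OF that openin_cyl])
    moreover have "{x \<in> topspace (shift_topology N A). g x \<in> cyl n \<omega>} = g -` cyl n \<omega> \<inter> space \<B>"
      by auto
    ultimately show "g -` cyl n \<omega> \<inter> space \<B> \<in> sets \<B>" unfolding sets_shift_borel_open by auto
  qed
  obtain \<tau>' where \<tau>': "homeomorphic_maps (shift_topology N A) (shift_topology N A) \<tau> \<tau>'"
    using \<tau>(1) homeomorphic_map_maps by blast
  then have cont: "continuous_map (shift_topology N A) (shift_topology N A) \<tau>"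
    "continuous_map (shift_topology N A) (shift_topology N A) \<tau>'"
    and inv: "\<And>x. x \<in> \<Omega> \<Longrightarrow> \<tau>' (\<tau> x) = x \<and> \<tau> (\<tau>' x) = x"
    unfolding homeomorphic_maps_def by auto
  have \<tau>'_in: "\<tau>' x \<in> \<Omega>" if "x \<in> \<Omega>" for x
    using continuous_map_image_subset_topspace[OF cont(2)] that by auto
  have "the_inv_into \<Omega> \<tau> x = \<tau>' x" if "x \<in> \<Omega>" for x
    using bij inv[OF that] \<tau>'_in[OF that] by (intro the_inv_into_f_eq) (auto simp: bij_betw_def)
  then have "the_inv_into \<Omega> \<tau> \<in> \<B> \<rightarrow>\<^sub>M \<B>"
    using meas[OF cont(2)] by (subst measurable_cong[where g = \<tau>']) auto
  moreover have "restrict_space \<B> \<Omega> = \<B>"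
    using sets.sets_into_space[of _ \<B>] sets.top[of \<B>]
    by (intro measure_eqI) (auto simp: sets_restrict_space_iff emeasure_restrict_space)
  moreover have "emeasure \<mu> \<Omega> = 1" "emeasure \<nu> \<Omega> = 1"
    using prob_space.emeasure_space_1[OF assms(1)] prob_space.emeasure_space_1[OF assms(2)]
      sets_eq_imp_space_eq[OF assms(3)] sets_eq_imp_space_eq[OF assms(4)] by simp_all
  moreover have "\<Omega> \<in> sets \<B>" using sets.top[of \<B>] by simp
  moreover have "shift ` \<Omega> \<subseteq> \<Omega>" using shift_in by blast
  ultimately show ?thesis
    unfolding isomorphic_def using bij \<tau>(2,3) meas[OF cont(1)]
    by (intro bexI[of _ \<Omega>] exI[of _ \<tau>]) auto
qed

text \<open>The Gibbs measure of any \<open>g\<close> is Markov for some kernel, so both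
  implications between the two relations are available once the kernel of \<open>f\<close> is
  separating.\<close>

lemma generic_classes_eq:
  assumes "f \<in> generic"
  shows "equivalence_class N A (locally_constant N A 2) f = isomorphism_class N A (locally_constant N A 2) f"
proof -
  obtain q where q: "f \<in> locally_constant N A 2" "kernel_of f q" "separating q"
    using assms by (auto simp: generic_def)
  have \<mu>: "markov q (gibbs_measure N A f)" by (rule gibbs_measure_markov[OF q(1,2)])
  have "equivalent N A (gibbs_measure N A f) (gibbs_measure N A g)
      \<longleftrightarrow> isomorphic N A (gibbs_measure N A f) (gibbs_measure N A g)"
    if g: "g \<in> locally_constant N A 2" for g
  proof -
    obtain q' where "kernel_of g q'" using ex_kernel_of by blast
    then have \<nu>: "markov q' (gibbs_measure N A g)" by (rule gibbs_measure_markov[OF g])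
    show ?thesis
      using isomorphic_imp_equivalent[OF \<mu> \<nu> q(3)] equivalent_imp_isomorphic \<mu> \<nu>
      unfolding markov_def by blast
  qed
  then show ?thesis by (auto simp: equivalence_class_def isomorphism_class_def)
qed

end

theorem theoremA1:
  fixes N :: nat and A :: "nat mat" and \<C> :: "((nat \<Rightarrow> nat) \<Rightarrow> real) set"
  assumes "N \<ge> 2"
    and "zero_one_matrix N A"
    and "aperiodic N A"
    and "\<C> = locally_constant N A 2"
    and "card {i \<in> {1..N}. out_degree N A i = 1} \<le> 1"
  shows "\<exists>U. U \<subseteq> {f \<in> \<C>. equivalence_class N A \<C> f = isomorphism_class N A \<C> f} \<and>
             openin (function_topology N A \<C>) U \<and>
             (function_topology N A \<C>) closure_of U = \<C>"
proof -
  interpret markov_shift N A by unfold_locales (use assms in auto)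
  show ?thesis
    unfolding \<open>\<C> = _\<close>
    using generic_classes_eq generic_open generic_dense
    by (intro exI[of _ generic]) (auto simp: generic_def)
qed

end
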